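(* Suppose that $\alpha\in\mathbb{R}$ is such that $$\lim_{t\uparrow T} I_{X^{(\alpha)}}(t)=\infty$$ and $$\lim_{t\uparrow T}\frac{1}{\sqrt{I_{X^{(\alpha)}}(t)}}\,\frac{b(t)}{\sigma(t)^2}\int_0^t\sigma(s)^2\exp\left\{2\alpha\int_s^t b(v)\,\mathrm{d}v\right\}\mathrm{d}s=0.$$ Then $$\left(\int_0^t\frac{b(u)^2\,(X_u^{(\alpha)})^2}{\sigma(u)^2}\,\mathrm{d}u\right)^{1/2}\left(\widehat{\alpha}_t^{(X^{(\alpha)})}-\alpha\right)\ \longrightarrow\ \mathcal{N}(0,1)\qquad\text{in distribution as } t\uparrow T.$$
   Context: Let $T\in(0,\infty]$ be fixed. Let $b:[0,T)\to\mathbb{R}$ and $\sigma:[0,T)\to\mathbb{R}$ be continuous functions such that $\sigma(t)>0$ for all $t\in[0,T)$, and there exists $t_0\in(0,T)$ with $b(t)\neq0$ for all $t\in[t_0,T)$. Let $(B_t)_{t\in[0,T)}$ be a standard Wiener process on a filtered probability space $(\Omega,\mathcal{F},(\mathcal{F}_t)_{t\in[0,T)},\mathsf{P})$ constructed with the help of $B$, satisfying the usual conditions, with $\mathcal{F}=\sigma\big(\bigcup_{t\in[0,T)}\mathcal{F}_t\big)$. For $\alpha\in\mathbb{R}$, let $(X_t^{(\alpha)})_{t\in[0,T)}$ be the unique strong solution of $$\mathrm{d}X_t^{(\alpha)}=\alpha b(t)X_t^{(\alpha)}\,\mathrm{d}t+\sigma(t)\,\mathrm{d}B_t,\quad t\in[0,T),\qquad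 X_0^{(\alpha)}=0,$$ that is, $X_t^{(\alpha)}=\int_0^t\sigma(s)\exp\{\alpha\int_s^t b(u)\,\mathrm{d}u\}\,\mathrm{d}B_s$. The maximum likelihood estimator (MLE) $\widehat{\alpha}_t^{(X^{(\alpha)})}$ of $\alpha$ based on $(X_s^{(\alpha)})_{s\in[0,t]}$ is the maximizer over $\theta\in\mathbb{R}$ of the log-likelihood $\theta\int_0^t\frac{b(s)X_s^{(\alpha)}}{\sigma(s)^2}\,\mathrm{d}X_s^{(\alpha)}-\frac{\theta^2}{2}\int_0^t\frac{b(s)^2(X_s^{(\alpha)})^2}{\sigma(s)^2}\,\mathrm{d}s$; for $t\in[t_0,T)$ it exists $\mathsf{P}$-almost surely, is unique, and is given by $$\widehat{\alpha}_t^{(X^{(\alpha)})}=\frac{\int_0^t\frac{b(s)X_s^{(\alpha)}}{\sigma(s)^2}\,\mathrm{d}X_s^{(\alpha)}}{\int_0^t\frac{b(s)^2(X_s^{(\alpha)})^2}{\sigma(s)^2}\,\mathrm{d}s},\quad\text{so that}\quad \widehat{\alpha}_t^{(X^{(\alpha)})}-\alpha=\frac{\int_0^t\frac{b(s)X_s^{(\alpha)}}{\sigma(s)}\,\mathrm{d}B_s}{\int_0^t\frac{b(s)^2(X_s^{(\alpha)})^2}{\sigma(s)^2}\,\mathrm{d}s}.$$ The Fisher information for $\alpha$ contained in $(X_s^{(\alpha)})_{s\in[0,t]}$ is $$I_{X^{(\alpha)}}(t)=\int_0^t\frac{b(s)^2\,\mathsf{E}(X_s^{(\alpha)})^2}{\sigma(s)^2}\,\mathrm{d}s,\qquad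 \mathsf{E}(X_s^{(\alpha)})^2=\int_0^s\sigma(u)^2\exp\Big\{2\alpha\int_u^s b(v)\,\mathrm{d}v\Big\}\,\mathrm{d}u .$$ $\mathcal{N}(0,1)$ denotes the standard normal distribution. *)

theory Defs
  imports "HOL-Probability.Probability"
begin

section \<open>The time interval $[0,T)$ with $T$ in $(0,\infty]$\<close>

definition time_dom :: "ereal \<Rightarrow> real set" where
  "time_dom T = {t. 0 \<le> t \<and> ereal t < T}"

definition up_to :: "ereal \<Rightarrow> real filter" where
  "up_to T = filtermap real_of_ereal (at_left T)"

lemma up_to_ereal: "up_to (ereal r) = at_left r"
  by (simp add: up_to_def at_left_ereal filtermap_filtermap)

lemma up_to_infinity: "up_to \<infinity> = at_top"
  by (simp add: up_to_def at_left_PInf filtermap_filtermap)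


section \<open>Filtered probability spaces and Wiener processes on $[0,T)$\<close>

text \<open>Only \<open>space (F t)\<close> and \<open>sets (F t)\<close> for \<open>t\<close> in \<open>time_dom T\<close> are relevant.\<close>

locale filtered_prob_space = prob_space M for M :: "'a measure" +
  fixes T :: ereal and F :: "real \<Rightarrow> 'a measure"
  assumes T_pos: "0 < T"
    and subalg: "\<And>t. t \<in> time_dom T \<Longrightarrow> subalgebra M (F t)"
    and mono: "\<And>s t. s \<in> time_dom T \<Longrightarrow> t \<in> time_dom T \<Longrightarrow> s \<le> t \<Longrightarrow> sets (F s) \<subseteq> sets (F t)"

definition negligible_sets :: "'a measure \<Rightarrow> 'a set set" where
  "negligible_sets M = {A. \<exists>N\<in>null_sets M. A \<subseteq> N}"

locale usual_conditions = filtered_prob_space +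
  assumes complete: "negligible_sets M \<subseteq> sets (F 0)"
    and right_continuous:
      "\<And>t. t \<in> time_dom T \<Longrightarrow> sets (F t) = (\<Inter>s \<in> {s \<in> time_dom T. t < s}. sets (F s))"

definition adapted :: "ereal \<Rightarrow> (real \<Rightarrow> 'a measure) \<Rightarrow> (real \<Rightarrow> 'a \<Rightarrow> real) \<Rightarrow> bool" where
  "adapted T F X \<longleftrightarrow> (\<forall>t\<in>time_dom T. X t \<in> borel_measurable (F t))"

definition progressive :: "ereal \<Rightarrow> (real \<Rightarrow> 'a measure) \<Rightarrow> (real \<Rightarrow> 'a \<Rightarrow> real) \<Rightarrow> bool" where
  "progressive T F H \<longleftrightarrow> (\<forall>t\<in>time_dom T.
     (\<lambda>(s, \<omega>). H s \<omega>) \<in> borel_measurable (restrict_space borel {0..t} \<Otimes>\<^sub>M F t))"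

definition continuous_paths :: "'a measure \<Rightarrow> ereal \<Rightarrow> (real \<Rightarrow> 'a \<Rightarrow> real) \<Rightarrow> bool" where
  "continuous_paths M T X \<longleftrightarrow> (\<forall>\<omega>\<in>space M. continuous_on (time_dom T) (\<lambda>t. X t \<omega>))"

locale wiener_process = filtered_prob_space +
  fixes B :: "real \<Rightarrow> 'a \<Rightarrow> real"
  assumes B_adapted: "adapted T F B"
    and B_continuous: "continuous_paths M T B"
    and B_0: "AE \<omega> in M. B 0 \<omega> = 0"
    and B_increments_indep: "\<And>s t. s \<in> time_dom T \<Longrightarrow> t \<in> time_dom T \<Longrightarrow> s < t \<Longrightarrow>
      indep_set (sets (F s)) {(\<lambda>\<omega>. B t \<omega> - B s \<omega>) -` A \<inter> space M | A. A \<in> sets borel}"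
    and B_increments_normal: "\<And>s t. s \<in> time_dom T \<Longrightarrow> t \<in> time_dom T \<Longrightarrow> s < t \<Longrightarrow>
      distributed M lborel (\<lambda>\<omega>. B t \<omega> - B s \<omega>) (normal_density 0 (sqrt (t - s)))"

text \<open>The natural filtration of \<open>B\<close>, augmented by the negligible sets of \<open>M\<close>.\<close>

definition augmented_natural_sets :: "'a measure \<Rightarrow> (real \<Rightarrow> 'a \<Rightarrow> real) \<Rightarrow> real \<Rightarrow> 'a set set" where
  "augmented_natural_sets M B t = sigma_sets (space M)
     ({B s -` A \<inter> space M | s A. 0 \<le> s \<and> s \<le> t \<and> A \<in> sets borel} \<union> negligible_sets M)"


section \<open>The It\^o integral\<close>

text \<open>
  Simple integrands are of the form $\sum_{i<n} \xi_i 1_{(p_i, p_{i+1}]}$, with each $\xi_i$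
  bounded and $\mathcal F_{p_i}$-measurable.
\<close>

definition simple_integrand ::
    "'a measure \<Rightarrow> ereal \<Rightarrow> (real \<Rightarrow> 'a measure) \<Rightarrow> nat \<Rightarrow> (nat \<Rightarrow> real) \<Rightarrow> (nat \<Rightarrow> 'a \<Rightarrow> real) \<Rightarrow> bool" where
  "simple_integrand M T F n p \<xi> \<longleftrightarrow>
     (\<forall>i\<le>n. p i \<in> time_dom T) \<and> (\<forall>i<n. p i < p (Suc i)) \<and>
     (\<forall>i<n. \<xi> i \<in> borel_measurable (F (p i)) \<and> (\<exists>C. \<forall>\<omega>\<in>space M. \<bar>\<xi> i \<omega>\<bar> \<le> C))"

definition simple_process ::
    "nat \<Rightarrow> (nat \<Rightarrow> real) \<Rightarrow> (nat \<Rightarrow> 'a \<Rightarrow> real) \<Rightarrow> real \<Rightarrow> 'a \<Rightarrow> real" where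
  "simple_process n p \<xi> s \<omega> = (\<Sum>i<n. \<xi> i \<omega> * indicator {p i<..p (Suc i)} s)"

definition simple_ito_integral ::
    "(real \<Rightarrow> 'a \<Rightarrow> real) \<Rightarrow> nat \<Rightarrow> (nat \<Rightarrow> real) \<Rightarrow> (nat \<Rightarrow> 'a \<Rightarrow> real) \<Rightarrow> real \<Rightarrow> 'a \<Rightarrow> real" where
  "simple_ito_integral B n p \<xi> t \<omega> =
     (\<Sum>i<n. \<xi> i \<omega> * (B (min t (p (Suc i))) \<omega> - B (min t (p i)) \<omega>))"

definition tendsto_in_prob :: "'a measure \<Rightarrow> (nat \<Rightarrow> 'a \<Rightarrow> real) \<Rightarrow> ('a \<Rightarrow> real) \<Rightarrow> bool" where
  "tendsto_in_prob M Y Z \<longleftrightarrow>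
     (\<forall>\<epsilon>>0. (\<lambda>k. measure M {\<omega>\<in>space M. \<epsilon> < \<bar>Y k \<omega> - Z \<omega>\<bar>}) \<longlonglongrightarrow> 0)"

text \<open>
  \<open>is_ito_integral M T F B H I\<close>: the process \<open>I\<close> is (a continuous version of)
  $I_t = \int_0^t H_s\,dB_s$, $t \in [0,T)$, for a progressively measurable \<open>H\<close> with
  $\int_0^t H_s^2\,ds < \infty$ almost surely for all \<open>t\<close>. As usual, $I_t$ is the limit in
  probability of the integrals of simple integrands $H^k$ such that
  $\int_0^t (H^k_s - H_s)^2\,ds \to 0$ in probability. This determines \<open>I\<close> up to
  indistinguishability.
\<close>

definition is_ito_integral ::
    "'a measure \<Rightarrow> ereal \<Rightarrow> (real \<Rightarrow> 'a measure) \<Rightarrow> (real \<Rightarrow> 'a \<Rightarrow> real) \<Rightarrow>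
     (real \<Rightarrow> 'a \<Rightarrow> real) \<Rightarrow> (real \<Rightarrow> 'a \<Rightarrow> real) \<Rightarrow> bool" where
  "is_ito_integral M T F B H I \<longleftrightarrow>
     progressive T F H \<and>
     (\<forall>t\<in>time_dom T. AE \<omega> in M. set_integrable lborel {0..t} (\<lambda>s. (H s \<omega>)\<^sup>2)) \<and>
     adapted T F I \<and> continuous_paths M T I \<and>
     (\<exists>n p \<xi>. (\<forall>k. simple_integrand M T F (n k) (p k) (\<xi> k)) \<and>
        (\<forall>t\<in>time_dom T.
           tendsto_in_prob M
             (\<lambda>k \<omega>. LBINT s:{0..t}. (simple_process (n k) (p k) (\<xi> k) s \<omega> - H s \<omega>)\<^sup>2) (\<lambda>\<omega>. 0) \<and>
           tendsto_in_prob M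
             (\<lambda>k. simple_ito_integral B (n k) (p k) (\<xi> k) t) (I t)))"

text \<open>\<open>X\<close> is a continuous adapted process with $dX_t = a_t\,dt + c_t\,dB_t$.\<close>

definition has_ito_differential ::
    "'a measure \<Rightarrow> ereal \<Rightarrow> (real \<Rightarrow> 'a measure) \<Rightarrow> (real \<Rightarrow> 'a \<Rightarrow> real) \<Rightarrow>
     (real \<Rightarrow> 'a \<Rightarrow> real) \<Rightarrow> (real \<Rightarrow> 'a \<Rightarrow> real) \<Rightarrow> (real \<Rightarrow> 'a \<Rightarrow> real) \<Rightarrow> bool" where
  "has_ito_differential M T F B X a c \<longleftrightarrow>
     adapted T F X \<and> continuous_paths M T X \<and> progressive T F a \<and>
     (\<forall>t\<in>time_dom T. AE \<omega> in M. set_integrable lborel {0..t} (\<lambda>s. a s \<omega>)) \<and>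
     is_ito_integral M T F B c (\<lambda>t \<omega>. X t \<omega> - X 0 \<omega> - (LBINT s:{0..t}. a s \<omega>))"

text \<open>
  \<open>J\<close> is (a continuous version of) the stochastic integral of \<open>H\<close> against a process \<open>X\<close> with
  $dX_t = a_t\,dt + c_t\,dB_t$, that is, $J_t = \int_0^t H_s a_s\,ds + \int_0^t H_s c_s\,dB_s$.
\<close>

definition is_integral_against_ito_process ::
    "'a measure \<Rightarrow> ereal \<Rightarrow> (real \<Rightarrow> 'a measure) \<Rightarrow> (real \<Rightarrow> 'a \<Rightarrow> real) \<Rightarrow>
     (real \<Rightarrow> 'a \<Rightarrow> real) \<Rightarrow> (real \<Rightarrow> 'a \<Rightarrow> real) \<Rightarrow> (real \<Rightarrow> 'a \<Rightarrow> real) \<Rightarrow>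
     (real \<Rightarrow> 'a \<Rightarrow> real) \<Rightarrow> (real \<Rightarrow> 'a \<Rightarrow> real) \<Rightarrow> bool" where
  "is_integral_against_ito_process M T F B X a c H J \<longleftrightarrow>
     has_ito_differential M T F B X a c \<and>
     (\<forall>t\<in>time_dom T. AE \<omega> in M. set_integrable lborel {0..t} (\<lambda>s. H s \<omega> * a s \<omega>)) \<and>
     is_ito_integral M T F B (\<lambda>s \<omega>. H s \<omega> * c s \<omega>)
       (\<lambda>t \<omega>. J t \<omega> - (LBINT s:{0..t}. H s \<omega> * a s \<omega>))"


section \<open>The diffusion, its Fisher information and the maximum likelihood estimator\<close>

text \<open>Strong solutions of $dX_t = \alpha b(t) X_t\,dt + \sigma(t)\,dB_t$, $X_0 = 0$.\<close>

definition is_solution ::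
    "'a measure \<Rightarrow> ereal \<Rightarrow> (real \<Rightarrow> 'a measure) \<Rightarrow> (real \<Rightarrow> 'a \<Rightarrow> real) \<Rightarrow>
     real \<Rightarrow> (real \<Rightarrow> real) \<Rightarrow> (real \<Rightarrow> real) \<Rightarrow> (real \<Rightarrow> 'a \<Rightarrow> real) \<Rightarrow> bool" where
  "is_solution M T F B \<alpha> b \<sigma> X \<longleftrightarrow>
     (AE \<omega> in M. X 0 \<omega> = 0) \<and>
     has_ito_differential M T F B X (\<lambda>t \<omega>. \<alpha> * b t * X t \<omega>) (\<lambda>t \<omega>. \<sigma> t)"

definition fisher_information ::
    "'a measure \<Rightarrow> (real \<Rightarrow> real) \<Rightarrow> (real \<Rightarrow> real) \<Rightarrow> (real \<Rightarrow> 'a \<Rightarrow> real) \<Rightarrow> real \<Rightarrow> real" where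
  "fisher_information M b \<sigma> X t =
     (LBINT s:{0..t}. (b s)\<^sup>2 * prob_space.expectation M (\<lambda>\<omega>. (X s \<omega>)\<^sup>2) / (\<sigma> s)\<^sup>2)"

text \<open>
  In the following two definitions, \<open>J\<close> is to be a version of
  $J_t = \int_0^t b(s) X_s / \sigma(s)^2\,dX_s$.
\<close>

definition log_likelihood ::
    "(real \<Rightarrow> real) \<Rightarrow> (real \<Rightarrow> real) \<Rightarrow> (real \<Rightarrow> 'a \<Rightarrow> real) \<Rightarrow> (real \<Rightarrow> 'a \<Rightarrow> real) \<Rightarrow>
     real \<Rightarrow> 'a \<Rightarrow> real \<Rightarrow> real" where
  "log_likelihood b \<sigma> X J t \<omega> \<theta> =
     \<theta> * J t \<omega> - \<theta>\<^sup>2 / 2 * (LBINT s:{0..t}. (b s)\<^sup>2 * (X s \<omega>)\<^sup>2 / (\<sigma> s)\<^sup>2)"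

definition mle ::
    "(real \<Rightarrow> real) \<Rightarrow> (real \<Rightarrow> real) \<Rightarrow> (real \<Rightarrow> 'a \<Rightarrow> real) \<Rightarrow> (real \<Rightarrow> 'a \<Rightarrow> real) \<Rightarrow>
     real \<Rightarrow> 'a \<Rightarrow> real" where
  "mle b \<sigma> X J t \<omega> = arg_max (log_likelihood b \<sigma> X J t \<omega>) (\<lambda>\<theta>. True)"

lemma mle_eq:
  assumes pos: "(LBINT s:{0..t}. (b s)\<^sup>2 * (X s \<omega>)\<^sup>2 / (\<sigma> s)\<^sup>2) > 0"
  shows "mle b \<sigma> X J t \<omega> = J t \<omega> / (LBINT s:{0..t}. (b s)\<^sup>2 * (X s \<omega>)\<^sup>2 / (\<sigma> s)\<^sup>2)"
proof -
  define Q where "Q = (LBINT s:{0..t}. (b s)\<^sup>2 * (X s \<omega>)\<^sup>2 / (\<sigma> s)\<^sup>2)"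
  define L where "L = log_likelihood b \<sigma> X J t \<omega>"
  have Q: "Q > 0" using pos by (simp add: Q_def)
  have L: "L \<theta> = (J t \<omega>)\<^sup>2 / (2 * Q) - Q / 2 * (\<theta> - J t \<omega> / Q)\<^sup>2" for \<theta>
    using Q by (simp add: L_def log_likelihood_def flip: Q_def)
      (simp add: field_simps power2_eq_square)
  have "is_arg_max L (\<lambda>\<theta>. True) \<theta> \<longleftrightarrow> \<theta> = J t \<omega> / Q" for \<theta>
  proof
    assume "is_arg_max L (\<lambda>\<theta>. True) \<theta>"
    then have "\<not> L (J t \<omega> / Q) > L \<theta>" by (simp add: is_arg_max_def)
    then have "Q / 2 * (\<theta> - J t \<omega> / Q)\<^sup>2 \<le> 0" by (simp add: L)
    with Q show "\<theta> = J t \<omega> / Q" by (simp add: mult_le_0_iff)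
  next
    assume "\<theta> = J t \<omega> / Q"
    with Q show "is_arg_max L (\<lambda>\<theta>. True) \<theta>"
      by (simp add: is_arg_max_def L not_less)
  qed
  then show ?thesis
    by (simp add: mle_def arg_max_def flip: L_def Q_def)
qed


section \<open>Convergence in distribution along a filter\<close>

text \<open>\<^const>\<open>weak_conv_m\<close> for laws of random variables, along an arbitrary filter instead of a
  sequence.\<close>

definition converges_in_distribution ::
    "'a measure \<Rightarrow> ('i \<Rightarrow> 'a \<Rightarrow> real) \<Rightarrow> real measure \<Rightarrow> 'i filter \<Rightarrow> bool" where
  "converges_in_distribution M Z \<mu> G \<longleftrightarrow>
     (\<forall>\<^sub>F t in G. Z t \<in> borel_measurable M) \<and>
     (\<forall>x. isCont (cdf \<mu>) x \<longrightarrow> ((\<lambda>t. cdf (distr M borel (Z t)) x) \<longlongrightarrow> cdf \<mu> x) G)"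

end

theory Submission
  imports Defs
begin

text \<open>
  Write $A_t = \int_0^t b^2 X^2/\sigma^2\,ds$ for the observed information, $I(t) = \mathsf E A_t$ for
  the Fisher information and $N_t = \int_0^t b X/\sigma\,dB$. Inserting $dX$ into the score gives
  $\widehat\alpha_t - \alpha = N_t / A_t$, so the normalized error is $N_t/\sqrt{A_t}$, and
  $A$ is the bracket of the martingale $N$. Two facts give the theorem:
  $A_t / I(t) \to 1$ in probability, and $N_t/\sqrt{I(t)}$ is asymptotically standard normal.

  The central tool is an elementary substitute for the martingale central limit theorem. For a
  predictable step integrand with stochastic integral $R$ and bracket $A$, conditioning on one grid
  point after the other yields $\mathsf E\,e^{iR + A/2} = 1$ (\<open>exponential_martingale\<close>). If $A$ is close to
  a constant $a$, this says that the characteristic function of $R$ is close to $e^{-a/2}$. To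
  control the exponential on the event where $A$ is large, the integrand is switched off just before
  its bracket exceeds $a + \delta$; as this is decided at the left grid point, the integrand stays
  predictable. The resulting bound depends only on the probability of $|A - a| > \delta$, and it
  carries over to It\^o integrals along the approximating sequence that defines them
  (\<open>ito_integral_char_bound\<close>).

  This bound is used twice. For the deterministic integrand $\sigma$ it is an equality and shows
  that $S = \int \sigma\,dB$ has independent Gaussian increments. The rescaled process
  $Y_t = e^{-\alpha \int_0^t b} X_t$ is a limit of Riemann-Stieltjes sums of $S$, by a pathwise computation with
  the equation for $X$; hence $Y$ has independent Gaussian increments as well, with variance function
  $G(t) = \int_0^t e^{-2\alpha\int_0^u b}\sigma(u)^2\,du$ (\<open>Y_increment_char\<close>). Therefore
  $\mathrm{Cov}(Y_u^2, Y_v^2) = 2 G(u \wedge v)^2$, and for every $\varepsilon > 0$ and $t$ close to $T$ the second limit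
  assumption of the theorem bounds the variance of $A_t$ by $4 (K + \varepsilon I(t)) I(t)$, where $K$
  depends on $\varepsilon$ but not on $t$; as $I(t) \to \infty$, Chebyshev's inequality gives $A_t/I(t) \to 1$ (\<open>information_ratio_tendsto\<close>).
  The second use of the bound is for $N/\sqrt{I(t)}$, whose bracket $A_t/I(t)$ is now known to be close to $1$
  (\<open>normalized_martingale_char\<close>). Levy's continuity theorem and a Slutsky argument for dividing by
  $\sqrt{A_t/I(t)}$ finish the proof.
\<close>

section \<open>Exponential martingales of predictable step integrands\<close>

lemma integral_iexp_std_normal:
  "(CLINT x|std_normal_distribution. iexp (c * x)) = complex_of_real (exp (- (c\<^sup>2) / 2))"
  using char_std_normal_distribution by (simp add: char_def fun_eq_iff)

lemma integral_iexp_normal_density: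
  assumes "0 < s"
  shows "(CLINT x|density lborel (normal_density 0 s). iexp (c * x)) = complex_of_real (exp (- (c\<^sup>2 * s\<^sup>2) / 2))"
proof -
  interpret std: prob_space std_normal_distribution
    by (rule prob_space_normal_density) simp
  have id: "distributed std_normal_distribution lborel (\<lambda>x. x) std_normal_density"
    by (auto simp: distributed_def distr_id2)
  have "distributed std_normal_distribution lborel (\<lambda>x. 0 + x * s) (normal_density (0 + 0 * s) (\<bar>s\<bar> * 1))"
    using std.normal_density_affine[OF id, of s 0] assms by (simp add: mult.commute)
  then have "density lborel (normal_density 0 s) = distr std_normal_distribution lborel (\<lambda>x. x * s)"
    using assms by (simp add: distributed_def)
  then have "(CLINT x|density lborel (normal_density 0 s). iexp (c * x)) = (CLINT x|std_normal_distribution. iexp ((c * s) * x))"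
    by (simp add: integral_distr ac_simps)
  then show ?thesis unfolding integral_iexp_std_normal by (simp add: power_mult_distrib)
qed

context wiener_process
begin

lemma space_F: "t \<in> time_dom T \<Longrightarrow> space (F t) = space M"
  using subalg by (auto simp: subalgebra_def)

lemma measurable_F_mono: "s \<in> time_dom T \<Longrightarrow> t \<in> time_dom T \<Longrightarrow> s \<le> t \<Longrightarrow> f \<in> measurable (F s) N \<Longrightarrow> f \<in> measurable (F t) N"
  using mono[of s t] by (auto simp: measurable_def space_F)

lemma measurable_F_M: "t \<in> time_dom T \<Longrightarrow> f \<in> measurable (F t) N \<Longrightarrow> f \<in> measurable M N"
  using subalg[of t] by (rule measurable_from_subalg)

lemma B_measurable_F: "t \<in> time_dom T \<Longrightarrow> B t \<in> borel_measurable (F t)"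
  using B_adapted by (auto simp: adapted_def)

text \<open>
  Given the past up to \<open>q\<close>, the increment of \<open>B\<close> is centred normal with variance \<open>q' - q\<close>, so the
  conditional expectation of the exponential factor is the characteristic function of a normal law
  times its own inverse. Conditioning is carried out by Fubini on the product of \<open>F q\<close> with the law
  of the increment.
\<close>
lemma exponential_step:
  fixes U :: "'a \<Rightarrow> complex"
  assumes q: "q \<in> time_dom T" "q' \<in> time_dom T" "q \<le> q'"
    and U: "U \<in> borel_measurable (F q)" and UK: "\<And>\<omega>. \<omega> \<in> space M \<Longrightarrow> norm (U \<omega>) \<le> K"
    and \<xi>: "\<xi> \<in> borel_measurable (F q)" and \<xi>C: "\<And>\<omega>. \<omega> \<in> space M \<Longrightarrow> \<bar>\<xi> \<omega>\<bar> \<le> C"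
  shows "(CLINT \<omega>|M. U \<omega> * (iexp (\<xi> \<omega> * (B q' \<omega> - B q \<omega>)) * of_real (exp ((\<xi> \<omega>)\<^sup>2 * (q' - q) / 2)))) = (CLINT \<omega>|M. U \<omega>)"
proof (cases "q = q'")
  case True then show ?thesis by simp
next
  case False
  with q have lt: "q < q'" by simp
  define D where "D = (\<lambda>\<omega>. B q' \<omega> - B q \<omega>)"
  have Dm[measurable]: "D \<in> borel_measurable M"
    unfolding D_def using measurable_F_M[OF q(1) B_measurable_F[OF q(1)]] measurable_F_M[OF q(2) B_measurable_F[OF q(2)]] by measurable
  have sub: "subalgebra M (F q)" using subalg q by simp
  have idm[measurable]: "(\<lambda>x. x) \<in> measurable M (F q)"
    using sub by (auto simp: measurable_def subalgebra_def)
  note [measurable] = U \<xi>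
  define s where "s = sqrt (q' - q)"
  have s: "0 < s" "s\<^sup>2 = q' - q" using lt by (auto simp: s_def)
  define N where "N = distr M borel D"
  have N: "N = density lborel (normal_density 0 s)"
    using B_increments_normal[OF q(1,2) lt] unfolding distributed_def N_def D_def s_def
    by (metis distr_cong sets_lborel)
  define P where "P = distr M (F q) (\<lambda>x. x)"
  interpret P: prob_space P unfolding P_def by (rule prob_space_distr) simp
  interpret N: prob_space N unfolding N_def by (rule prob_space_distr) simp
  interpret PN: pair_prob_space P N ..
  have setsP[measurable_cong]: "sets P = sets (F q)" and setsN[measurable_cong]: "sets N = sets borel"
    by (auto simp: P_def N_def)
  have spP: "space P = space M" by (simp add: P_def space_F q)
  have prod: "P \<Otimes>\<^sub>M N = distr M (F q \<Otimes>\<^sub>M borel) (\<lambda>x. (x, D x))"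
  proof (rule pair_measure_eqI)
    show "sets (P \<Otimes>\<^sub>M N) = sets (distr M (F q \<Otimes>\<^sub>M borel) (\<lambda>x. (x, D x)))"
      by (simp cong: sets_pair_measure_cong add: setsP setsN)
  next
    fix A E assume "A \<in> sets P" and "E \<in> sets N"
    then have A: "A \<in> sets (F q)" and E: "E \<in> sets borel" by (auto simp: setsP setsN)
    have "A \<subseteq> space M" using sets.sets_into_space[OF A] space_F[OF q(1)] by simp
    then have "prob (A \<inter> (D -` E \<inter> space M)) = prob A * prob (D -` E \<inter> space M)"
      using indep_setD[OF B_increments_indep[OF q(1,2) lt] A, of "D -` E \<inter> space M"] E
      by (auto simp: D_def)
    moreover have "emeasure P A = prob A"
      unfolding P_def using A \<open>A \<subseteq> space M\<close> by (simp add: emeasure_distr emeasure_eq_measure Int_absorb2)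
    moreover have "emeasure N E = prob (D -` E \<inter> space M)"
      unfolding N_def using E by (simp add: emeasure_distr emeasure_eq_measure)
    moreover have "emeasure (distr M (F q \<Otimes>\<^sub>M borel) (\<lambda>x. (x, D x))) (A \<times> E) = prob (A \<inter> (D -` E \<inter> space M))"
      using A E \<open>A \<subseteq> space M\<close>
      by (subst emeasure_distr) (auto simp: emeasure_eq_measure intro!: arg_cong[where f=prob])
    ultimately show "emeasure P A * emeasure N E = emeasure (distr M (F q \<Otimes>\<^sub>M borel) (\<lambda>x. (x, D x))) (A \<times> E)"
      by (simp add: ennreal_mult)
  qed unfold_locales
  define f where "f = (\<lambda>(\<omega>, x). U \<omega> * (iexp (\<xi> \<omega> * x) * complex_of_real (exp ((\<xi> \<omega>)\<^sup>2 * (q' - q) / 2))))"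
  have fm[measurable]: "f \<in> borel_measurable (P \<Otimes>\<^sub>M N)" unfolding f_def by measurable
  have fi: "integrable (P \<Otimes>\<^sub>M N) f"
  proof (rule PN.integrable_const_bound[where B="K * exp (C\<^sup>2 * (q' - q) / 2)"])
    show "AE x in P \<Otimes>\<^sub>M N. cmod (f x) \<le> K * exp (C\<^sup>2 * (q' - q) / 2)"
    proof (rule AE_I2)
      fix x assume "x \<in> space (P \<Otimes>\<^sub>M N)"
      then obtain \<omega> y where x: "x = (\<omega>, y)" "\<omega> \<in> space M" by (auto simp: space_pair_measure spP)
      have "(\<xi> \<omega>)\<^sup>2 \<le> C\<^sup>2" using \<xi>C[OF x(2)] by (metis abs_ge_zero power2_abs power_mono)
      then have "exp ((\<xi> \<omega>)\<^sup>2 * (q' - q) / 2) \<le> exp (C\<^sup>2 * (q' - q) / 2)"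
        using lt by (simp add: mult_right_mono)
      then show "cmod (f x) \<le> K * exp (C\<^sup>2 * (q' - q) / 2)"
        using UK[OF x(2)] by (auto simp: x f_def norm_mult intro!: mult_mono intro: order_trans[OF norm_ge_zero])
    qed
  qed measurable
  have "(CLINT \<omega>|M. f (\<omega>, D \<omega>)) = integral\<^sup>L (P \<Otimes>\<^sub>M N) f"
    unfolding prod using fm unfolding prod by (subst integral_distr) (auto simp: P_def)
  also have "\<dots> = (CLINT \<omega>|P. CLINT x|N. f (\<omega>, x))"
    using PN.integral_fst[OF fi[unfolded f_def]] by (simp add: f_def)
  also have "\<dots> = (CLINT \<omega>|P. U \<omega>)"
  proof (rule Bochner_Integration.integral_cong[OF refl])
    fix \<omega>
    have "(CLINT x|N. f (\<omega>, x)) = U \<omega> * (complex_of_real (exp ((\<xi> \<omega>)\<^sup>2 * (q' - q) / 2)) * (CLINT x|N. iexp (\<xi> \<omega> * x)))"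
      by (simp add: f_def ac_simps)
    also have "\<dots> = U \<omega>"
      unfolding N integral_iexp_normal_density[OF s(1)] s(2) of_real_mult[symmetric] exp_add[symmetric] by simp
    finally show "(CLINT x|N. f (\<omega>, x)) = U \<omega>" .
  qed
  also have "\<dots> = (CLINT \<omega>|M. U \<omega>)"
    unfolding P_def by (subst integral_distr) auto
  finally show ?thesis by (simp add: f_def D_def)
qed

text \<open>
  The complex exponential of the integral, compensated by half its bracket, has constant
  expectation: each factor is removed by \<open>exponential_step\<close>, starting from the last grid point. The weight \<open>W\<close> encodes
  conditioning on the past at \<open>q 0\<close>.
\<close>
lemma exponential_martingale:
  fixes W :: "'a \<Rightarrow> complex"
  assumes q: "\<And>i. i \<le> n \<Longrightarrow> q i \<in> time_dom T" "\<And>i. i < n \<Longrightarrow> q i \<le> q (Suc i)"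
    and \<eta>: "\<And>i. i < n \<Longrightarrow> \<eta> i \<in> borel_measurable (F (q i))"
    and \<eta>C: "\<And>i. i < n \<Longrightarrow> \<exists>C. \<forall>\<omega>\<in>space M. \<bar>\<eta> i \<omega>\<bar> \<le> C"
    and W: "W \<in> borel_measurable (F (q 0))" and WK: "\<And>\<omega>. \<omega> \<in> space M \<Longrightarrow> norm (W \<omega>) \<le> K"
  shows "(CLINT \<omega>|M. W \<omega> * (iexp (\<Sum>i<n. \<eta> i \<omega> * (B (q (Suc i)) \<omega> - B (q i) \<omega>)) *
            of_real (exp ((\<Sum>i<n. (\<eta> i \<omega>)\<^sup>2 * (q (Suc i) - q i)) / 2)))) = (CLINT \<omega>|M. W \<omega>)"
proof -
  define U where "U m \<omega> = W \<omega> * (iexp (\<Sum>i<m. \<eta> i \<omega> * (B (q (Suc i)) \<omega> - B (q i) \<omega>)) *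
            complex_of_real (exp ((\<Sum>i<m. (\<eta> i \<omega>)\<^sup>2 * (q (Suc i) - q i)) / 2)))" for m \<omega>
  have qmono: "q i \<le> q j" if "i \<le> j" "j \<le> n" for i j
    using that by (induction j) (auto simp: le_Suc_eq Suc_le_eq intro: order_trans[OF _ q(2)])
  have "U m \<in> borel_measurable (F (q m)) \<and> (\<exists>K. \<forall>\<omega>\<in>space M. norm (U m \<omega>) \<le> K) \<and>
      (CLINT \<omega>|M. U m \<omega>) = (CLINT \<omega>|M. W \<omega>)" if "m \<le> n" for m
    using that
  proof (induction m)
    case 0
    then show ?case using W WK by (auto simp: U_def)
  next
    case (Suc m)
    then obtain K' where IH: "U m \<in> borel_measurable (F (q m))" "\<And>\<omega>. \<omega> \<in> space M \<Longrightarrow> norm (U m \<omega>) \<le> K'"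
      "(CLINT \<omega>|M. U m \<omega>) = (CLINT \<omega>|M. W \<omega>)" by auto
    obtain C where C: "\<And>\<omega>. \<omega> \<in> space M \<Longrightarrow> \<bar>\<eta> m \<omega>\<bar> \<le> C" using \<eta>C[of m] Suc by auto
    have qm: "q m \<in> time_dom T" "q (Suc m) \<in> time_dom T" "q m \<le> q (Suc m)" using Suc q by auto
    have eq: "U (Suc m) \<omega> = U m \<omega> * (iexp (\<eta> m \<omega> * (B (q (Suc m)) \<omega> - B (q m) \<omega>)) * of_real (exp ((\<eta> m \<omega>)\<^sup>2 * (q (Suc m) - q m) / 2)))" for \<omega>
      by (simp add: U_def distrib_left exp_add add_divide_distrib)
    have [measurable]: "U m \<in> borel_measurable (F (q (Suc m)))" "\<eta> m \<in> borel_measurable (F (q (Suc m)))"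
      "B (q m) \<in> borel_measurable (F (q (Suc m)))" "B (q (Suc m)) \<in> borel_measurable (F (q (Suc m)))"
      using measurable_F_mono[OF qm] IH(1) \<eta>[of m] Suc B_measurable_F qm by auto
    have "U (Suc m) \<in> borel_measurable (F (q (Suc m)))"
      unfolding eq by measurable
    moreover have "norm (U (Suc m) \<omega>) \<le> K' * exp (C\<^sup>2 * (q (Suc m) - q m) / 2)" if "\<omega> \<in> space M" for \<omega>
    proof -
      have "(\<eta> m \<omega>)\<^sup>2 \<le> C\<^sup>2" using C[OF that] by (metis abs_ge_zero power2_abs power_mono)
      then have "exp ((\<eta> m \<omega>)\<^sup>2 * (q (Suc m) - q m) / 2) \<le> exp (C\<^sup>2 * (q (Suc m) - q m) / 2)"
        using qm by (simp add: mult_right_mono)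
      then show ?thesis
        using IH(2)[OF that] unfolding eq
        by (auto simp: norm_mult intro!: mult_mono intro: order_trans[OF norm_ge_zero])
    qed
    moreover have "(CLINT \<omega>|M. U (Suc m) \<omega>) = (CLINT \<omega>|M. U m \<omega>)"
      unfolding eq by (rule exponential_step[OF qm IH(1,2) _ C]) (use \<eta>[of m] Suc in auto)
    ultimately show ?case using IH(3) by auto
  qed
  from this[of n] show ?thesis by (simp add: U_def)
qed

end

section \<open>Truncation at the bracket\<close>

lemma abs_one_minus_exp_le: "\<bar>1 - exp x\<bar> \<le> exp \<bar>x\<bar> - (1::real)"
proof (cases "0 \<le> x")
  case False
  have "2 \<le> exp x + exp (- x)"
    using sum_squares_bound[of "exp (x/2)" "exp (-x/2)"] by (simp add: power2_eq_square mult.assoc flip: exp_add)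
  then show ?thesis using False by (simp add: abs_if)
qed simp

context wiener_process
begin

text \<open>
  If the bracket \<open>A\<close> were the constant \<open>a\<close>, \<open>exponential_martingale\<close> would give equality with right-hand
  side \<open>0\<close>. In general it is applied to a truncated integrand, which agrees with the original one
  unless \<open>A\<close> exceeds \<open>a + \<delta>\<close> and whose bracket never exceeds \<open>a + \<delta>\<close>. On the event
  \<open>\<bar>A - a\<bar> \<le> \<delta>\<close> the two exponentials then differ by at most \<open>exp (\<delta> / 2) - 1\<close>, and elsewhere by at most
  \<open>1 + exp (\<delta> / 2)\<close>.
\<close>
lemma predictable_sum_char_bound:
  fixes W :: "'a \<Rightarrow> complex" and a \<delta> :: real
  assumes q: "\<And>i. i \<le> n \<Longrightarrow> q i \<in> time_dom T" "\<And>i. i < n \<Longrightarrow> q i \<le> q (Suc i)"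
    and \<eta>: "\<And>i. i < n \<Longrightarrow> \<eta> i \<in> borel_measurable (F (q i))"
    and \<eta>C: "\<And>i. i < n \<Longrightarrow> \<exists>C. \<forall>\<omega>\<in>space M. \<bar>\<eta> i \<omega>\<bar> \<le> C"
    and W: "W \<in> borel_measurable (F (q 0))" and W1: "\<And>\<omega>. \<omega> \<in> space M \<Longrightarrow> norm (W \<omega>) \<le> 1"
    and a: "0 \<le> a" and \<delta>: "0 < \<delta>"
  defines "R \<equiv> \<lambda>\<omega>. \<Sum>i<n. \<eta> i \<omega> * (B (q (Suc i)) \<omega> - B (q i) \<omega>)"
    and "A \<equiv> \<lambda>\<omega>. \<Sum>i<n. (\<eta> i \<omega>)\<^sup>2 * (q (Suc i) - q i)"
  shows "norm ((CLINT \<omega>|M. W \<omega> * iexp (R \<omega>)) - of_real (exp (- a / 2)) * (CLINT \<omega>|M. W \<omega>))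
    \<le> (exp (\<delta> / 2) - 1) + (1 + exp (\<delta> / 2)) * prob {\<omega>\<in>space M. \<delta> < \<bar>A \<omega> - a\<bar>}"
proof -
  define C where "C = a + \<delta>"
  define Z where "Z m \<omega> = (\<Sum>j<m. (\<eta> j \<omega>)\<^sup>2 * (q (Suc j) - q j))" for m \<omega>
  (* Switching off at i is decided by the bracket up to and including cell i, which is known at q i
     because the cell lengths are deterministic. *)
  define \<eta>' where "\<eta>' i \<omega> = \<eta> i \<omega> * indicator {\<omega>. Z (Suc i) \<omega> \<le> C} \<omega>" for i \<omega>
  define R' where "R' \<omega> = (\<Sum>i<n. \<eta>' i \<omega> * (B (q (Suc i)) \<omega> - B (q i) \<omega>))" for \<omega>
  define A' where "A' m \<omega> = (\<Sum>i<m. (\<eta>' i \<omega>)\<^sup>2 * (q (Suc i) - q i))" for m \<omega>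
  have qmono: "q i \<le> q j" if "i \<le> j" "j \<le> n" for i j
    using that by (induction j) (auto simp: le_Suc_eq Suc_le_eq intro: order_trans[OF _ q(2)])
  have \<eta>F: "\<eta> j \<in> borel_measurable (F (q i))" if "j \<le> i" "i < n" for i j
    using measurable_F_mono[of "q j" "q i"] that q(1)[of i] q(1)[of j] qmono \<eta>[of j] by auto
  have \<eta>'F: "\<eta>' i \<in> borel_measurable (F (q i))" if "i < n" for i
  proof -
    have [measurable]: "Z (Suc i) \<in> borel_measurable (F (q i))"
      unfolding Z_def using \<eta>F[OF _ that] by (intro borel_measurable_sum borel_measurable_times borel_measurable_power) auto
    note [measurable] = \<eta>[OF that]
    show ?thesis unfolding \<eta>'_def indicator_def by measurable
  qed
  have \<eta>'C: "\<exists>C. \<forall>\<omega>\<in>space M. \<bar>\<eta>' i \<omega>\<bar> \<le> C" if "i < n" for i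
    using \<eta>C[OF that] by (auto simp: \<eta>'_def abs_mult indicator_def intro: order_trans[OF abs_ge_zero])
  have Zmono: "Z i \<omega> \<le> Z j \<omega>" if "i \<le> j" "j \<le> n" for i j \<omega>
    unfolding Z_def using that q(2) by (intro sum_mono2) auto
  have A'le: "A' m \<omega> \<le> C" if "m \<le> n" for m \<omega>
    using that
  proof (induction m)
    case 0 then show ?case using a \<delta> by (simp add: A'_def C_def)
  next
    case (Suc m)
    show ?case
    proof (cases "Z (Suc m) \<omega> \<le> C")
      case True
      have "A' (Suc m) \<omega> \<le> Z (Suc m) \<omega>"
        unfolding A'_def Z_def using Suc.prems q(2)
        by (intro sum_mono mult_right_mono) (auto simp: \<eta>'_def indicator_def)
      with True show ?thesis by simp
    next
      case False
      with Suc show ?thesis by (simp add: A'_def \<eta>'_def)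
    qed
  qed
  have good: "R' \<omega> = R \<omega>" "A' n \<omega> = A \<omega>" if "A \<omega> \<le> C" for \<omega>
  proof -
    have "\<eta>' i \<omega> = \<eta> i \<omega>" if "i < n" for i
      using Zmono[of "Suc i" n \<omega>] that \<open>A \<omega> \<le> C\<close> by (simp add: \<eta>'_def Z_def A_def)
    then show "R' \<omega> = R \<omega>" "A' n \<omega> = A \<omega>" by (auto simp: R'_def R_def A'_def A_def intro!: sum.cong)
  qed
  have q0: "q 0 \<in> time_dom T" using q by simp
  have BM: "B (q i) \<in> borel_measurable M" if "i \<le> n" for i
    using measurable_F_M[OF q(1) B_measurable_F[OF q(1)]] that by simp
  have \<eta>M: "\<eta> i \<in> borel_measurable M" "\<eta>' i \<in> borel_measurable M" if "i < n" for i
    using measurable_F_M[OF q(1) \<eta>[OF that]] measurable_F_M[OF q(1) \<eta>'F[OF that]] that by simp_all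
  have [measurable]: "W \<in> borel_measurable M" using measurable_F_M[OF q0 W] .
  have [measurable]: "R \<in> borel_measurable M" "R' \<in> borel_measurable M" "A \<in> borel_measurable M" "A' n \<in> borel_measurable M"
    unfolding R_def R'_def A_def A'_def using BM \<eta>M
    by (auto intro!: borel_measurable_sum borel_measurable_times borel_measurable_diff borel_measurable_power)
  define f where "f \<omega> = W \<omega> * iexp (R \<omega>)" for \<omega>
  define g where "g \<omega> = W \<omega> * (iexp (R' \<omega>) * complex_of_real (exp (A' n \<omega> / 2)))" for \<omega>
  define e where "e = complex_of_real (exp (- a / 2))"
  define Bad where "Bad = {\<omega>\<in>space M. \<delta> < \<bar>A \<omega> - a\<bar>}"
  have [measurable]: "Bad \<in> sets M" unfolding Bad_def by measurable
  have g: "(CLINT \<omega>|M. g \<omega>) = (CLINT \<omega>|M. W \<omega>)"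
    unfolding g_def R'_def A'_def by (rule exponential_martingale[OF q \<eta>'F \<eta>'C W W1])
  have fi: "integrable M f"
  proof (intro integrable_const_bound[where B=1] AE_I2)
    show "f \<in> borel_measurable M" unfolding f_def by measurable
  qed (use W1 in \<open>simp add: f_def norm_mult\<close>)
  have gi: "integrable M (\<lambda>\<omega>. e * g \<omega>)"
  proof (intro integrable_const_bound[where B="exp (C/2)"] AE_I2)
    fix \<omega> assume "\<omega> \<in> space M"
    have "cmod (e * g \<omega>) = exp (- a / 2) * (norm (W \<omega>) * exp (A' n \<omega> / 2))"
      by (simp add: g_def e_def norm_mult)
    also have "\<dots> \<le> 1 * (1 * exp (C / 2))"
      using a W1[OF \<open>\<omega> \<in> space M\<close>] A'le[of n \<omega>] by (intro mult_mono) auto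
    finally show "cmod (e * g \<omega>) \<le> exp (C/2)" by simp
  next
    show "(\<lambda>\<omega>. e * g \<omega>) \<in> borel_measurable M" unfolding g_def by measurable
  qed
  have ex: "exp (- a / 2) * exp (x / 2) = exp ((x - a) / 2)" for x
    by (simp add: diff_divide_distrib flip: exp_add)
  have bound: "norm (f \<omega> - e * g \<omega>) \<le> (exp (\<delta> / 2) - 1) + (1 + exp (\<delta> / 2)) * indicator Bad \<omega>" if \<omega>: "\<omega> \<in> space M" for \<omega>
  proof (cases "\<omega> \<in> Bad")
    case True
    have "norm (e * g \<omega>) = exp (- a / 2) * (norm (W \<omega>) * exp (A' n \<omega> / 2))"
      by (simp add: g_def e_def norm_mult)
    also have "\<dots> = norm (W \<omega>) * exp ((A' n \<omega> - a) / 2)"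
      unfolding ex[symmetric] by (rule mult.left_commute)
    also have "\<dots> \<le> 1 * exp (\<delta> / 2)"
      using A'le[of n \<omega>] W1[OF \<omega>] by (intro mult_mono) (auto simp: C_def)
    finally have "norm (e * g \<omega>) \<le> exp (\<delta> / 2)" by simp
    moreover have "norm (f \<omega>) \<le> 1" using W1[OF \<omega>] by (simp add: f_def norm_mult)
    moreover have "0 \<le> exp (\<delta> / 2) - 1" using \<delta> by simp
    moreover have "n3 \<le> (x - 1) + (1 + x) * 1" if "n1 \<le> x" "n2 \<le> 1" "0 \<le> x - 1" "n3 \<le> n2 + n1" for n1 n2 n3 x :: real
      using that by simp
    ultimately have "norm (f \<omega> - e * g \<omega>) \<le> (exp (\<delta> / 2) - 1) + (1 + exp (\<delta> / 2)) * 1"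
      using norm_triangle_ineq4[of "f \<omega>" "e * g \<omega>"] by blast
    then show ?thesis using True by (simp only: indicator_simps)
  next
    case False
    with \<omega> have *: "\<bar>A \<omega> - a\<bar> \<le> \<delta>" by (auto simp: Bad_def not_less)
    then have "A \<omega> \<le> C" by (simp add: C_def)
    note good = good[OF this]
    have "f \<omega> - e * g \<omega> = W \<omega> * iexp (R \<omega>) * of_real (1 - exp ((A \<omega> - a) / 2))"
      unfolding ex[symmetric] f_def g_def e_def good of_real_diff of_real_mult right_diff_distrib by (simp only: mult_1_left mult_1_right of_real_1 ac_simps)
    then have "norm (f \<omega> - e * g \<omega>) = norm (W \<omega>) * \<bar>1 - exp ((A \<omega> - a) / 2)\<bar>"
      by (simp add: norm_mult del: of_real_diff)
    also have "\<dots> \<le> 1 * (exp \<bar>(A \<omega> - a) / 2\<bar> - 1)"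
      by (intro mult_mono abs_one_minus_exp_le W1[OF \<omega>]) simp_all
    also have "\<dots> \<le> exp (\<delta> / 2) - 1" using * by simp
    finally show ?thesis using False by simp
  qed
  have "norm ((CLINT \<omega>|M. f \<omega>) - e * (CLINT \<omega>|M. W \<omega>)) = norm (CLINT \<omega>|M. f \<omega> - e * g \<omega>)"
    using fi gi by (simp add: g)
  also have "\<dots> \<le> (LINT \<omega>|M. norm (f \<omega> - e * g \<omega>))" by (rule integral_norm_bound)
  also have "\<dots> \<le> (LINT \<omega>|M. (exp (\<delta> / 2) - 1) + (1 + exp (\<delta> / 2)) * indicator Bad \<omega>)"
    using fi gi bound by (intro integral_mono) (auto intro!: integrable_real_mult_indicator simp: emeasure_eq_measure)
  also have "\<dots> = (exp (\<delta> / 2) - 1) + (1 + exp (\<delta> / 2)) * prob Bad"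
    using prob_space by (subst Bochner_Integration.integral_add) (auto simp: emeasure_eq_measure)
  finally show ?thesis by (simp add: f_def e_def Bad_def)
qed

definition (in -) clamp :: "real \<Rightarrow> real \<Rightarrow> real \<Rightarrow> real" where
  "clamp s t x = max s (min t x)"

text \<open>
  The bracket over \<open>{s..t}\<close>, that is, the integral of the square of the simple process; the grid is
  clamped to the interval so that the increment of the simple integral from \<open>s\<close> to \<open>t\<close> is again a
  simple integral.
\<close>
definition (in -) simple_bracket :: "nat \<Rightarrow> (nat \<Rightarrow> real) \<Rightarrow> (nat \<Rightarrow> 'a \<Rightarrow> real) \<Rightarrow> real \<Rightarrow> real \<Rightarrow> 'a \<Rightarrow> real" where
  "simple_bracket n p \<xi> s t \<omega> = (\<Sum>i<n. (\<xi> i \<omega>)\<^sup>2 * (clamp s t (p (Suc i)) - clamp s t (p i)))"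

text \<open>
  On the clamped grid the coefficients remain predictable: a cell that does not degenerate under
  clamping only has its left end moved to the right. On degenerate cells the coefficient is set to
  \<open>0\<close>, which changes neither the integral nor the bracket.
\<close>
lemma simple_ito_integral_char_bound:
  fixes W :: "'a \<Rightarrow> complex" and a \<delta> \<theta> :: real
  assumes H: "simple_integrand M T F n p \<xi>"
    and st: "s \<in> time_dom T" "t \<in> time_dom T" "s \<le> t"
    and W: "W \<in> borel_measurable (F s)" and W1: "\<And>\<omega>. \<omega> \<in> space M \<Longrightarrow> norm (W \<omega>) \<le> 1"
    and a: "0 \<le> a" and \<delta>: "0 < \<delta>"
  shows "norm ((CLINT \<omega>|M. W \<omega> * iexp (\<theta> * (simple_ito_integral B n p \<xi> t \<omega> - simple_ito_integral B n p \<xi> s \<omega>)))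
      - of_real (exp (- a / 2)) * (CLINT \<omega>|M. W \<omega>))
    \<le> (exp (\<delta> / 2) - 1) + (1 + exp (\<delta> / 2)) * prob {\<omega>\<in>space M. \<delta> < \<bar>\<theta>\<^sup>2 * simple_bracket n p \<xi> s t \<omega> - a\<bar>}"
proof -
  define q where "q i = clamp s t (p i)" for i
  define \<eta> where "\<eta> i = (if q i < q (Suc i) then (\<lambda>\<omega>. \<theta> * \<xi> i \<omega>) else (\<lambda>_. 0))" for i
  have p: "p i < p (Suc i)" if "i < n" for i using H that by (auto simp: simple_integrand_def)
  have pd: "p i \<in> time_dom T" if "i \<le> n" for i using H that by (auto simp: simple_integrand_def)
  have between: "u \<in> time_dom T" if "s \<le> u" "u \<le> t" for u
    using st that by (auto simp: time_dom_def intro: le_less_trans[of _ "ereal t"])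
  have qd: "q i \<in> time_dom T" for i using st by (intro between) (auto simp: q_def clamp_def)
  have qm: "q i \<le> q (Suc i)" if "i < n" for i using p[OF that] by (auto simp: q_def clamp_def)
  have \<eta>: "\<eta> i \<in> borel_measurable (F (q i))" if "i < n" for i
  proof (cases "q i < q (Suc i)")
    case True
    then have "p i \<le> q i" by (auto simp: q_def clamp_def)
    moreover have "\<xi> i \<in> borel_measurable (F (p i))" using H that by (auto simp: simple_integrand_def)
    ultimately have "\<xi> i \<in> borel_measurable (F (q i))" using measurable_F_mono[OF pd[of i] qd] that by (metis less_imp_le)
    then show ?thesis using True by (simp add: \<eta>_def)
  qed (simp add: \<eta>_def)
  have \<eta>C: "\<exists>C. \<forall>\<omega>\<in>space M. \<bar>\<eta> i \<omega>\<bar> \<le> C" if i: "i < n" for i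
  proof -
    obtain C where "\<forall>\<omega>\<in>space M. \<bar>\<xi> i \<omega>\<bar> \<le> C" using H i by (auto simp: simple_integrand_def)
    then have "\<forall>\<omega>\<in>space M. \<bar>\<eta> i \<omega>\<bar> \<le> \<bar>\<theta>\<bar> * \<bar>C\<bar>"
      by (auto simp: \<eta>_def abs_mult intro!: mult_left_mono intro: order_trans[OF _ abs_ge_self])
    then show ?thesis by blast
  qed
  have Wq: "W \<in> borel_measurable (F (q 0))"
    using measurable_F_mono[OF st(1) qd _ W] by (simp add: q_def clamp_def)
  have R: "(\<Sum>i<n. \<eta> i \<omega> * (B (q (Suc i)) \<omega> - B (q i) \<omega>)) =
      \<theta> * (simple_ito_integral B n p \<xi> t \<omega> - simple_ito_integral B n p \<xi> s \<omega>)" for \<omega>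
    unfolding simple_ito_integral_def sum_subtractf[symmetric] sum_distrib_left
  proof (intro sum.cong refl)
    fix i assume "i \<in> {..<n}"
    then have i: "i < n" by simp
    have c: "B (min t x) \<omega> - B (min s x) \<omega> = B (clamp s t x) \<omega> - B s \<omega>" for x
      using st(3) by (cases "x \<le> s"; cases "x \<le> t") (auto simp: clamp_def min_def max_def)
    have 1: "\<eta> i \<omega> * (B (q (Suc i)) \<omega> - B (q i) \<omega>) = \<theta> * \<xi> i \<omega> * (B (q (Suc i)) \<omega> - B (q i) \<omega>)"
      using qm[OF i] by (auto simp: \<eta>_def le_less)
    have 2: "B (q (Suc i)) \<omega> - B (q i) \<omega> = (B (min t (p (Suc i))) \<omega> - B (min s (p (Suc i))) \<omega>) - (B (min t (p i)) \<omega> - B (min s (p i)) \<omega>)"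
      by (simp add: c q_def)
    show "\<eta> i \<omega> * (B (q (Suc i)) \<omega> - B (q i) \<omega>) = \<theta> *
         (\<xi> i \<omega> * (B (min t (p (Suc i))) \<omega> - B (min t (p i)) \<omega>) -
          \<xi> i \<omega> * (B (min s (p (Suc i))) \<omega> - B (min s (p i)) \<omega>))"
      unfolding 1 unfolding 2 by (simp add: algebra_simps)
  qed
  have A: "(\<Sum>i<n. (\<eta> i \<omega>)\<^sup>2 * (q (Suc i) - q i)) = \<theta>\<^sup>2 * simple_bracket n p \<xi> s t \<omega>" for \<omega>
    unfolding simple_bracket_def sum_distrib_left q_def[symmetric]
  proof (intro sum.cong refl)
    fix i assume "i \<in> {..<n}"
    then have "q i \<le> q (Suc i)" using qm by simp
    then show "(\<eta> i \<omega>)\<^sup>2 * (q (Suc i) - q i) = \<theta>\<^sup>2 * ((\<xi> i \<omega>)\<^sup>2 * (q (Suc i) - q i))"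
      by (auto simp: \<eta>_def power_mult_distrib)
  qed
  show ?thesis
    using predictable_sum_char_bound[of n q \<eta> W a \<delta>, OF qd qm \<eta> \<eta>C Wq W1 a \<delta>] unfolding R A by simp
qed

end

section \<open>Convergence in probability and brackets of simple integrands\<close>

lemma norm_iexp_diff_le: "cmod (iexp x - iexp y) \<le> \<bar>x - y\<bar>"
proof -
  have "iexp x - iexp y = iexp y * (iexp (x - y) - 1)"
    by (simp add: algebra_simps flip: exp_add)
  then have "cmod (iexp x - iexp y) = cmod (iexp (x - y) - 1)"
    by (simp add: norm_mult)
  also have "\<dots> \<le> \<bar>x - y\<bar>" using iexp_approx1[of "x - y" 0] by simp
  finally show ?thesis .
qed

context prob_space
begin

lemma tendsto_in_probD:
  "tendsto_in_prob M Y Z \<Longrightarrow> 0 < \<epsilon> \<Longrightarrow> (\<lambda>k. prob {\<omega>\<in>space M. \<epsilon> < \<bar>Y k \<omega> - Z \<omega>\<bar>}) \<longlonglongrightarrow> 0"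
  by (auto simp: tendsto_in_prob_def)

lemma tendsto_in_prob_diff:
  assumes Y: "tendsto_in_prob M Y Z" and Y': "tendsto_in_prob M Y' Z'"
    and m: "\<And>k. Y k \<in> borel_measurable M" "\<And>k. Y' k \<in> borel_measurable M" "Z \<in> borel_measurable M" "Z' \<in> borel_measurable M"
  shows "tendsto_in_prob M (\<lambda>k \<omega>. Y k \<omega> - Y' k \<omega>) (\<lambda>\<omega>. Z \<omega> - Z' \<omega>)"
  unfolding tendsto_in_prob_def
proof (intro allI impI)
  fix \<epsilon> :: real assume \<epsilon>: "0 < \<epsilon>"
  note [measurable] = m
  let ?P = "\<lambda>k. prob {\<omega>\<in>space M. \<epsilon>/2 < \<bar>Y k \<omega> - Z \<omega>\<bar>}" and ?P' = "\<lambda>k. prob {\<omega>\<in>space M. \<epsilon>/2 < \<bar>Y' k \<omega> - Z' \<omega>\<bar>}"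
  have lim: "(\<lambda>k. ?P k + ?P' k) \<longlonglongrightarrow> 0"
    using tendsto_add[OF tendsto_in_probD[OF Y, of "\<epsilon>/2"] tendsto_in_probD[OF Y', of "\<epsilon>/2"]] \<epsilon> by simp
  have le: "prob {\<omega>\<in>space M. \<epsilon> < \<bar>Y k \<omega> - Y' k \<omega> - (Z \<omega> - Z' \<omega>)\<bar>} \<le> ?P k + ?P' k" for k
  proof -
    have "prob {\<omega>\<in>space M. \<epsilon> < \<bar>Y k \<omega> - Y' k \<omega> - (Z \<omega> - Z' \<omega>)\<bar>} \<le>
        prob ({\<omega>\<in>space M. \<epsilon>/2 < \<bar>Y k \<omega> - Z \<omega>\<bar>} \<union> {\<omega>\<in>space M. \<epsilon>/2 < \<bar>Y' k \<omega> - Z' \<omega>\<bar>})"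
      by (rule finite_measure_mono) (auto simp: abs_if split: if_splits)
    also have "\<dots> \<le> ?P k + ?P' k" by (rule measure_Un_le) measurable
    finally show ?thesis .
  qed
  show "(\<lambda>k. prob {\<omega>\<in>space M. \<epsilon> < \<bar>Y k \<omega> - Y' k \<omega> - (Z \<omega> - Z' \<omega>)\<bar>}) \<longlonglongrightarrow> 0"
    by (rule tendsto_sandwich[OF _ _ tendsto_const lim]) (use le in auto)
qed

text \<open>
  \<open>iexp\<close> is bounded and Lipschitz, so convergence in probability is enough to pass to the limit
  under a bounded weight.
\<close>
lemma tendsto_in_prob_char:
  fixes W :: "'a \<Rightarrow> complex"
  assumes Y: "tendsto_in_prob M Y Z"
    and m[measurable]: "\<And>k. Y k \<in> borel_measurable M" "Z \<in> borel_measurable M" "W \<in> borel_measurable M"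
    and W1: "\<And>\<omega>. \<omega> \<in> space M \<Longrightarrow> norm (W \<omega>) \<le> 1"
  shows "(\<lambda>k. CLINT \<omega>|M. W \<omega> * iexp (\<theta> * Y k \<omega>)) \<longlonglongrightarrow> (CLINT \<omega>|M. W \<omega> * iexp (\<theta> * Z \<omega>))"
proof (rule LIMSEQ_I)
  fix r :: real assume r: "0 < r"
  define \<epsilon> where "\<epsilon> = r / (2 * (\<bar>\<theta>\<bar> + 1))"
  have \<epsilon>: "0 < \<epsilon>" "\<bar>\<theta>\<bar> * \<epsilon> < r / 2" using r by (auto simp: \<epsilon>_def field_simps)
  have int: "integrable M (\<lambda>\<omega>. W \<omega> * iexp (\<theta> * V \<omega>))" if [measurable]: "V \<in> borel_measurable M" for V :: "'a \<Rightarrow> real"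
    using W1 by (intro integrable_const_bound[where B=1] AE_I2) (auto simp: norm_mult)
  have le: "norm ((CLINT \<omega>|M. W \<omega> * iexp (\<theta> * Y k \<omega>)) - (CLINT \<omega>|M. W \<omega> * iexp (\<theta> * Z \<omega>)))
      \<le> \<bar>\<theta>\<bar> * \<epsilon> + 2 * prob {\<omega>\<in>space M. \<epsilon> < \<bar>Y k \<omega> - Z \<omega>\<bar>}" (is "_ \<le> _ + 2 * prob ?Bad") for k
  proof -
    have bound: "norm (W \<omega> * iexp (\<theta> * Y k \<omega>) - W \<omega> * iexp (\<theta> * Z \<omega>)) \<le> \<bar>\<theta>\<bar> * \<epsilon> + 2 * indicator ?Bad \<omega>"
      if \<omega>: "\<omega> \<in> space M" for \<omega>
    proof -
      have eq: "norm (W \<omega> * iexp (\<theta> * Y k \<omega>) - W \<omega> * iexp (\<theta> * Z \<omega>)) = norm (W \<omega>) * norm (iexp (\<theta> * Y k \<omega>) - iexp (\<theta> * Z \<omega>))"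
        by (simp add: norm_mult flip: right_diff_distrib)
      have le1: "\<dots> \<le> norm (iexp (\<theta> * Y k \<omega>) - iexp (\<theta> * Z \<omega>))"
        using W1[OF \<omega>] by (intro mult_left_le_one_le) auto
      show ?thesis
      proof (cases "\<omega> \<in> ?Bad")
        case True
        have "norm (iexp (\<theta> * Y k \<omega>) - iexp (\<theta> * Z \<omega>)) \<le> 1 + 1"
          by (rule order_trans[OF norm_triangle_ineq4]) simp
        moreover have "0 \<le> \<bar>\<theta>\<bar> * \<epsilon>" using \<epsilon> by simp
        ultimately show ?thesis unfolding eq indicator_simps(1)[OF True] using le1 by linarith
      next
        case False
        have "norm (iexp (\<theta> * Y k \<omega>) - iexp (\<theta> * Z \<omega>)) \<le> \<bar>\<theta>\<bar> * \<bar>Y k \<omega> - Z \<omega>\<bar>"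
          using norm_iexp_diff_le[of "\<theta> * Y k \<omega>" "\<theta> * Z \<omega>"] by (simp add: abs_mult flip: right_diff_distrib)
        also have "\<dots> \<le> \<bar>\<theta>\<bar> * \<epsilon>" using False \<omega> by (intro mult_left_mono) auto
        finally show ?thesis using eq le1 False by simp
      qed
    qed
    have "norm ((CLINT \<omega>|M. W \<omega> * iexp (\<theta> * Y k \<omega>)) - (CLINT \<omega>|M. W \<omega> * iexp (\<theta> * Z \<omega>))) =
        norm (CLINT \<omega>|M. W \<omega> * iexp (\<theta> * Y k \<omega>) - W \<omega> * iexp (\<theta> * Z \<omega>))"
      using int by simp
    also have "\<dots> \<le> (LINT \<omega>|M. norm (W \<omega> * iexp (\<theta> * Y k \<omega>) - W \<omega> * iexp (\<theta> * Z \<omega>)))"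
      by (rule integral_norm_bound)
    also have "\<dots> \<le> (LINT \<omega>|M. \<bar>\<theta>\<bar> * \<epsilon> + 2 * indicator ?Bad \<omega>)"
      using int bound by (intro integral_mono) (auto simp: emeasure_eq_measure)
    also have "\<dots> = \<bar>\<theta>\<bar> * \<epsilon> + 2 * prob ?Bad"
      using prob_space by (subst Bochner_Integration.integral_add) (auto simp: emeasure_eq_measure)
    finally show ?thesis .
  qed
  have "\<forall>\<^sub>F k in sequentially. prob {\<omega>\<in>space M. \<epsilon> < \<bar>Y k \<omega> - Z \<omega>\<bar>} < r / 4"
    using tendsto_in_probD[OF Y \<epsilon>(1)] r by (intro order_tendstoD) auto
  then obtain N where N: "\<And>k. k \<ge> N \<Longrightarrow> prob {\<omega>\<in>space M. \<epsilon> < \<bar>Y k \<omega> - Z \<omega>\<bar>} < r / 4"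
    by (auto simp: eventually_sequentially)
  show "\<exists>no. \<forall>k\<ge>no. norm ((CLINT \<omega>|M. W \<omega> * iexp (\<theta> * Y k \<omega>)) - (CLINT \<omega>|M. W \<omega> * iexp (\<theta> * Z \<omega>))) < r"
  proof (intro exI allI impI)
    fix k assume "N \<le> k"
    then show "norm ((CLINT \<omega>|M. W \<omega> * iexp (\<theta> * Y k \<omega>)) - (CLINT \<omega>|M. W \<omega> * iexp (\<theta> * Z \<omega>))) < r"
      using le[of k] N[of k] \<epsilon>(2) by simp
  qed
qed

lemma real_random_variable_tight:
  fixes X :: "'a \<Rightarrow> real"
  assumes [measurable]: "X \<in> borel_measurable M" and "0 < \<gamma>"
  shows "\<exists>K>0. prob {\<omega>\<in>space M. K < X \<omega>} < \<gamma>"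
proof -
  interpret D: real_distribution "distr M borel X" by (rule real_distribution_distr) simp
  have "\<forall>\<^sub>F K in at_top. cdf (distr M borel X) K > 1 - \<gamma>"
    using D.cdf_lim_at_top_prob \<open>0 < \<gamma>\<close> by (intro order_tendstoD) auto
  then have "\<forall>\<^sub>F K in at_top. cdf (distr M borel X) K > 1 - \<gamma> \<and> 0 < K"
    using eventually_gt_at_top by (rule eventually_conj)
  then obtain K where K: "cdf (distr M borel X) K > 1 - \<gamma>" "0 < K"
    by (auto dest: eventually_happens)
  have "cdf (distr M borel X) K = prob {\<omega>\<in>space M. X \<omega> \<le> K}"
    by (auto simp: cdf_def measure_distr intro!: arg_cong[where f=prob])
  also have "\<dots> = 1 - prob {\<omega>\<in>space M. K < X \<omega>}"
    by (subst prob_compl[symmetric]) (auto intro!: arg_cong[where f=prob])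
  finally show ?thesis using K by auto
qed

end

lemma measure_Ioc_Int_Icc:
  assumes "a \<le> b" "s \<le> t"
  shows "measure lborel ({a<..b} \<inter> {s..t}) = clamp s t b - clamp s t a"
proof -
  consider "b < s" | "t \<le> a" | "a < s" "s \<le> b" | "s \<le> a" "a < t" by linarith
  then show ?thesis
  proof cases
    case 1
    then have "{a<..b} \<inter> {s..t} = {}" by auto
    then show ?thesis using 1 assms by (simp add: clamp_def)
  next
    case 2
    then have "{a<..b} \<inter> {s..t} = {}" by auto
    then show ?thesis using 2 assms by (simp add: clamp_def)
  next
    case 3
    then have "{a<..b} \<inter> {s..t} = {s..min b t}" by auto
    then show ?thesis using 3 assms by (simp add: clamp_def min_def max_def)
  next
    case 4
    then have "{a<..b} \<inter> {s..t} = {a<..min b t}" by auto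
    then show ?thesis using 4 assms by (simp add: clamp_def min_def max_def)
  qed
qed

text \<open>
  The cells are disjoint, so the mixed terms of the square vanish.
\<close>
lemma simple_process_square:
  assumes "\<And>i. i < n \<Longrightarrow> p i < (p (Suc i) :: real)"
  shows "(simple_process n p \<xi> u \<omega>)\<^sup>2 = (\<Sum>i<n. (\<xi> i \<omega>)\<^sup>2 * indicator {p i<..p (Suc i)} u)"
  using assms
proof (induction n)
  case 0 then show ?case by (simp add: simple_process_def)
next
  case (Suc n)
  have pm: "p i \<le> p j" if "i \<le> j" "j \<le> n" for i j
    using that Suc.prems by (induction j) (auto simp: le_Suc_eq Suc_le_eq intro: order_trans[OF _ less_imp_le[OF Suc.prems]])
  have *: "simple_process (Suc n) p \<xi> u \<omega> = simple_process n p \<xi> u \<omega> + \<xi> n \<omega> * indicator {p n<..p (Suc n)} u"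
    by (simp add: simple_process_def)
  have "simple_process n p \<xi> u \<omega> = 0" if "u \<in> {p n<..p (Suc n)}"
    unfolding simple_process_def
  proof (intro sum.neutral ballI)
    fix i assume "i \<in> {..<n}"
    then have "p (Suc i) \<le> p n" by (intro pm) auto
    with that show "\<xi> i \<omega> * indicat_real {p i<..p (Suc i)} u = 0" by (auto simp: indicator_def)
  qed
  then have "simple_process n p \<xi> u \<omega> * indicator {p n<..p (Suc n)} u = 0" by (auto simp: indicator_def)
  then have "(simple_process (Suc n) p \<xi> u \<omega>)\<^sup>2 = (simple_process n p \<xi> u \<omega>)\<^sup>2 + (\<xi> n \<omega>)\<^sup>2 * indicator {p n<..p (Suc n)} u"
    unfolding * by (auto simp: indicator_def power2_sum)
  then show ?case using Suc by simp
qed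

lemma simple_bracket_eq_integral:
  assumes p: "\<And>i. i < n \<Longrightarrow> p i < (p (Suc i) :: real)" and "s \<le> t"
  shows "set_integrable lborel {s..t} (\<lambda>u. (simple_process n p \<xi> u \<omega>)\<^sup>2)"
    and "(LBINT u:{s..t}. (simple_process n p \<xi> u \<omega>)\<^sup>2) = simple_bracket n p \<xi> s t \<omega>"
proof -
  have eq: "indicator {s..t} u *\<^sub>R (simple_process n p \<xi> u \<omega>)\<^sup>2 = (\<Sum>i<n. (\<xi> i \<omega>)\<^sup>2 * indicator ({p i<..p (Suc i)} \<inter> {s..t}) u)" for u
    using simple_process_square[of n p \<xi> u \<omega>] p by (auto simp: sum_distrib_left indicator_inter_arith ac_simps intro!: sum.cong)
  have fin: "emeasure lborel ({p i<..p (Suc i)} \<inter> {s..t}) < \<infinity>" for i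
    by (rule le_less_trans[OF emeasure_mono[of _ "{s..t}"]]) (auto simp: emeasure_lborel_Icc_eq)
  have int: "integrable lborel (\<lambda>u. (\<xi> i \<omega>)\<^sup>2 * indicator ({p i<..p (Suc i)} \<inter> {s..t}) u :: real)" for i
    using fin by (intro integrable_mult_right) (auto simp: integrable_indicator_iff)
  show "set_integrable lborel {s..t} (\<lambda>u. (simple_process n p \<xi> u \<omega>)\<^sup>2)"
    unfolding set_integrable_def eq by (rule Bochner_Integration.integrable_sum) (rule int)
  show "(LBINT u:{s..t}. (simple_process n p \<xi> u \<omega>)\<^sup>2) = simple_bracket n p \<xi> s t \<omega>"
    unfolding set_lebesgue_integral_def eq simple_bracket_def
    using int p \<open>s \<le> t\<close> measure_Ioc_Int_Icc[OF less_imp_le]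
    by (subst Bochner_Integration.integral_sum) (auto intro!: sum.cong)
qed

text \<open>
  Progressive measurability only provides measurability on the strip over \<open>{0..t}\<close>, so the integral is
  rewritten as one over the restricted Lebesgue measure.
\<close>
lemma borel_measurable_set_integral_restrict:
  fixes f :: "real \<Rightarrow> 'a \<Rightarrow> real"
  assumes f: "(\<lambda>(u, \<omega>). f u \<omega>) \<in> borel_measurable (restrict_space borel {0..t} \<Otimes>\<^sub>M N)" and s: "0 \<le> s"
  shows "(\<lambda>\<omega>. LBINT u:{s..t}. f u \<omega>) \<in> borel_measurable N"
proof -
  let ?L = "restrict_space lborel {0..t}"
  interpret L: sigma_finite_measure ?L
    by (rule sigma_finite_measure_restrict_space) (auto intro: lborel.sigma_finite_measure_axioms)
  have sL: "sets ?L = sets (restrict_space borel {0..t})" by (simp cong: sets_restrict_space_cong)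
  have [measurable]: "(\<lambda>(u, \<omega>). f u \<omega>) \<in> borel_measurable (?L \<Otimes>\<^sub>M N)"
    using f by (simp cong: measurable_cong_sets sets_pair_measure_cong add: sL)
  have [measurable]: "(\<lambda>u. indicator {s..t} u :: real) \<in> borel_measurable ?L"
    by (rule measurable_restrict_space1) simp
  have [measurable]: "(\<lambda>x. f (snd x) (fst x)) \<in> borel_measurable (N \<Otimes>\<^sub>M ?L)"
    using measurable_compose[OF measurable_pair_swap' \<open>(\<lambda>(u, \<omega>). f u \<omega>) \<in> borel_measurable (?L \<Otimes>\<^sub>M N)\<close>]
    by (simp add: case_prod_beta)
  have "(\<lambda>\<omega>. \<integral>u. indicator {s..t} u * f u \<omega> \<partial>?L) \<in> borel_measurable N"
    by (rule L.borel_measurable_lebesgue_integral) (simp add: case_prod_beta)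
  also have "(\<lambda>\<omega>. \<integral>u. indicator {s..t} u * f u \<omega> \<partial>?L) = (\<lambda>\<omega>. LBINT u:{s..t}. f u \<omega>)"
    using s by (auto simp: integral_restrict_space set_lebesgue_integral_def indicator_def fun_eq_iff intro!: Bochner_Integration.integral_cong)
  finally show ?thesis .
qed

lemma borel_measurable_section_restrict:
  fixes f :: "real \<Rightarrow> 'a \<Rightarrow> real"
  assumes f: "(\<lambda>(u, \<omega>). f u \<omega> :: real) \<in> borel_measurable (restrict_space borel {0..t} \<Otimes>\<^sub>M N)" and \<omega>: "\<omega> \<in> space N"
  shows "(\<lambda>u. indicator {0..t} u * f u \<omega>) \<in> borel_measurable borel"
proof -
  have "(\<lambda>u. f u \<omega>) \<in> borel_measurable (restrict_space borel {0..t})"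
    using measurable_compose[OF measurable_Pair2'[OF \<omega>] f] by (simp add: comp_def)
  then show ?thesis using borel_measurable_restrict_space_iff[of "{0..t}" borel "\<lambda>u. f u \<omega>"] by simp
qed

section \<open>A characteristic function bound for It\^o integrals\<close>

text \<open>
  The parameter \<open>\<eta>\<close> trades the mixed term between the two squares; this takes the place of the
  Cauchy-Schwarz inequality when integrals are compared.
\<close>
lemma abs_square_diff_le:
  fixes x y \<eta> :: real
  assumes "0 < \<eta>"
  shows "\<bar>x\<^sup>2 - y\<^sup>2\<bar> \<le> (1 + 1 / \<eta>) * (x - y)\<^sup>2 + \<eta> * y\<^sup>2"
proof -
  have e: "x\<^sup>2 - y\<^sup>2 = (x - y)\<^sup>2 + 2 * (y * (x - y))"
    by (simp add: power2_eq_square algebra_simps)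
  have "2 * (\<eta> * \<bar>y\<bar> * \<bar>x - y\<bar>) \<le> (\<eta> * \<bar>y\<bar>)\<^sup>2 + \<bar>x - y\<bar>\<^sup>2"
    using sum_squares_bound[of "\<eta> * \<bar>y\<bar>" "\<bar>x - y\<bar>"] by (simp add: mult.assoc)
  then have "\<eta> * (2 * (\<bar>y\<bar> * \<bar>x - y\<bar>)) \<le> \<eta> * (\<eta> * y\<^sup>2 + 1 / \<eta> * (x - y)\<^sup>2)"
    using assms by (simp add: power_mult_distrib power2_eq_square[of \<eta>] algebra_simps)
  then have "2 * (\<bar>y\<bar> * \<bar>x - y\<bar>) \<le> \<eta> * y\<^sup>2 + 1 / \<eta> * (x - y)\<^sup>2"
    using assms by (simp add: mult_le_cancel_left_pos)
  moreover have "\<bar>x\<^sup>2 - y\<^sup>2\<bar> \<le> (x - y)\<^sup>2 + 2 * (\<bar>y\<bar> * \<bar>x - y\<bar>)"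
    unfolding e by (rule order_trans[OF abs_triangle_ineq]) (simp add: abs_mult)
  ultimately show ?thesis by (simp add: algebra_simps)
qed

lemma integral_square_diff_bound:
  fixes f g :: "real \<Rightarrow> real"
  assumes f: "set_integrable lborel {0..t} (\<lambda>u. (f u)\<^sup>2)" and g: "set_integrable lborel {0..t} (\<lambda>u. (g u)\<^sup>2)"
    and fm: "(\<lambda>u. indicator {0..t} u * f u) \<in> borel_measurable borel"
    and gm: "(\<lambda>u. indicator {0..t} u * g u) \<in> borel_measurable borel"
    and s: "0 \<le> s" and \<eta>: "0 < \<eta>"
  shows "\<bar>(LBINT u:{s..t}. (f u)\<^sup>2) - (LBINT u:{s..t}. (g u)\<^sup>2)\<bar>
    \<le> (1 + 1 / \<eta>) * (LBINT u:{0..t}. (f u - g u)\<^sup>2) + \<eta> * (LBINT u:{0..t}. (g u)\<^sup>2)"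
proof -
  have sub: "{s..t} \<subseteq> {0..t}" using s by auto
  note f' = set_integrable_subset[OF f _ sub, simplified] and g' = set_integrable_subset[OF g _ sub, simplified]
  have eqd: "indicator {0..t} u * (f u - g u)\<^sup>2 = (indicator {0..t} u * f u - indicator {0..t} u * g u)\<^sup>2" for u :: real
    by (simp add: indicator_def)
  have dm: "(\<lambda>u. indicator {0..t} u * (f u - g u)\<^sup>2) \<in> borel_measurable borel"
    unfolding eqd using fm gm by measurable
  have d: "set_integrable lborel {0..t} (\<lambda>u. (f u - g u)\<^sup>2)"
    unfolding set_integrable_def
  proof (rule Bochner_Integration.integrable_bound)
    show "integrable lborel (\<lambda>u. 2 * (indicator {0..t} u *\<^sub>R (f u)\<^sup>2) + 2 * (indicator {0..t} u *\<^sub>R (g u)\<^sup>2))"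
      using f g unfolding set_integrable_def by (intro Bochner_Integration.integrable_add integrable_mult_right)
    have "(f u - g u)\<^sup>2 \<le> 2 * (f u)\<^sup>2 + 2 * (g u)\<^sup>2" for u
      using zero_le_power2[of "f u + g u"] by (simp add: power2_eq_square algebra_simps)
    then show "AE u in lborel. norm (indicator {0..t} u *\<^sub>R (f u - g u)\<^sup>2) \<le> norm (2 * (indicator {0..t} u *\<^sub>R (f u)\<^sup>2) + 2 * (indicator {0..t} u *\<^sub>R (g u)\<^sup>2))"
      by (intro AE_I2) (auto simp: indicator_def intro: order_trans[OF _ abs_ge_self])
  qed (use dm in simp)
  have "\<bar>(LBINT u:{s..t}. (f u)\<^sup>2) - (LBINT u:{s..t}. (g u)\<^sup>2)\<bar> = norm (LBINT u:{s..t}. (f u)\<^sup>2 - (g u)\<^sup>2)"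
    using f' g' by simp
  also have "\<dots> \<le> (LBINT u:{s..t}. norm ((f u)\<^sup>2 - (g u)\<^sup>2))"
    by (rule set_integral_norm_bound) (use f' g' in auto)
  also have "\<dots> \<le> (LBINT u:{0..t}. norm ((f u)\<^sup>2 - (g u)\<^sup>2))"
    unfolding set_lebesgue_integral_def
  proof (rule integral_mono)
    have fg: "set_integrable lborel {0..t} (\<lambda>u. norm ((f u)\<^sup>2 - (g u)\<^sup>2))" "set_integrable lborel {s..t} (\<lambda>u. norm ((f u)\<^sup>2 - (g u)\<^sup>2))"
      using f g f' g' by (auto intro!: set_integrable_abs set_integral_diff(1))
    then show "integrable lborel (\<lambda>u. indicator {0..t} u *\<^sub>R norm ((f u)\<^sup>2 - (g u)\<^sup>2))"
      "integrable lborel (\<lambda>u. indicator {s..t} u *\<^sub>R norm ((f u)\<^sup>2 - (g u)\<^sup>2))"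
      unfolding set_integrable_def by auto
  qed (use sub in \<open>auto simp: indicator_def\<close>)
  also have "\<dots> \<le> (LBINT u:{0..t}. (1 + 1 / \<eta>) * (f u - g u)\<^sup>2 + \<eta> * (g u)\<^sup>2)"
    using abs_square_diff_le[OF \<eta>] f g d
    by (intro set_integral_mono) (auto intro!: set_integrable_abs set_integral_diff(1) set_integral_add(1))
  also have "\<dots> = (1 + 1 / \<eta>) * (LBINT u:{0..t}. (f u - g u)\<^sup>2) + \<eta> * (LBINT u:{0..t}. (g u)\<^sup>2)"
    using g d by (subst set_integral_add) auto
  finally show ?thesis .
qed

context wiener_process
begin

lemma time_dom_0: "t \<in> time_dom T \<Longrightarrow> 0 \<in> time_dom T"
  by (auto simp: time_dom_def intro: le_less_trans[rotated])

lemma progressive_joint_measurable: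
  assumes "progressive T F H" "t \<in> time_dom T"
  shows "(\<lambda>(u, \<omega>). H u \<omega>) \<in> borel_measurable (restrict_space borel {0..t} \<Otimes>\<^sub>M M)"
proof -
  have 1: "(\<lambda>(u, \<omega>). H u \<omega>) \<in> borel_measurable (restrict_space borel {0..t} \<Otimes>\<^sub>M F t)"
    using assms by (auto simp: progressive_def)
  have "id \<in> restrict_space borel {0..t} \<Otimes>\<^sub>M M \<rightarrow>\<^sub>M restrict_space borel {0..t} \<Otimes>\<^sub>M F t"
    unfolding id_def
    using measurable_F_M[OF assms(2), of "\<lambda>x. x" "F t"]
    by (intro measurable_pair) (simp_all add: comp_def)
  from measurable_comp[OF this 1] show ?thesis by simp
qed

lemma simple_integrand_measurable:
  assumes "simple_integrand M T F n p \<xi>" "i < n"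
  shows "\<xi> i \<in> borel_measurable M"
proof -
  have "p i \<in> time_dom T" "\<xi> i \<in> borel_measurable (F (p i))"
    using assms by (auto simp: simple_integrand_def)
  then show ?thesis by (rule measurable_F_M)
qed

lemma simple_integrand_joint_measurable:
  assumes H: "simple_integrand M T F n p \<xi>"
  shows "(\<lambda>(u, \<omega>). simple_process n p \<xi> u \<omega>) \<in> borel_measurable (restrict_space borel {0..t} \<Otimes>\<^sub>M M)"
proof -
  have [measurable]: "\<xi> i \<in> borel_measurable M" if "i < n" for i
    using simple_integrand_measurable[OF H that] .
  have [measurable]: "(\<lambda>u. indicator {p i<..p (Suc i)} u :: real) \<in> borel_measurable (restrict_space borel {0..t})" for i
    by (rule measurable_restrict_space1) simp
  show ?thesis
    unfolding simple_process_def case_prod_beta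
    by (intro borel_measurable_sum borel_measurable_times) measurable
qed

text \<open>
  By \<open>integral_square_diff_bound\<close> the brackets differ by a multiple of the distance of the integrands,
  which tends to \<open>0\<close> in probability, plus \<open>\<eta>\<close> times the integral of \<open>H\<^sup>2\<close>, which is tight;
  \<open>\<eta>\<close> is chosen after the tightness level.
\<close>
lemma simple_bracket_tendsto:
  assumes H: "\<And>k. simple_integrand M T F (n k) (p k) (\<xi> k)"
    and Hp: "progressive T F H" and st: "0 \<le> s" "s \<le> t" "t \<in> time_dom T"
    and HI: "AE \<omega> in M. set_integrable lborel {0..t} (\<lambda>s. (H s \<omega>)\<^sup>2)"
    and D: "tendsto_in_prob M (\<lambda>k \<omega>. LBINT s:{0..t}. (simple_process (n k) (p k) (\<xi> k) s \<omega> - H s \<omega>)\<^sup>2) (\<lambda>\<omega>. 0)"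
  shows "tendsto_in_prob M (\<lambda>k. simple_bracket (n k) (p k) (\<xi> k) s t) (\<lambda>\<omega>. LBINT u:{s..t}. (H u \<omega>)\<^sup>2)"
  unfolding tendsto_in_prob_def
proof (intro allI impI)
  fix \<epsilon> :: real assume \<epsilon>: "0 < \<epsilon>"
  note Hm = progressive_joint_measurable[OF Hp st(3)]
  define D where "D k \<omega> = (LBINT s:{0..t}. (simple_process (n k) (p k) (\<xi> k) s \<omega> - H s \<omega>)\<^sup>2)" for k \<omega>
  define A where "A \<omega> = (LBINT u:{s..t}. (H u \<omega>)\<^sup>2)" for \<omega>
  define A0 where "A0 \<omega> = (LBINT u:{0..t}. (H u \<omega>)\<^sup>2)" for \<omega>
  have Dm[measurable]: "D k \<in> borel_measurable M" for k
  proof -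
    note [measurable] = simple_integrand_joint_measurable[OF H[of k], of t] Hm
    show ?thesis unfolding D_def
      by (rule borel_measurable_set_integral_restrict) (simp_all add: case_prod_beta)
  qed
  have [measurable]: "A0 \<in> borel_measurable M" "A \<in> borel_measurable M"
    unfolding A0_def A_def using Hm st by (auto intro!: borel_measurable_set_integral_restrict simp: case_prod_beta)
  have sp: "simple_bracket (n k) (p k) (\<xi> k) s t \<omega> = (LBINT u:{s..t}. (simple_process (n k) (p k) (\<xi> k) u \<omega>)\<^sup>2)" for k \<omega>
    using H[of k] st by (subst simple_bracket_eq_integral) (auto simp: simple_integrand_def)
  have spm[measurable]: "simple_bracket (n k) (p k) (\<xi> k) s t \<in> borel_measurable M" for k
  proof -
    note [measurable] = simple_integrand_joint_measurable[OF H[of k], of t]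
    show ?thesis unfolding sp using st
      by (intro borel_measurable_set_integral_restrict) (simp_all add: case_prod_beta)
  qed
  have AE_bound: "AE \<omega> in M. \<forall>\<eta>>0. \<forall>k. \<bar>simple_bracket (n k) (p k) (\<xi> k) s t \<omega> - A \<omega>\<bar> \<le> (1 + 1 / \<eta>) * D k \<omega> + \<eta> * A0 \<omega>"
    using HI AE_space
  proof eventually_elim
    case (elim \<omega>)
    show ?case
    proof (intro allI impI)
      fix \<eta> :: real and k assume "0 < \<eta>"
      have ps: "p k i < p k (Suc i)" if "i < n k" for i using H[of k] that by (auto simp: simple_integrand_def)
      show "\<bar>simple_bracket (n k) (p k) (\<xi> k) s t \<omega> - A \<omega>\<bar> \<le> (1 + 1 / \<eta>) * D k \<omega> + \<eta> * A0 \<omega>"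
        unfolding sp A_def D_def A0_def
      proof (rule integral_square_diff_bound)
        show "set_integrable lborel {0..t} (\<lambda>u. (simple_process (n k) (p k) (\<xi> k) u \<omega>)\<^sup>2)"
          using ps st by (intro simple_bracket_eq_integral) auto
        show "(\<lambda>u. indicator {0..t} u * simple_process (n k) (p k) (\<xi> k) u \<omega>) \<in> borel_measurable borel"
          by (rule borel_measurable_section_restrict[OF simple_integrand_joint_measurable[OF H[of k]] elim(2)])
        show "(\<lambda>u. indicator {0..t} u * H u \<omega>) \<in> borel_measurable borel"
          by (rule borel_measurable_section_restrict[OF Hm elim(2)])
      qed fact+
    qed
  qed
  show "(\<lambda>k. prob {\<omega> \<in> space M. \<epsilon> < \<bar>simple_bracket (n k) (p k) (\<xi> k) s t \<omega> - (LBINT u:{s..t}. (H u \<omega>)\<^sup>2)\<bar>}) \<longlonglongrightarrow> 0"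
  proof (rule LIMSEQ_I)
    fix r :: real assume r: "0 < r"
    obtain K where K: "0 < K" "prob {\<omega>\<in>space M. K < A0 \<omega>} < r / 2"
      using real_random_variable_tight[of A0 "r/2"] r by auto
    define \<eta> where "\<eta> = \<epsilon> / (2 * K)"
    have \<eta>: "0 < \<eta>" using \<epsilon> K by (simp add: \<eta>_def)
    define c where "c = \<epsilon> / (2 * (1 + 1 / \<eta>))"
    have c: "0 < c" using \<epsilon> \<eta> by (simp add: c_def add_pos_pos)
    have "(\<lambda>k. prob {\<omega>\<in>space M. c < \<bar>D k \<omega> - 0\<bar>}) \<longlonglongrightarrow> 0"
      using tendsto_in_probD[OF D c] by (simp add: D_def)
    then have "\<forall>\<^sub>F k in sequentially. prob {\<omega>\<in>space M. c < \<bar>D k \<omega> - 0\<bar>} < r / 2"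
      using r by (intro order_tendstoD) auto
    then obtain N where N: "\<And>k. k \<ge> N \<Longrightarrow> prob {\<omega>\<in>space M. c < \<bar>D k \<omega>\<bar>} < r / 2"
      by (auto simp: eventually_sequentially)
    have le: "prob {\<omega> \<in> space M. \<epsilon> < \<bar>simple_bracket (n k) (p k) (\<xi> k) s t \<omega> - A \<omega>\<bar>} \<le>
      prob {\<omega>\<in>space M. K < A0 \<omega>} + prob {\<omega>\<in>space M. c < \<bar>D k \<omega>\<bar>}" for k
    proof -
      have "prob {\<omega> \<in> space M. \<epsilon> < \<bar>simple_bracket (n k) (p k) (\<xi> k) s t \<omega> - A \<omega>\<bar>} \<le>
        prob ({\<omega>\<in>space M. K < A0 \<omega>} \<union> {\<omega>\<in>space M. c < \<bar>D k \<omega>\<bar>})"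
      proof (rule finite_measure_mono_AE)
        show "AE \<omega> in M. \<omega> \<in> {\<omega> \<in> space M. \<epsilon> < \<bar>simple_bracket (n k) (p k) (\<xi> k) s t \<omega> - A \<omega>\<bar>} \<longrightarrow>
           \<omega> \<in> {\<omega>\<in>space M. K < A0 \<omega>} \<union> {\<omega>\<in>space M. c < \<bar>D k \<omega>\<bar>}"
          using AE_bound
        proof eventually_elim
          case (elim \<omega>)
          show ?case
          proof (intro impI, rule ccontr)
            assume *: "\<omega> \<in> {\<omega> \<in> space M. \<epsilon> < \<bar>simple_bracket (n k) (p k) (\<xi> k) s t \<omega> - A \<omega>\<bar>}"
              and "\<omega> \<notin> {\<omega>\<in>space M. K < A0 \<omega>} \<union> {\<omega>\<in>space M. c < \<bar>D k \<omega>\<bar>}"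
            then have 1: "A0 \<omega> \<le> K" "D k \<omega> \<le> c" by auto
            have "(1 + 1 / \<eta>) * D k \<omega> \<le> (1 + 1 / \<eta>) * c" using 1 \<eta> by (intro mult_left_mono) auto
            also have "\<dots> = \<epsilon> / 2"
            proof -
              have "x * (\<epsilon> / (2 * x)) = \<epsilon> / 2" if "0 < x" for x using that by simp
              from this[of "1 + 1 / \<eta>"] show ?thesis using \<eta> unfolding c_def by (simp add: add_pos_pos)
            qed
            finally have 2: "(1 + 1 / \<eta>) * D k \<omega> \<le> \<epsilon> / 2" .
            have "\<eta> * A0 \<omega> \<le> \<eta> * K" using 1 \<eta> by simp
            also have "\<dots> = \<epsilon> / 2" using K by (simp add: \<eta>_def)
            finally have "\<eta> * A0 \<omega> \<le> \<epsilon> / 2" .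
            moreover have "\<bar>simple_bracket (n k) (p k) (\<xi> k) s t \<omega> - A \<omega>\<bar> \<le> (1 + 1 / \<eta>) * D k \<omega> + \<eta> * A0 \<omega>"
              using elim \<eta> by blast
            moreover have "\<epsilon> < \<bar>simple_bracket (n k) (p k) (\<xi> k) s t \<omega> - A \<omega>\<bar>" using * by simp
            ultimately show False using 2 by linarith
          qed
        qed
      qed measurable
      also have "\<dots> \<le> prob {\<omega>\<in>space M. K < A0 \<omega>} + prob {\<omega>\<in>space M. c < \<bar>D k \<omega>\<bar>}"
        by (rule measure_Un_le) measurable
      finally show ?thesis .
    qed
    show "\<exists>no. \<forall>k\<ge>no. norm (prob {\<omega> \<in> space M. \<epsilon> < \<bar>simple_bracket (n k) (p k) (\<xi> k) s t \<omega> - (LBINT u:{s..t}. (H u \<omega>)\<^sup>2)\<bar>} - 0) < r"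
    proof (intro exI allI impI)
      fix k assume "N \<le> k"
      then show "norm (prob {\<omega> \<in> space M. \<epsilon> < \<bar>simple_bracket (n k) (p k) (\<xi> k) s t \<omega> - (LBINT u:{s..t}. (H u \<omega>)\<^sup>2)\<bar>} - 0) < r"
        using le[of k] K N[of k] by (simp add: A_def)
    qed
  qed
qed

text \<open>
  The limit of \<open>simple_ito_integral_char_bound\<close> along the approximating simple integrands. Halving the
  tolerance inside the probability leaves room for the error in the brackets.
\<close>
lemma ito_integral_char_bound:
  fixes W :: "'a \<Rightarrow> complex" and a \<delta> \<theta> :: real
  assumes I: "is_ito_integral M T F B H I"
    and st: "s \<in> time_dom T" "t \<in> time_dom T" "s \<le> t"
    and W: "W \<in> borel_measurable (F s)" and W1: "\<And>\<omega>. \<omega> \<in> space M \<Longrightarrow> norm (W \<omega>) \<le> 1"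
    and a: "0 \<le> a" and \<delta>: "0 < \<delta>"
  shows "norm ((CLINT \<omega>|M. W \<omega> * iexp (\<theta> * (I t \<omega> - I s \<omega>))) - of_real (exp (- a / 2)) * (CLINT \<omega>|M. W \<omega>))
    \<le> (exp (\<delta> / 2) - 1) + (1 + exp (\<delta> / 2)) * prob {\<omega>\<in>space M. \<delta> / 2 < \<bar>\<theta>\<^sup>2 * (LBINT u:{s..t}. (H u \<omega>)\<^sup>2) - a\<bar>}"
proof -
  obtain n p \<xi> where H: "\<And>k. simple_integrand M T F (n k) (p k) (\<xi> k)"
    and D: "\<And>t. t \<in> time_dom T \<Longrightarrow> tendsto_in_prob M
             (\<lambda>k \<omega>. LBINT s:{0..t}. (simple_process (n k) (p k) (\<xi> k) s \<omega> - H s \<omega>)\<^sup>2) (\<lambda>\<omega>. 0)"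
    and S: "\<And>t. t \<in> time_dom T \<Longrightarrow> tendsto_in_prob M (\<lambda>k. simple_ito_integral B (n k) (p k) (\<xi> k) t) (I t)"
    using I unfolding is_ito_integral_def by blast
  have Hp: "progressive T F H" and HI: "AE \<omega> in M. set_integrable lborel {0..t} (\<lambda>s. (H s \<omega>)\<^sup>2)"
    and Ia: "\<And>t. t \<in> time_dom T \<Longrightarrow> I t \<in> borel_measurable (F t)"
    using I st unfolding is_ito_integral_def adapted_def by blast+
  have s0: "0 \<le> s" using st by (simp add: time_dom_def)
  have Im[measurable]: "I s \<in> borel_measurable M" "I t \<in> borel_measurable M"
    using measurable_F_M Ia st by auto
  have Wm[measurable]: "W \<in> borel_measurable M" using measurable_F_M[OF st(1) W] .
  define Y where "Y k t = simple_ito_integral B (n k) (p k) (\<xi> k) t" for k t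
  have Ym: "Y k u \<in> borel_measurable M" if "u \<in> time_dom T" for k u
  proof -
    have pd: "min u (p k i) \<in> time_dom T" if "i \<le> n k" for i
      using H[of k] \<open>u \<in> time_dom T\<close> that by (auto simp: simple_integrand_def min_def)
    have \<xi>: "\<xi> k i \<in> borel_measurable M" if "i < n k" for i
      using simple_integrand_measurable[OF H that] .
    have "B (min u (p k i)) \<in> borel_measurable M" if "i \<le> n k" for i
      using measurable_F_M[OF pd[OF that] B_measurable_F[OF pd[OF that]]] .
    with \<xi> show ?thesis unfolding Y_def simple_ito_integral_def[abs_def]
      by (intro borel_measurable_sum borel_measurable_times borel_measurable_diff) auto
  qed
  note [measurable] = Ym[OF st(1)] Ym[OF st(2)]
  define A where "A \<omega> = (LBINT u:{s..t}. (H u \<omega>)\<^sup>2)" for \<omega>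
  define Ak where "Ak k = simple_bracket (n k) (p k) (\<xi> k) s t" for k
  have [measurable]: "A \<in> borel_measurable M"
    unfolding A_def using progressive_joint_measurable[OF Hp st(2)] s0 by (auto intro!: borel_measurable_set_integral_restrict simp: case_prod_beta)
  have [measurable]: "Ak k \<in> borel_measurable M" for k
  proof -
    have "\<xi> k i \<in> borel_measurable M" if "i < n k" for i
      using simple_integrand_measurable[OF H that] .
    then show ?thesis unfolding Ak_def simple_bracket_def[abs_def]
      by (intro borel_measurable_sum borel_measurable_times borel_measurable_power) auto
  qed
  have lim1: "(\<lambda>k. CLINT \<omega>|M. W \<omega> * iexp (\<theta> * (Y k t \<omega> - Y k s \<omega>))) \<longlonglongrightarrow> (CLINT \<omega>|M. W \<omega> * iexp (\<theta> * (I t \<omega> - I s \<omega>)))"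
    using S[OF st(1)] S[OF st(2)] W1
    by (intro tendsto_in_prob_char tendsto_in_prob_diff) (auto simp: Y_def[symmetric])
  have bl: "tendsto_in_prob M Ak A"
    unfolding Ak_def[abs_def] A_def[abs_def]
    by (rule simple_bracket_tendsto[OF H Hp s0 st(3,2) HI D[OF st(2)]])
  define c where "c = \<delta> / (2 * (\<theta>\<^sup>2 + 1))"
  have c: "0 < c" "\<theta>\<^sup>2 * c \<le> \<delta> / 2"
    using \<delta> by (auto simp: c_def field_simps add_pos_nonneg intro!: divide_pos_pos)
  have lim2: "(\<lambda>k. (exp (\<delta> / 2) - 1) + (1 + exp (\<delta> / 2)) *
      (prob {\<omega>\<in>space M. \<delta> / 2 < \<bar>\<theta>\<^sup>2 * A \<omega> - a\<bar>} + prob {\<omega>\<in>space M. c < \<bar>Ak k \<omega> - A \<omega>\<bar>})) \<longlonglongrightarrow>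
      (exp (\<delta> / 2) - 1) + (1 + exp (\<delta> / 2)) * (prob {\<omega>\<in>space M. \<delta> / 2 < \<bar>\<theta>\<^sup>2 * A \<omega> - a\<bar>} + 0)"
    by (intro tendsto_intros tendsto_in_probD[OF bl c(1)])
  have le: "norm ((CLINT \<omega>|M. W \<omega> * iexp (\<theta> * (Y k t \<omega> - Y k s \<omega>))) - of_real (exp (- a / 2)) * (CLINT \<omega>|M. W \<omega>))
    \<le> (exp (\<delta> / 2) - 1) + (1 + exp (\<delta> / 2)) *
      (prob {\<omega>\<in>space M. \<delta> / 2 < \<bar>\<theta>\<^sup>2 * A \<omega> - a\<bar>} + prob {\<omega>\<in>space M. c < \<bar>Ak k \<omega> - A \<omega>\<bar>})" for k
  proof -
    have "prob {\<omega>\<in>space M. \<delta> < \<bar>\<theta>\<^sup>2 * Ak k \<omega> - a\<bar>} \<le>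
      prob ({\<omega>\<in>space M. \<delta> / 2 < \<bar>\<theta>\<^sup>2 * A \<omega> - a\<bar>} \<union> {\<omega>\<in>space M. c < \<bar>Ak k \<omega> - A \<omega>\<bar>})"
    proof (rule finite_measure_mono, safe)
      fix \<omega> assume *: "\<delta> < \<bar>\<theta>\<^sup>2 * Ak k \<omega> - a\<bar>" "\<not> c < \<bar>Ak k \<omega> - A \<omega>\<bar>"
      have "\<bar>\<theta>\<^sup>2 * Ak k \<omega> - \<theta>\<^sup>2 * A \<omega>\<bar> = \<theta>\<^sup>2 * \<bar>Ak k \<omega> - A \<omega>\<bar>"
        by (simp add: abs_mult flip: right_diff_distrib)
      also have "\<dots> \<le> \<theta>\<^sup>2 * c" using *(2) by (intro mult_left_mono) auto
      finally show "\<delta> / 2 < \<bar>\<theta>\<^sup>2 * A \<omega> - a\<bar>" using *(1) c(2) by linarith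
    qed measurable
    also have "\<dots> \<le> prob {\<omega>\<in>space M. \<delta> / 2 < \<bar>\<theta>\<^sup>2 * A \<omega> - a\<bar>} + prob {\<omega>\<in>space M. c < \<bar>Ak k \<omega> - A \<omega>\<bar>}"
      by (rule measure_Un_le) measurable
    finally have "(1 + exp (\<delta> / 2)) * prob {\<omega>\<in>space M. \<delta> < \<bar>\<theta>\<^sup>2 * Ak k \<omega> - a\<bar>} \<le> (1 + exp (\<delta> / 2)) *
       (prob {\<omega>\<in>space M. \<delta> / 2 < \<bar>\<theta>\<^sup>2 * A \<omega> - a\<bar>} + prob {\<omega>\<in>space M. c < \<bar>Ak k \<omega> - A \<omega>\<bar>})"
      by (intro mult_left_mono) (auto intro: add_nonneg_nonneg)
    note order_trans[OF simple_ito_integral_char_bound[OF H[of k] st W W1 a \<delta>, of \<theta>] add_left_mono[OF this[unfolded Ak_def]]]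
    then show ?thesis unfolding Y_def Ak_def .
  qed
  show ?thesis
    using LIMSEQ_le[OF tendsto_norm[OF tendsto_diff[OF lim1 tendsto_const]] lim2] le unfolding A_def by simp
qed

text \<open>
  For a deterministic integrand \<open>a\<close> can be taken to be the bracket itself; then the probability in
  \<open>ito_integral_char_bound\<close> is \<open>0\<close>, and \<open>\<delta>\<close> tends to \<open>0\<close>.
\<close>
lemma ito_integral_deterministic_char:
  fixes W :: "'a \<Rightarrow> complex" and \<theta> :: real
  assumes I: "is_ito_integral M T F B (\<lambda>s \<omega>. h s) I"
    and st: "s \<in> time_dom T" "t \<in> time_dom T" "s \<le> t"
    and W: "W \<in> borel_measurable (F s)" and W1: "\<And>\<omega>. \<omega> \<in> space M \<Longrightarrow> norm (W \<omega>) \<le> 1"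
  shows "(CLINT \<omega>|M. W \<omega> * iexp (\<theta> * (I t \<omega> - I s \<omega>))) =
    of_real (exp (- (\<theta>\<^sup>2 * (LBINT u:{s..t}. (h u)\<^sup>2)) / 2)) * (CLINT \<omega>|M. W \<omega>)" (is "?L = ?R")
proof -
  define a where "a = \<theta>\<^sup>2 * (LBINT u:{s..t}. (h u)\<^sup>2)"
  have a: "0 \<le> a" by (auto simp: a_def set_lebesgue_integral_def intro!: mult_nonneg_nonneg Bochner_Integration.integral_nonneg)
  have le: "norm (?L - ?R) \<le> exp (\<delta> / 2) - 1" if "0 < \<delta>" for \<delta>
    using ito_integral_char_bound[OF I st W W1 a that, of \<theta>] that by (simp add: a_def)
  have lim: "((\<lambda>\<delta>. exp (\<delta> / 2) - 1) \<longlongrightarrow> exp (0 / 2) - 1) (at_right (0::real))"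
    by (auto intro!: tendsto_eq_intros)
  have "norm (?L - ?R) \<le> exp (0 / 2) - 1"
    by (rule tendsto_lowerbound[OF lim]) (use eventually_mono[OF eventually_at_right_less[of 0] le] in simp_all)
  then show ?thesis by simp
qed

end

section \<open>Riemann sums for a linear equation\<close>

text \<open>
  If \<open>c r r'\<close> agrees with the increment of \<open>G\<close> up to an error that is small compared with the mesh,
  uniformly, then the errors add up to something that vanishes with the mesh. Both Riemann sums
  below are instances.
\<close>
lemma telescoping_sum_limit:
  fixes G :: "real \<Rightarrow> real" and c :: "real \<Rightarrow> real \<Rightarrow> real" and s t :: real
  assumes st: "s \<le> t"
    and c: "\<And>\<kappa>. 0 < \<kappa> \<Longrightarrow> \<exists>d>0. \<forall>r r'. s \<le> r \<longrightarrow> r \<le> r' \<longrightarrow> r' \<le> t \<longrightarrow> r' - r < d \<longrightarrow> \<bar>G r' - G r - c r r'\<bar> \<le> \<kappa> * (r' - r)"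
  shows "(\<lambda>n. \<Sum>i<n. c (s + i * (t - s) / n) (s + Suc i * (t - s) / n)) \<longlonglongrightarrow> G t - G s"
proof (rule LIMSEQ_I)
  fix e :: real assume e: "0 < e"
  define \<kappa> where "\<kappa> = e / (2 * (t - s + 1))"
  have "e * (t - s) < e * (2 * (t - s + 1))" using e st by (intro mult_strict_left_mono) auto
  then have \<kappa>: "0 < \<kappa>" "\<kappa> * (t - s) < e" using e st by (simp_all add: \<kappa>_def pos_divide_less_eq)
  obtain d where d: "0 < d" "\<And>r r'. s \<le> r \<Longrightarrow> r \<le> r' \<Longrightarrow> r' \<le> t \<Longrightarrow> r' - r < d \<Longrightarrow> \<bar>G r' - G r - c r r'\<bar> \<le> \<kappa> * (r' - r)"
    using c[OF \<kappa>(1)] by blast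
  obtain N :: nat where N: "(t - s) / d < N" using reals_Archimedean2 by blast
  show "\<exists>no. \<forall>n\<ge>no. norm ((\<Sum>i<n. c (s + i * (t - s) / n) (s + Suc i * (t - s) / n)) - (G t - G s)) < e"
  proof (intro exI allI impI)
    fix n assume n: "Suc N \<le> n"
    define r where "r i = s + real i * (t - s) / n" for i
    have n0: "0 < real n" and nN: "real N < n" using n by auto
    have "(t - s) / d < n" using N nN by simp
    then have mesh: "(t - s) / n < d" using d(1) n0 by (simp add: field_simps)
    have step: "r (Suc i) - r i = (t - s) / n" for i by (simp add: r_def ring_distribs add_divide_distrib diff_divide_distrib)
    have rs: "s \<le> r i" for i using st by (simp add: r_def)
    have rt: "r i \<le> t" if "i \<le> n" for i
    proof -
      have "real i * (t - s) / n \<le> real n * (t - s) / n" using that st by (intro divide_right_mono mult_right_mono) auto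
      then show ?thesis using n0 by (simp add: r_def)
    qed
    have "(\<Sum>i<n. G (r (Suc i)) - G (r i)) = G (r n) - G (r 0)" by (rule sum_lessThan_telescope)
    also have "\<dots> = G t - G s" using n0 by (simp add: r_def)
    finally have "norm ((\<Sum>i<n. c (r i) (r (Suc i))) - (G t - G s)) = norm (\<Sum>i<n. c (r i) (r (Suc i)) - (G (r (Suc i)) - G (r i)))"
      by (simp add: sum_subtractf)
    also have "\<dots> \<le> (\<Sum>i<n. \<kappa> * ((t - s) / n))"
    proof (rule sum_norm_le)
      fix i assume "i \<in> {..<n}"
      moreover have "0 \<le> (t - s) / n" using st by simp
      then have "r i \<le> r (Suc i)" using step[of i] by linarith
      ultimately have "\<bar>G (r (Suc i)) - G (r i) - c (r i) (r (Suc i))\<bar> \<le> \<kappa> * (r (Suc i) - r i)"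
        using mesh by (intro d(2) rs rt) (auto simp: step)
      then show "norm (c (r i) (r (Suc i)) - (G (r (Suc i)) - G (r i))) \<le> \<kappa> * ((t - s) / n)"
        by (simp add: step abs_minus_commute)
    qed
    also have "\<dots> = \<kappa> * (t - s)" using n0 by simp
    also have "\<dots> < e" by fact
    finally show "norm ((\<Sum>i<n. c (s + i * (t - s) / n) (s + Suc i * (t - s) / n)) - (G t - G s)) < e"
      by (simp only: r_def)
  qed
qed

lemma LBINT_continuous:
  fixes f :: "real \<Rightarrow> real"
  assumes "continuous_on {a..b} f"
  shows "set_integrable lborel {a..b} f" "(LBINT u:{a..b}. f u) = integral {a..b} f" "f integrable_on {a..b}"
proof -
  show 1: "set_integrable lborel {a..b} f"
    by (rule borel_integrable_atLeastAtMost'[OF assms])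
  show "(LBINT u:{a..b}. f u) = integral {a..b} f" "f integrable_on {a..b}"
    using set_borel_integral_eq_integral[OF 1] by auto
qed

lemma integral_increment:
  fixes f :: "real \<Rightarrow> real"
  assumes "continuous_on {0..t} f" "0 \<le> r" "r \<le> r'" "r' \<le> t"
  shows "integral {0..r'} f - integral {0..r} f = integral {r..r'} f"
proof -
  have "f integrable_on {0..r'}"
    using LBINT_continuous(3)[OF continuous_on_subset[OF assms(1)], of 0 r'] assms by auto
  from Henstock_Kurzweil_Integration.integral_combine[OF assms(2,3) this] show ?thesis by simp
qed

lemma uniformly_continuous_Icc:
  fixes f :: "real \<Rightarrow> real"
  assumes "continuous_on {0..t} f" "0 < e"
  shows "\<exists>d>0. \<forall>u\<in>{0..t}. \<forall>v\<in>{0..t}. \<bar>u - v\<bar> < d \<longrightarrow> \<bar>f u - f v\<bar> < e"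
  using compact_uniformly_continuous[OF assms(1)] assms(2)
  unfolding uniformly_continuous_on_def dist_real_def by (meson compact_Icc abs_minus_commute)

lemma continuous_bounded_Icc:
  fixes f :: "real \<Rightarrow> real"
  assumes "continuous_on {a..b} f"
  shows "\<exists>C>0. \<forall>u\<in>{a..b}. \<bar>f u\<bar> \<le> C"
proof -
  have "bounded (f ` {a..b})" using assms compact_continuous_image compact_imp_bounded by blast
  then show ?thesis by (auto simp: bounded_pos)
qed

lemma exp_integral_FTC:
  fixes \<beta> :: "real \<Rightarrow> real"
  assumes \<beta>: "continuous_on {0..t} \<beta>"
  defines "E \<equiv> \<lambda>u. exp (- integral {0..u} \<beta>)"
  shows "continuous_on {0..t} E"
    and "\<And>r r'. 0 \<le> r \<Longrightarrow> r \<le> r' \<Longrightarrow> r' \<le> t \<Longrightarrow> E r' - E r = - integral {r..r'} (\<lambda>u. \<beta> u * E u)"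
proof -
  have D: "(E has_real_derivative - (\<beta> u * E u)) (at u within {0..t})" if "u \<in> {0..t}" for u
  proof -
    have "((\<lambda>u. integral {0..u} \<beta>) has_real_derivative \<beta> u) (at u within {0..t})"
      using integral_has_real_derivative[OF \<beta> that] .
    then show ?thesis unfolding E_def by (auto intro!: derivative_eq_intros)
  qed
  then show "continuous_on {0..t} E"
    unfolding continuous_on_eq_continuous_within using DERIV_continuous by blast
  fix r r' assume r: "0 \<le> r" "r \<le> r'" "r' \<le> t"
  have "((\<lambda>u. - (\<beta> u * E u)) has_integral E r' - E r) {r..r'}"
    using r D by (intro fundamental_theorem_of_calculus)
      (auto simp: has_real_derivative_iff_has_vector_derivative[symmetric] intro!: DERIV_subset[OF D])
  then show "E r' - E r = - integral {r..r'} (\<lambda>u. \<beta> u * E u)"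
    by (metis integral_unique integral_neg)
qed

text \<open>
  If \<open>S\<close> is the driver of \<open>dx = \<beta> x dt + dS\<close>, then \<open>d(E x) = E dS\<close> for the integrating factor \<open>E\<close>. As
  \<open>S\<close> is merely continuous, the integral on the right is read as a limit of Riemann-Stieltjes sums: over a
  cell, the increment of \<open>E x\<close> differs from \<open>E r (S r' - S r)\<close> by the integral of
  \<open>\<beta> u (E r x u - x r' E u)\<close>, whose integrand is uniformly small on short cells.
\<close>
lemma linear_ode_riemann_sum:
  fixes x \<beta> :: "real \<Rightarrow> real" and s t :: real
  assumes \<beta>: "continuous_on {0..t} \<beta>" and x: "continuous_on {0..t} x" and s: "0 \<le> s" "s \<le> t"
  defines "E \<equiv> \<lambda>u. exp (- integral {0..u} \<beta>)" and "S \<equiv> \<lambda>u. x u - x 0 - integral {0..u} (\<lambda>v. \<beta> v * x v)"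
  shows "(\<lambda>n. \<Sum>i<n. E (s + i * (t - s) / n) * (S (s + Suc i * (t - s) / n) - S (s + i * (t - s) / n)))
    \<longlonglongrightarrow> E t * x t - E s * x s"
proof (rule telescoping_sum_limit[OF s(2), where G="\<lambda>u. E u * x u" and c="\<lambda>r r'. E r * (S r' - S r)"])
  fix \<kappa> :: real assume \<kappa>: "0 < \<kappa>"
  note E = exp_integral_FTC[OF \<beta>, folded E_def]
  obtain Cb where Cb: "0 < Cb" "\<And>u. u \<in> {0..t} \<Longrightarrow> \<bar>\<beta> u\<bar> \<le> Cb" using continuous_bounded_Icc[OF \<beta>] by blast
  obtain Cx where Cx: "0 < Cx" "\<And>u. u \<in> {0..t} \<Longrightarrow> \<bar>x u\<bar> \<le> Cx" using continuous_bounded_Icc[OF x] by blast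
  obtain Ce where Ce: "0 < Ce" "\<And>u. u \<in> {0..t} \<Longrightarrow> \<bar>E u\<bar> \<le> Ce" using continuous_bounded_Icc[OF E(1)] by blast
  (* Makes the bound for the integrand of the cell error equal to the prescribed tolerance. *)
  define k where "k = \<kappa> / (Cb * (Cx + Ce))"
  have pos: "0 < Cb * (Cx + Ce)" using Cb(1) Cx(1) Ce(1) by (intro mult_pos_pos add_pos_pos)
  have "Cb * (k * Cx + Ce * k) = (Cb * (Cx + Ce)) * k" by (simp add: algebra_simps)
  also have "\<dots> = \<kappa>" using pos unfolding k_def by (metis nonzero_mult_div_cancel_left order_less_irrefl times_divide_eq_right)
  finally have k: "0 < k" "Cb * (k * Cx + Ce * k) = \<kappa>" using pos \<kappa> unfolding k_def by (auto intro: divide_pos_pos)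
  obtain d1 where d1: "0 < d1" "\<And>u v. u \<in> {0..t} \<Longrightarrow> v \<in> {0..t} \<Longrightarrow> \<bar>u - v\<bar> < d1 \<Longrightarrow> \<bar>E u - E v\<bar> < k"
    using uniformly_continuous_Icc[OF E(1) k(1)] by blast
  obtain d2 where d2: "0 < d2" "\<And>u v. u \<in> {0..t} \<Longrightarrow> v \<in> {0..t} \<Longrightarrow> \<bar>u - v\<bar> < d2 \<Longrightarrow> \<bar>x u - x v\<bar> < k"
    using uniformly_continuous_Icc[OF x k(1)] by blast
  show "\<exists>d>0. \<forall>r r'. s \<le> r \<longrightarrow> r \<le> r' \<longrightarrow> r' \<le> t \<longrightarrow> r' - r < d \<longrightarrow> \<bar>E r' * x r' - E r * x r - E r * (S r' - S r)\<bar> \<le> \<kappa> * (r' - r)"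
  proof (intro exI[of _ "min d1 d2"] conjI allI impI)
    fix r r' assume r: "s \<le> r" "r \<le> r'" "r' \<le> t" "r' - r < min d1 d2"
    then have r0: "0 \<le> r" using s by simp
    have sub: "{r..r'} \<subseteq> {0..t}" using r r0 by auto
    have cont: "continuous_on {r..r'} \<beta>" "continuous_on {r..r'} x" "continuous_on {r..r'} E"
      using \<beta> x E(1) sub by (auto intro: continuous_on_subset)
    have c\<beta>x: "continuous_on {0..t} (\<lambda>v. \<beta> v * x v)" using \<beta> x by (intro continuous_intros)
    have Sd: "S r' - S r = x r' - x r - integral {r..r'} (\<lambda>v. \<beta> v * x v)"
      using integral_increment[OF c\<beta>x r0 r(2,3)] by (simp add: S_def)
    have i3: "(\<lambda>v. E r * (\<beta> v * x v)) integrable_on {r..r'}" "(\<lambda>u. x r' * (\<beta> u * E u)) integrable_on {r..r'}"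
      using cont by (auto intro!: LBINT_continuous(3) continuous_intros)
    have "E r' * x r' - E r * x r - E r * (S r' - S r) = x r' * (E r' - E r) + E r * integral {r..r'} (\<lambda>v. \<beta> v * x v)"
      unfolding Sd by (simp add: algebra_simps)
    also have "\<dots> = E r * integral {r..r'} (\<lambda>v. \<beta> v * x v) - x r' * integral {r..r'} (\<lambda>u. \<beta> u * E u)"
      using exp_integral_FTC(2)[OF \<beta> r0 r(2,3)] by (simp add: E_def)
    also have "\<dots> = integral {r..r'} (\<lambda>u. E r * (\<beta> u * x u) - x r' * (\<beta> u * E u))"
      using i3 by (subst integral_diff) auto
    finally have eq: "E r' * x r' - E r * x r - E r * (S r' - S r) = integral {r..r'} (\<lambda>u. E r * (\<beta> u * x u) - x r' * (\<beta> u * E u))" .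
    show "\<bar>E r' * x r' - E r * x r - E r * (S r' - S r)\<bar> \<le> \<kappa> * (r' - r)"
      unfolding eq real_norm_def[symmetric]
    proof (rule integral_bound[OF r(2)])
      show "continuous_on {r..r'} (\<lambda>u. E r * (\<beta> u * x u) - x r' * (\<beta> u * E u))"
        using cont by (intro continuous_intros)
      fix u assume u: "u \<in> {r..r'}"
      have m: "u \<in> {0..t}" "r \<in> {0..t}" "r' \<in> {0..t}" using u sub r r0 by auto
      have "\<bar>E r - E u\<bar> \<le> k" using d1(2)[OF m(2,1)] u r by auto
      moreover have "\<bar>x u - x r'\<bar> \<le> k" using d2(2)[OF m(1,3)] u r by auto
      ultimately have "\<bar>E r - E u\<bar> * \<bar>x u\<bar> + \<bar>E u\<bar> * \<bar>x u - x r'\<bar> \<le> k * Cx + Ce * k"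
        using Cx(2)[OF m(1)] Ce(2)[OF m(1)] k Cx Ce by (intro add_mono mult_mono) auto
      then have "\<bar>(E r - E u) * x u + E u * (x u - x r')\<bar> \<le> k * Cx + Ce * k"
        by (intro order_trans[OF abs_triangle_ineq]) (simp add: abs_mult)
      then have "\<bar>\<beta> u\<bar> * \<bar>(E r - E u) * x u + E u * (x u - x r')\<bar> \<le> Cb * (k * Cx + Ce * k)"
        using Cb(2)[OF m(1)] Cb by (intro mult_mono) auto
      also have "\<bar>\<beta> u\<bar> * \<bar>(E r - E u) * x u + E u * (x u - x r')\<bar> = \<bar>E r * (\<beta> u * x u) - x r' * (\<beta> u * E u)\<bar>"
        unfolding abs_mult[symmetric] by (intro arg_cong[where f=abs]) (simp add: algebra_simps)
      finally show "norm (E r * (\<beta> u * x u) - x r' * (\<beta> u * E u)) \<le> \<kappa>" using k(2) by simp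
    qed
  qed (use d1 d2 in auto)
qed

lemma weighted_integral_riemann_sum:
  fixes e f :: "real \<Rightarrow> real" and s t :: real
  assumes e: "continuous_on {0..t} e" and f: "continuous_on {0..t} f" and s: "0 \<le> s" "s \<le> t"
  shows "(\<lambda>n. \<Sum>i<n. e (s + i * (t - s) / n) * integral {s + i * (t - s) / n..s + Suc i * (t - s) / n} f)
    \<longlonglongrightarrow> integral {0..t} (\<lambda>u. e u * f u) - integral {0..s} (\<lambda>u. e u * f u)"
proof (rule telescoping_sum_limit[OF s(2), where G="\<lambda>v. integral {0..v} (\<lambda>u. e u * f u)" and c="\<lambda>r r'. e r * integral {r..r'} f"])
  fix \<kappa> :: real assume \<kappa>: "0 < \<kappa>"
  obtain C where C: "0 < C" "\<And>u. u \<in> {0..t} \<Longrightarrow> \<bar>f u\<bar> \<le> C" using continuous_bounded_Icc[OF f] by blast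
  obtain d where d: "0 < d" "\<And>u v. u \<in> {0..t} \<Longrightarrow> v \<in> {0..t} \<Longrightarrow> \<bar>u - v\<bar> < d \<Longrightarrow> \<bar>e u - e v\<bar> < \<kappa> / C"
    using uniformly_continuous_Icc[OF e, of "\<kappa> / C"] \<kappa> C by auto
  show "\<exists>d>0. \<forall>r r'. s \<le> r \<longrightarrow> r \<le> r' \<longrightarrow> r' \<le> t \<longrightarrow> r' - r < d \<longrightarrow>
    \<bar>integral {0..r'} (\<lambda>u. e u * f u) - integral {0..r} (\<lambda>u. e u * f u) - e r * integral {r..r'} f\<bar> \<le> \<kappa> * (r' - r)"
  proof (intro exI[of _ d] conjI allI impI d(1))
    fix r r' assume r: "s \<le> r" "r \<le> r'" "r' \<le> t" "r' - r < d"
    then have r0: "0 \<le> r" using s by simp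
    have sub: "{r..r'} \<subseteq> {0..t}" using r r0 by auto
    have cont: "continuous_on {r..r'} e" "continuous_on {r..r'} f"
      using e f sub by (auto intro: continuous_on_subset)
    have cef: "continuous_on {0..t} (\<lambda>v. e v * f v)" using e f by (intro continuous_intros)
    have i1: "(\<lambda>v. e v * f v) integrable_on {r..r'}" and i2: "(\<lambda>v. e r * f v) integrable_on {r..r'}"
      using cont by (auto intro!: LBINT_continuous(3) continuous_intros)
    have eq: "integral {0..r'} (\<lambda>u. e u * f u) - integral {0..r} (\<lambda>u. e u * f u) - e r * integral {r..r'} f =
       integral {r..r'} (\<lambda>u. e u * f u - e r * f u)"
      unfolding integral_increment[OF cef r0 r(2,3)] using i1 i2 by (subst integral_diff) auto
    show "\<bar>integral {0..r'} (\<lambda>u. e u * f u) - integral {0..r} (\<lambda>u. e u * f u) - e r * integral {r..r'} f\<bar> \<le> \<kappa> * (r' - r)"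
      unfolding eq real_norm_def[symmetric]
    proof (rule integral_bound[OF r(2)])
      show "continuous_on {r..r'} (\<lambda>u. e u * f u - e r * f u)" using cont by (intro continuous_intros)
      fix u assume u: "u \<in> {r..r'}"
      have m: "u \<in> {0..t}" "r \<in> {0..t}" using u sub r r0 by auto
      have "\<bar>e u - e r\<bar> \<le> \<kappa> / C" using d(2)[OF m] u r by auto
      then have "\<bar>e u - e r\<bar> * \<bar>f u\<bar> \<le> \<kappa> / C * C" using C(2)[OF m(1)] C(1) \<kappa> by (intro mult_mono) auto
      then show "norm (e u * f u - e r * f u) \<le> \<kappa>" using C by (simp flip: abs_mult left_diff_distrib)
    qed
  qed
qed

section \<open>The rescaled diffusion as a Gaussian process\<close>

locale linear_diffusion = wiener_process M T F B for M :: "'a measure" and T F B +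
  fixes b \<sigma> :: "real \<Rightarrow> real" and \<alpha> :: real and X :: "real \<Rightarrow> 'a \<Rightarrow> real"
  assumes b: "continuous_on (time_dom T) b" and \<sigma>: "continuous_on (time_dom T) \<sigma>"
    and X: "is_solution M T F B \<alpha> b \<sigma> X"
begin

text \<open>The integrating factor of the equation for \<open>X\<close>.\<close>
definition E :: "real \<Rightarrow> real" where "E t = exp (- (\<alpha> * (LBINT v:{0..t}. b v)))"

text \<open>The variance function of \<open>Y\<close>.\<close>
definition G :: "real \<Rightarrow> real" where "G t = (LBINT u:{0..t}. (E u)\<^sup>2 * (\<sigma> u)\<^sup>2)"

definition Y :: "real \<Rightarrow> 'a \<Rightarrow> real" where "Y t \<omega> = E t * X t \<omega>"

lemma Icc_time_dom: "t \<in> time_dom T \<Longrightarrow> {0..t} \<subseteq> time_dom T"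
  by (auto simp: time_dom_def intro: le_less_trans[of _ "ereal t"])

lemma b_cont: "t \<in> time_dom T \<Longrightarrow> continuous_on {0..t} b"
  and \<sigma>_cont: "t \<in> time_dom T \<Longrightarrow> continuous_on {0..t} \<sigma>"
  using b \<sigma> Icc_time_dom continuous_on_subset by blast+

lemma E_eq: "t \<in> time_dom T \<Longrightarrow> u \<in> {0..t} \<Longrightarrow> E u = exp (- integral {0..u} (\<lambda>v. \<alpha> * b v))"
  unfolding E_def using LBINT_continuous(2)[OF b_cont, of u] Icc_time_dom by (auto simp: subset_eq)

lemma E_pos: "0 < E t" by (simp add: E_def)

lemma E_cont:
  assumes t: "t \<in> time_dom T"
  shows "continuous_on {0..t} E"
proof -
  have "continuous_on {0..t} (\<lambda>v. \<alpha> * b v)" using b_cont[OF t] by (intro continuous_intros)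
  from exp_integral_FTC(1)[OF this] show ?thesis
    by (rule continuous_on_eq) (rule E_eq[OF t, symmetric])
qed

lemma X_adapted: "t \<in> time_dom T \<Longrightarrow> X t \<in> borel_measurable (F t)"
  and X_paths: "\<omega> \<in> space M \<Longrightarrow> continuous_on (time_dom T) (\<lambda>t. X t \<omega>)"
  and X_0: "AE \<omega> in M. X 0 \<omega> = 0"
  and X_ito: "is_ito_integral M T F B (\<lambda>t \<omega>. \<sigma> t) (\<lambda>t \<omega>. X t \<omega> - X 0 \<omega> - (LBINT s:{0..t}. \<alpha> * b s * X s \<omega>))"
  using X unfolding is_solution_def has_ito_differential_def adapted_def continuous_paths_def
  by auto

lemma X_cont: "\<omega> \<in> space M \<Longrightarrow> t \<in> time_dom T \<Longrightarrow> continuous_on {0..t} (\<lambda>t. X t \<omega>)"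
  using X_paths Icc_time_dom continuous_on_subset by blast

lemma Y_adapted: "t \<in> time_dom T \<Longrightarrow> Y t \<in> borel_measurable (F t)"
  unfolding Y_def using X_adapted by measurable

lemma Y_measurable: "t \<in> time_dom T \<Longrightarrow> Y t \<in> borel_measurable M"
  using measurable_F_M Y_adapted by blast

text \<open>The driving martingale \<open>\<integral> \<sigma> dB\<close>.\<close>
definition S :: "real \<Rightarrow> 'a \<Rightarrow> real" where
  "S t \<omega> = X t \<omega> - X 0 \<omega> - (LBINT s:{0..t}. \<alpha> * b s * X s \<omega>)"

lemma S_adapted: "t \<in> time_dom T \<Longrightarrow> S t \<in> borel_measurable (F t)"
  using X_ito unfolding is_ito_integral_def adapted_def S_def[abs_def] by blast

lemma S_char:
  fixes W :: "'a \<Rightarrow> complex"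
  assumes "s \<in> time_dom T" "t \<in> time_dom T" "s \<le> t"
    and "W \<in> borel_measurable (F s)" and "\<And>\<omega>. \<omega> \<in> space M \<Longrightarrow> norm (W \<omega>) \<le> 1"
  shows "(CLINT \<omega>|M. W \<omega> * iexp (\<theta> * (S t \<omega> - S s \<omega>))) =
    of_real (exp (- (\<theta>\<^sup>2 * (LBINT u:{s..t}. (\<sigma> u)\<^sup>2)) / 2)) * (CLINT \<omega>|M. W \<omega>)"
  using ito_integral_deterministic_char[OF X_ito[folded S_def] assms] .

text \<open>
  The increments of \<open>S\<close> are conditionally Gaussian given the past, so they can be split off one at a time.
\<close>
lemma S_weighted_sum_char:
  fixes W :: "'a \<Rightarrow> complex" and e r :: "nat \<Rightarrow> real"
  assumes r: "\<And>i. i \<le> n \<Longrightarrow> r i \<in> time_dom T" "\<And>i. i < n \<Longrightarrow> r i \<le> r (Suc i)"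
    and W: "W \<in> borel_measurable (F (r 0))" and W1: "\<And>\<omega>. \<omega> \<in> space M \<Longrightarrow> norm (W \<omega>) \<le> 1"
  shows "(CLINT \<omega>|M. W \<omega> * iexp (\<theta> * (\<Sum>i<n. e i * (S (r (Suc i)) \<omega> - S (r i) \<omega>)))) =
    of_real (exp (- (\<theta>\<^sup>2 * (\<Sum>i<n. (e i)\<^sup>2 * (LBINT u:{r i..r (Suc i)}. (\<sigma> u)\<^sup>2))) / 2)) * (CLINT \<omega>|M. W \<omega>)"
proof -
  define U where "U m \<omega> = W \<omega> * iexp (\<theta> * (\<Sum>i<m. e i * (S (r (Suc i)) \<omega> - S (r i) \<omega>)))" for m \<omega>
  have "U m \<in> borel_measurable (F (r m)) \<and> (\<forall>\<omega>\<in>space M. norm (U m \<omega>) \<le> 1) \<and> (CLINT \<omega>|M. U m \<omega>) =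
    of_real (exp (- (\<theta>\<^sup>2 * (\<Sum>i<m. (e i)\<^sup>2 * (LBINT u:{r i..r (Suc i)}. (\<sigma> u)\<^sup>2))) / 2)) * (CLINT \<omega>|M. W \<omega>)" if "m \<le> n" for m
    using that
  proof (induction m)
    case 0
    then show ?case using W W1 by (simp add: U_def)
  next
    case (Suc m)
    then have IH: "U m \<in> borel_measurable (F (r m))" "\<And>\<omega>. \<omega> \<in> space M \<Longrightarrow> norm (U m \<omega>) \<le> 1"
      "(CLINT \<omega>|M. U m \<omega>) = of_real (exp (- (\<theta>\<^sup>2 * (\<Sum>i<m. (e i)\<^sup>2 * (LBINT u:{r i..r (Suc i)}. (\<sigma> u)\<^sup>2))) / 2)) * (CLINT \<omega>|M. W \<omega>)"
      by auto
    have rm: "r m \<in> time_dom T" "r (Suc m) \<in> time_dom T" "r m \<le> r (Suc m)" using Suc.prems r by auto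
    have eq: "U (Suc m) \<omega> = U m \<omega> * iexp ((\<theta> * e m) * (S (r (Suc m)) \<omega> - S (r m) \<omega>))" for \<omega>
      by (simp add: U_def distrib_left exp_add ac_simps)
    have [measurable]: "U m \<in> borel_measurable (F (r (Suc m)))" "S (r m) \<in> borel_measurable (F (r (Suc m)))" "S (r (Suc m)) \<in> borel_measurable (F (r (Suc m)))"
      using measurable_F_mono[OF rm] IH(1) S_adapted rm by auto
    have "U (Suc m) \<in> borel_measurable (F (r (Suc m)))" unfolding eq by measurable
    moreover have "norm (U (Suc m) \<omega>) \<le> 1" if "\<omega> \<in> space M" for \<omega>
      unfolding eq using IH(2)[OF that] by (simp add: norm_mult)
    moreover have "(CLINT \<omega>|M. U (Suc m) \<omega>) =
      of_real (exp (- (\<theta>\<^sup>2 * (\<Sum>i<Suc m. (e i)\<^sup>2 * (LBINT u:{r i..r (Suc i)}. (\<sigma> u)\<^sup>2))) / 2)) * (CLINT \<omega>|M. W \<omega>)"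
    proof -
      define L where "L = (LBINT u:{r m..r (Suc m)}. (\<sigma> u)\<^sup>2)"
      define R where "R = (\<Sum>i<m. (e i)\<^sup>2 * (LBINT u:{r i..r (Suc i)}. (\<sigma> u)\<^sup>2))"
      have "(CLINT \<omega>|M. U (Suc m) \<omega>) = of_real (exp (- ((\<theta> * e m)\<^sup>2 * L) / 2)) * (CLINT \<omega>|M. U m \<omega>)"
        unfolding eq L_def by (rule S_char[OF rm IH(1,2)])
      also have "\<dots> = of_real (exp (- ((\<theta> * e m)\<^sup>2 * L) / 2) * exp (- (\<theta>\<^sup>2 * R) / 2)) * (CLINT \<omega>|M. W \<omega>)"
        unfolding IH(3) R_def by (simp only: of_real_mult mult.assoc)
      also have "exp (- ((\<theta> * e m)\<^sup>2 * L) / 2) * exp (- (\<theta>\<^sup>2 * R) / 2) = exp (- (\<theta>\<^sup>2 * (R + (e m)\<^sup>2 * L)) / 2)"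
        unfolding exp_add[symmetric] by (simp add: power_mult_distrib algebra_simps add_divide_distrib)
      finally show ?thesis by (simp add: R_def L_def)
    qed
    ultimately show ?case by simp
  qed
  from this[of n] show ?thesis by (simp add: U_def)
qed

text \<open>
  As the weight \<open>W\<close> is an arbitrary bounded variable of the past, this says that \<open>Y t - Y s\<close> is
  independent of \<open>F s\<close> and normal with variance \<open>G t - G s\<close>. It follows from \<open>S_weighted_sum_char\<close>: the
  Riemann-Stieltjes sums of \<open>S\<close> converge pathwise to \<open>Y t - Y s\<close>, and their variances are Riemann sums
  for \<open>G t - G s\<close>.
\<close>
lemma Y_increment_char:
  fixes W :: "'a \<Rightarrow> complex"
  assumes st: "s \<in> time_dom T" "t \<in> time_dom T" "s \<le> t"
    and W: "W \<in> borel_measurable (F s)" and W1: "\<And>\<omega>. \<omega> \<in> space M \<Longrightarrow> norm (W \<omega>) \<le> 1"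
  shows "(CLINT \<omega>|M. W \<omega> * iexp (\<theta> * (Y t \<omega> - Y s \<omega>))) = of_real (exp (- (\<theta>\<^sup>2 * (G t - G s)) / 2)) * (CLINT \<omega>|M. W \<omega>)"
proof -
  define r where "r n i = s + real i * (t - s) / real n" for n i :: nat
  have s0: "0 \<le> s" using st by (simp add: time_dom_def)
  have sub: "{0..t} \<subseteq> time_dom T" by (rule Icc_time_dom[OF st(2)])
  have r_ge: "s \<le> r n i" for n i using st by (simp add: r_def)
  have r_le: "r n i \<le> t" if "i \<le> n" for n i
  proof (cases "n = 0")
    case True then show ?thesis using st by (simp add: r_def)
  next
    case False
    have "real i * (t - s) / n \<le> real n * (t - s) / n" using that st by (intro divide_right_mono mult_right_mono) auto
    then show ?thesis using False by (simp add: r_def)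
  qed
  have r_mono: "r n i \<le> r n (Suc i)" for n i
    unfolding r_def using st by (intro add_left_mono divide_right_mono mult_right_mono) auto
  have r_dom: "r n i \<in> {0..t}" if "i \<le> n" for n i using r_ge[of n i] r_le[OF that] s0 by auto
  define R where "R n \<omega> = (\<Sum>i<n. E (r n i) * (S (r n (Suc i)) \<omega> - S (r n i) \<omega>))" for n \<omega>
  define V where "V n = (\<Sum>i<n. (E (r n i))\<^sup>2 * (LBINT u:{r n i..r n (Suc i)}. (\<sigma> u)\<^sup>2))" for n
  have R_lim: "(\<lambda>n. R n \<omega>) \<longlonglongrightarrow> Y t \<omega> - Y s \<omega>" if \<omega>: "\<omega> \<in> space M" for \<omega>
  proof -
    have c: "continuous_on {0..t} (\<lambda>v. \<alpha> * b v)" using b_cont[OF st(2)] by (intro continuous_intros)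
    have Su: "S u \<omega> = X u \<omega> - X 0 \<omega> - integral {0..u} (\<lambda>v. \<alpha> * b v * X v \<omega>)" if "u \<in> {0..t}" for u
    proof -
      have "continuous_on {0..u} (\<lambda>v. \<alpha> * b v * X v \<omega>)"
        using that sub by (intro continuous_intros b_cont X_cont[OF \<omega>]) auto
      then show ?thesis by (simp add: S_def LBINT_continuous)
    qed
    have "(\<lambda>n. R n \<omega>) = (\<lambda>n. \<Sum>i<n. exp (- integral {0..r n i} (\<lambda>v. \<alpha> * b v)) * ((X (r n (Suc i)) \<omega> - X 0 \<omega> - integral {0..r n (Suc i)} (\<lambda>v. \<alpha> * b v * X v \<omega>)) -
        (X (r n i) \<omega> - X 0 \<omega> - integral {0..r n i} (\<lambda>v. \<alpha> * b v * X v \<omega>))))"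
      unfolding R_def
    proof (intro ext sum.cong refl)
      fix n i :: nat assume "i \<in> {..<n}"
      then show "E (r n i) * (S (r n (Suc i)) \<omega> - S (r n i) \<omega>) = exp (- integral {0..r n i} (\<lambda>v. \<alpha> * b v)) * ((X (r n (Suc i)) \<omega> - X 0 \<omega> - integral {0..r n (Suc i)} (\<lambda>v. \<alpha> * b v * X v \<omega>)) -
        (X (r n i) \<omega> - X 0 \<omega> - integral {0..r n i} (\<lambda>v. \<alpha> * b v * X v \<omega>)))"
        using r_dom[of i n] r_dom[of "Suc i" n] by (simp add: E_eq[OF st(2)] Su)
    qed
    also have "\<dots> \<longlonglongrightarrow> Y t \<omega> - Y s \<omega>"
      using linear_ode_riemann_sum[OF c X_cont[OF \<omega> st(2)] s0 st(3)] s0 st(3)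
      unfolding Y_def r_def by (simp add: E_eq[OF st(2)])
    finally show ?thesis .
  qed
  have V_lim: "V \<longlonglongrightarrow> G t - G s"
  proof -
    have cE: "continuous_on {0..t} (\<lambda>u. (E u)\<^sup>2)" and c\<sigma>: "continuous_on {0..t} (\<lambda>u. (\<sigma> u)\<^sup>2)"
      using E_cont \<sigma>_cont st by (auto intro!: continuous_intros)
    have "V = (\<lambda>n. \<Sum>i<n. (E (r n i))\<^sup>2 * integral {r n i..r n (Suc i)} (\<lambda>u. (\<sigma> u)\<^sup>2))"
      unfolding V_def
    proof (intro ext sum.cong refl)
      fix n i :: nat assume "i \<in> {..<n}"
      then have "continuous_on {r n i..r n (Suc i)} (\<lambda>u. (\<sigma> u)\<^sup>2)"
        using r_dom[of i n] r_dom[of "Suc i" n] by (intro continuous_on_subset[OF c\<sigma>]) auto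
      then show "(E (r n i))\<^sup>2 * (LBINT u:{r n i..r n (Suc i)}. (\<sigma> u)\<^sup>2) = (E (r n i))\<^sup>2 * integral {r n i..r n (Suc i)} (\<lambda>u. (\<sigma> u)\<^sup>2)"
        by (simp add: LBINT_continuous)
    qed
    moreover have "G u = integral {0..u} (\<lambda>u. (E u)\<^sup>2 * (\<sigma> u)\<^sup>2)" if "u \<in> {0..t}" for u
    proof -
      have "continuous_on {0..u} (\<lambda>u. (E u)\<^sup>2 * (\<sigma> u)\<^sup>2)"
        using that by (intro continuous_on_subset[OF continuous_on_mult[OF cE c\<sigma>]]) auto
      then show ?thesis by (simp add: G_def LBINT_continuous)
    qed
    ultimately show ?thesis
      using weighted_integral_riemann_sum[OF cE c\<sigma> s0 st(3)] s0 st(3) unfolding r_def by simp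
  qed
  have Sm: "S u \<in> borel_measurable M" if "u \<in> {0..t}" for u
    using measurable_F_M[OF _ S_adapted, of u] that sub by auto
  have [measurable]: "R n \<in> borel_measurable M" for n
    unfolding R_def using r_dom Sm by (intro borel_measurable_sum borel_measurable_times borel_measurable_diff) auto
  have [measurable]: "W \<in> borel_measurable M" "Y t \<in> borel_measurable M" "Y s \<in> borel_measurable M"
    using measurable_F_M[OF st(1) W] Y_measurable st by auto
  have "(\<lambda>n. CLINT \<omega>|M. W \<omega> * iexp (\<theta> * R n \<omega>)) \<longlonglongrightarrow> (CLINT \<omega>|M. W \<omega> * iexp (\<theta> * (Y t \<omega> - Y s \<omega>)))"
  proof (rule integral_dominated_convergence[where w="\<lambda>_. 1"])
    show "AE \<omega> in M. (\<lambda>n. W \<omega> * iexp (\<theta> * R n \<omega>)) \<longlonglongrightarrow> W \<omega> * iexp (\<theta> * (Y t \<omega> - Y s \<omega>))"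
      by (intro AE_I2 tendsto_intros R_lim)
    show "AE \<omega> in M. norm (W \<omega> * iexp (\<theta> * R n \<omega>)) \<le> 1" for n
      using W1 by (intro AE_I2) (simp add: norm_mult)
  qed simp_all
  moreover have "(CLINT \<omega>|M. W \<omega> * iexp (\<theta> * R n \<omega>)) = of_real (exp (- (\<theta>\<^sup>2 * V n) / 2)) * (CLINT \<omega>|M. W \<omega>)" for n
    unfolding R_def V_def
    using r_dom sub W W1 r_mono by (intro S_weighted_sum_char) (auto simp: r_def[of _ 0])
  moreover have "(\<lambda>n. of_real (exp (- (\<theta>\<^sup>2 * V n) / 2)) * (CLINT \<omega>|M. W \<omega>)) \<longlonglongrightarrow> of_real (exp (- (\<theta>\<^sup>2 * (G t - G s)) / 2)) * (CLINT \<omega>|M. W \<omega>)"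
    by (intro tendsto_intros V_lim) simp
  ultimately show ?thesis using LIMSEQ_unique by auto
qed

lemma Y_0: "AE \<omega> in M. Y 0 \<omega> = 0"
  using X_0 by eventually_elim (simp add: Y_def)

lemma G_0: "G 0 = 0"
proof -
  have "AE u in lborel. u \<noteq> (0::real)" by (rule AE_lborel_singleton)
  then have "(LBINT u:{0..0}. (E u)\<^sup>2 * (\<sigma> u)\<^sup>2) = 0"
    unfolding set_lebesgue_integral_def by (intro integral_eq_zero_AE) (auto elim!: eventually_mono)
  then show ?thesis by (simp add: G_def)
qed

text \<open>
  Linear combinations of \<open>Y u\<close> and \<open>Y v\<close> are Gaussian: write them as \<open>(c + d) Y u + d (Y v - Y u)\<close> and use the
  first summand as the weight.
\<close>
lemma Y_pair_char:
  assumes uv: "u \<in> time_dom T" "v \<in> time_dom T" "u \<le> v"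
  shows "(CLINT \<omega>|M. iexp (\<theta> * (c * Y u \<omega> + d * Y v \<omega>))) = of_real (exp (- (\<theta>\<^sup>2 * ((c + d)\<^sup>2 * G u + d\<^sup>2 * (G v - G u))) / 2))"
proof -
  have 0: "0 \<in> time_dom T" "0 \<le> u" using time_dom_0[OF uv(1)] uv by (auto simp: time_dom_def)
  note [measurable] = Y_adapted[OF uv(1)] Y_measurable[OF uv(1)] Y_measurable[OF 0(1)]
  have "(CLINT \<omega>|M. iexp (\<theta> * (c * Y u \<omega> + d * Y v \<omega>))) = (CLINT \<omega>|M. iexp (\<theta> * ((c + d) * Y u \<omega>)) * iexp ((\<theta> * d) * (Y v \<omega> - Y u \<omega>)))"
    unfolding exp_add[symmetric] by (intro Bochner_Integration.integral_cong refl arg_cong[where f=exp]) (simp add: algebra_simps)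
  also have "\<dots> = of_real (exp (- ((\<theta> * d)\<^sup>2 * (G v - G u)) / 2)) * (CLINT \<omega>|M. iexp (\<theta> * ((c + d) * Y u \<omega>)))"
    by (rule Y_increment_char[OF uv]) auto
  also have "(CLINT \<omega>|M. iexp (\<theta> * ((c + d) * Y u \<omega>))) = (CLINT \<omega>|M. 1 * iexp ((\<theta> * (c + d)) * (Y u \<omega> - Y 0 \<omega>)))"
    using Y_0 by (intro integral_cong_AE) (auto elim!: eventually_mono simp: ac_simps)
  also have "\<dots> = of_real (exp (- ((\<theta> * (c + d))\<^sup>2 * (G u - G 0)) / 2)) * (CLINT \<omega>|M. 1)"
    by (rule Y_increment_char[OF 0(1) uv(1) 0(2)]) auto
  also have "(CLINT \<omega>|M. 1) = 1" using prob_space by simp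
  finally show ?thesis
    unfolding G_0 mult.right_neutral of_real_mult[symmetric] exp_add[symmetric] power_mult_distrib
    by (simp add: algebra_simps add_divide_distrib diff_divide_distrib)
qed

end

text \<open>
  The characteristic function identifies the law of \<open>Z\<close> as that of \<open>sqrt w\<close> times a standard normal
  variable. This includes the degenerate case \<open>w = 0\<close>.
\<close>
lemma (in prob_space) gaussian_moments_of_char:
  fixes Z :: "'a \<Rightarrow> real"
  assumes Z[measurable]: "Z \<in> borel_measurable M" and w: "0 \<le> w"
    and char: "\<And>\<theta>. (CLINT \<omega>|M. iexp (\<theta> * Z \<omega>)) = of_real (exp (- (\<theta>\<^sup>2 * w) / 2))"
  shows "integrable M (\<lambda>\<omega>. (Z \<omega>)\<^sup>2)" "(LINT \<omega>|M. (Z \<omega>)\<^sup>2) = w"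
    and "integrable M (\<lambda>\<omega>. (Z \<omega>)^4)" "(LINT \<omega>|M. (Z \<omega>)^4) = 3 * w\<^sup>2"
proof -
  interpret N: real_distribution std_normal_distribution by (rule real_dist_normal_dist)
  let ?N = "distr std_normal_distribution borel (\<lambda>x. sqrt w * x)"
  have "distr M borel Z = ?N"
  proof (rule Levy_uniqueness)
    show "real_distribution (distr M borel Z)" by (rule real_distribution_distr) simp
    show "real_distribution ?N" by (rule N.real_distribution_distr) simp
    show "char (distr M borel Z) = char ?N"
    proof
      fix \<theta>
      have "char ?N \<theta> = (CLINT x|std_normal_distribution. iexp ((\<theta> * sqrt w) * x))"
        by (simp add: char_def integral_distr ac_simps)
      then show "char (distr M borel Z) \<theta> = char ?N \<theta>"
        unfolding integral_iexp_std_normal using char[of \<theta>] w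
        by (simp add: char_def integral_distr power_mult_distrib)
    qed
  qed
  note D = this
  have int: "integrable M (\<lambda>\<omega>. (Z \<omega>)^k) \<longleftrightarrow> integrable std_normal_distribution (\<lambda>x. (sqrt w * x)^k)"
    and eq: "(LINT \<omega>|M. (Z \<omega>)^k) = (LINT x|std_normal_distribution. (sqrt w * x)^k)" for k
  proof -
    have "integrable M (\<lambda>\<omega>. (Z \<omega>)^k) \<longleftrightarrow> integrable (distr M borel Z) (\<lambda>x. x^k)"
      by (simp add: integrable_distr_eq)
    also have "\<dots> \<longleftrightarrow> integrable std_normal_distribution (\<lambda>x. (sqrt w * x)^k)"
      unfolding D by (simp add: integrable_distr_eq)
    finally show "integrable M (\<lambda>\<omega>. (Z \<omega>)^k) \<longleftrightarrow> integrable std_normal_distribution (\<lambda>x. (sqrt w * x)^k)" .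
    have "(LINT \<omega>|M. (Z \<omega>)^k) = (LINT x|distr M borel Z. x^k)"
      by (simp add: integral_distr)
    also have "\<dots> = (LINT x|std_normal_distribution. (sqrt w * x)^k)"
      unfolding D by (simp add: integral_distr)
    finally show "(LINT \<omega>|M. (Z \<omega>)^k) = (LINT x|std_normal_distribution. (sqrt w * x)^k)" .
  qed
  show "integrable M (\<lambda>\<omega>. (Z \<omega>)\<^sup>2)" "integrable M (\<lambda>\<omega>. (Z \<omega>)^4)"
    unfolding int power_mult_distrib by (auto intro: integrable_std_normal_distribution_moment)
  show "(LINT \<omega>|M. (Z \<omega>)\<^sup>2) = w"
    unfolding eq power_mult_distrib using std_normal_distribution_even_moments(1)[of 1] w by simp
  have "sqrt w ^ 4 = w\<^sup>2" using w power_mult[of "sqrt w" 2 2] by simp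
  then show "(LINT \<omega>|M. (Z \<omega>)^4) = 3 * w\<^sup>2"
    unfolding eq power_mult_distrib using std_normal_distribution_even_moments(1)[of 2] by (simp add: fact_numeral)
qed

section \<open>The variance of the observed information\<close>

lemma nn_integral_restrict_LBINT:
  fixes f :: "real \<Rightarrow> real"
  assumes f: "continuous_on {0..t} f" and nn: "\<And>u. u \<in> {0..t} \<Longrightarrow> 0 \<le> f u"
  shows "(\<integral>\<^sup>+u. ennreal (f u) \<partial>restrict_space lborel {0..t}) = ennreal (LBINT u:{0..t}. f u)"
proof -
  have "(\<integral>\<^sup>+u. ennreal (f u) \<partial>restrict_space lborel {0..t}) = (\<integral>\<^sup>+u. ennreal (indicator {0..t} u *\<^sub>R f u) \<partial>lborel)"
    by (subst nn_integral_restrict_space) (auto simp: indicator_def intro!: nn_integral_cong)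
  also have "\<dots> = ennreal (LBINT u:{0..t}. f u)"
    using LBINT_continuous(1)[OF f] nn unfolding set_integrable_def set_lebesgue_integral_def
    by (intro nn_integral_eq_integral) (auto simp: indicator_def)
  finally show ?thesis .
qed

lemma sigma_finite_restrict_lborel: "sigma_finite_measure (restrict_space lborel {0..t::real})"
  by (rule sigma_finite_measure_restrict_space) (auto intro: lborel.sigma_finite_measure_axioms)

text \<open>
  The square of an integral as a double integral of products. Stated for \<open>ennreal\<close>, where
  Tonelli's theorem applies directly; it reduces the second moment of \<open>A t\<close> to the covariances of
  its integrand.
\<close>
lemma nn_integral_square_Tonelli:
  fixes f :: "'b \<Rightarrow> 'a \<Rightarrow> ennreal"
  assumes "sigma_finite_measure L" "sigma_finite_measure M"
    and f[measurable]: "(\<lambda>(u, \<omega>). f u \<omega>) \<in> borel_measurable (L \<Otimes>\<^sub>M M)"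
  shows "(\<integral>\<^sup>+\<omega>. (\<integral>\<^sup>+u. f u \<omega> \<partial>L)\<^sup>2 \<partial>M) = (\<integral>\<^sup>+u. \<integral>\<^sup>+v. \<integral>\<^sup>+\<omega>. f u \<omega> * f v \<omega> \<partial>M \<partial>L \<partial>L)"
proof -
  interpret L: sigma_finite_measure L by fact
  interpret M: sigma_finite_measure M by fact
  interpret LM: pair_sigma_finite L M ..
  define a where "a \<omega> = (\<integral>\<^sup>+u. f u \<omega> \<partial>L)" for \<omega>
  have fs[measurable]: "(\<lambda>x. f (snd x) (fst x)) \<in> borel_measurable (M \<Otimes>\<^sub>M L)"
    using measurable_compose[OF measurable_pair_swap' f] by (simp add: case_prod_beta)
  have f'[measurable]: "(\<lambda>x. f (fst x) (snd x)) \<in> borel_measurable (L \<Otimes>\<^sub>M M)"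
    using f by (simp add: case_prod_beta)
  have fu[measurable]: "(\<lambda>u. f u \<omega>) \<in> borel_measurable L" if "\<omega> \<in> space M" for \<omega>
    using measurable_compose[OF measurable_Pair2'[OF that] f'] by simp
  have f\<omega>[measurable]: "(\<lambda>\<omega>. f u \<omega>) \<in> borel_measurable M" if "u \<in> space L" for u
    using measurable_compose[OF measurable_Pair1'[OF that] f'] by simp
  have am[measurable]: "a \<in> borel_measurable M"
    unfolding a_def by (rule L.borel_measurable_nn_integral) (simp add: case_prod_beta)
  have "(\<integral>\<^sup>+\<omega>. (a \<omega>)\<^sup>2 \<partial>M) = (\<integral>\<^sup>+\<omega>. \<integral>\<^sup>+u. f u \<omega> * a \<omega> \<partial>L \<partial>M)"
    using fu by (intro nn_integral_cong) (simp add: nn_integral_multc power2_eq_square flip: a_def)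
  also have "\<dots> = (\<integral>\<^sup>+u. \<integral>\<^sup>+\<omega>. f u \<omega> * a \<omega> \<partial>M \<partial>L)"
    by (rule LM.Fubini') (simp add: case_prod_beta)
  also have "\<dots> = (\<integral>\<^sup>+u. \<integral>\<^sup>+v. \<integral>\<^sup>+\<omega>. f u \<omega> * f v \<omega> \<partial>M \<partial>L \<partial>L)"
  proof (rule nn_integral_cong)
    fix u assume u: "u \<in> space L"
    note [measurable] = f\<omega>[OF u]
    have "(\<integral>\<^sup>+\<omega>. f u \<omega> * a \<omega> \<partial>M) = (\<integral>\<^sup>+\<omega>. \<integral>\<^sup>+v. f u \<omega> * f v \<omega> \<partial>L \<partial>M)"
      using fu by (intro nn_integral_cong) (simp add: nn_integral_cmult a_def)
    also have "\<dots> = (\<integral>\<^sup>+v. \<integral>\<^sup>+\<omega>. f u \<omega> * f v \<omega> \<partial>M \<partial>L)"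
      by (rule LM.Fubini') (simp add: case_prod_beta)
    finally show "(\<integral>\<^sup>+\<omega>. f u \<omega> * a \<omega> \<partial>M) = (\<integral>\<^sup>+v. \<integral>\<^sup>+\<omega>. f u \<omega> * f v \<omega> \<partial>M \<partial>L)" .
  qed
  finally show ?thesis by (simp add: a_def)
qed

locale mle_diffusion = linear_diffusion M T F B b \<sigma> \<alpha> X for M :: "'a measure" and T F B b \<sigma> \<alpha> X +
  fixes J :: "real \<Rightarrow> 'a \<Rightarrow> real"
  assumes \<sigma>_pos: "\<And>t. t \<in> time_dom T \<Longrightarrow> 0 < \<sigma> t"
    and J: "is_integral_against_ito_process M T F B X (\<lambda>t \<omega>. \<alpha> * b t * X t \<omega>) (\<lambda>t \<omega>. \<sigma> t)
           (\<lambda>t \<omega>. b t * X t \<omega> / (\<sigma> t)\<^sup>2) J"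
begin

lemma G_cont: "t \<in> time_dom T \<Longrightarrow> continuous_on {0..t} G"
  and G_mono: "t \<in> time_dom T \<Longrightarrow> 0 \<le> r \<Longrightarrow> r \<le> t \<Longrightarrow> G r \<le> G t"
proof -
  assume t: "t \<in> time_dom T"
  have c: "continuous_on {0..t} (\<lambda>u. (E u)\<^sup>2 * (\<sigma> u)\<^sup>2)"
    using E_cont[OF t] \<sigma>_cont[OF t] by (intro continuous_intros)
  have eq: "G u = integral {0..u} (\<lambda>u. (E u)\<^sup>2 * (\<sigma> u)\<^sup>2)" if "u \<in> {0..t}" for u
    using that by (auto simp: G_def intro!: LBINT_continuous continuous_on_subset[OF c])
  show "continuous_on {0..t} G"
    using indefinite_integral_continuous_1[OF LBINT_continuous(3)[OF c]]
    by (rule continuous_on_eq) (rule eq[symmetric])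
  assume r: "0 \<le> r" "r \<le> t"
  have "0 \<le> integral {r..t} (\<lambda>u. (E u)\<^sup>2 * (\<sigma> u)\<^sup>2)"
    using r by (intro integral_nonneg LBINT_continuous continuous_on_subset[OF c]) auto
  then show "G r \<le> G t"
    using integral_increment[OF c r order_refl] r by (simp add: eq)
qed

lemma G_nonneg: "t \<in> time_dom T \<Longrightarrow> 0 \<le> G t"
  using G_mono[of t 0] G_0 by (simp add: time_dom_def)

lemma Y_combination_moments:
  assumes uv: "u \<in> time_dom T" "v \<in> time_dom T" "u \<le> v"
  defines "w \<equiv> \<lambda>c d. (c + d)\<^sup>2 * G u + d\<^sup>2 * (G v - G u)"
  shows "integrable M (\<lambda>\<omega>. (c * Y u \<omega> + d * Y v \<omega>)\<^sup>2)" "(LINT \<omega>|M. (c * Y u \<omega> + d * Y v \<omega>)\<^sup>2) = w c d"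
    and "integrable M (\<lambda>\<omega>. (c * Y u \<omega> + d * Y v \<omega>)^4)" "(LINT \<omega>|M. (c * Y u \<omega> + d * Y v \<omega>)^4) = 3 * (w c d)\<^sup>2"
proof -
  have m: "(\<lambda>\<omega>. c * Y u \<omega> + d * Y v \<omega>) \<in> borel_measurable M"
    using Y_measurable uv by measurable
  have nn: "0 \<le> w c d"
    unfolding w_def using G_nonneg[OF uv(1)] G_mono[OF uv(2) _ uv(3)] uv(1) by (simp add: time_dom_def)
  have ch: "(CLINT \<omega>|M. iexp (\<theta> * (c * Y u \<omega> + d * Y v \<omega>))) = of_real (exp (- (\<theta>\<^sup>2 * w c d) / 2))" for \<theta>
    unfolding w_def by (rule Y_pair_char[OF uv])
  show "integrable M (\<lambda>\<omega>. (c * Y u \<omega> + d * Y v \<omega>)\<^sup>2)" "(LINT \<omega>|M. (c * Y u \<omega> + d * Y v \<omega>)\<^sup>2) = w c d"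
    "integrable M (\<lambda>\<omega>. (c * Y u \<omega> + d * Y v \<omega>)^4)" "(LINT \<omega>|M. (c * Y u \<omega> + d * Y v \<omega>)^4) = 3 * (w c d)\<^sup>2"
    by (rule gaussian_moments_of_char[OF m nn ch])+
qed

lemma Y_second_moment:
  assumes "t \<in> time_dom T"
  shows "integrable M (\<lambda>\<omega>. (Y t \<omega>)\<^sup>2)" "(LINT \<omega>|M. (Y t \<omega>)\<^sup>2) = G t"
  using Y_combination_moments(1,2)[OF assms assms order_refl, of 1 0] by auto

text \<open>
  Polarization expresses \<open>x\<^sup>2 y\<^sup>2\<close> by the fourth powers of \<open>x + y\<close>, \<open>x - y\<close>, \<open>x\<close> and \<open>y\<close>; all
  of these are Gaussian by \<open>Y_pair_char\<close>.
\<close>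
lemma Y_square_covariance:
  assumes uv: "u \<in> time_dom T" "v \<in> time_dom T" "u \<le> v"
  shows "integrable M (\<lambda>\<omega>. (Y u \<omega>)\<^sup>2 * (Y v \<omega>)\<^sup>2)"
    and "(LINT \<omega>|M. (Y u \<omega>)\<^sup>2 * (Y v \<omega>)\<^sup>2) = G u * G v + 2 * (G u)\<^sup>2"
proof -
  have pol: "(Y u \<omega>)\<^sup>2 * (Y v \<omega>)\<^sup>2 = ((1 * Y u \<omega> + 1 * Y v \<omega>)^4 + (1 * Y u \<omega> + (-1) * Y v \<omega>)^4 - 2 * (1 * Y u \<omega> + 0 * Y v \<omega>)^4 - 2 * (0 * Y u \<omega> + 1 * Y v \<omega>)^4) / 12" for \<omega>
    by (simp add: power4_eq_xxxx power2_eq_square algebra_simps)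
  note int = Y_combination_moments(3)[OF uv] and eq = Y_combination_moments(4)[OF uv]
  show "integrable M (\<lambda>\<omega>. (Y u \<omega>)\<^sup>2 * (Y v \<omega>)\<^sup>2)"
    unfolding pol by (intro integrable_divide Bochner_Integration.integrable_diff Bochner_Integration.integrable_add integrable_mult_right int)
  have "(LINT \<omega>|M. (Y u \<omega>)\<^sup>2 * (Y v \<omega>)\<^sup>2) = ((LINT \<omega>|M. (1 * Y u \<omega> + 1 * Y v \<omega>)^4) + (LINT \<omega>|M. (1 * Y u \<omega> + (-1) * Y v \<omega>)^4) -
     2 * (LINT \<omega>|M. (1 * Y u \<omega> + 0 * Y v \<omega>)^4) - 2 * (LINT \<omega>|M. (0 * Y u \<omega> + 1 * Y v \<omega>)^4)) / 12"
    unfolding pol using int[of 1 1] int[of 1 "-1"] int[of 1 0] int[of 0 1]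
    by (simp only: integral_divide_zero Bochner_Integration.integral_diff Bochner_Integration.integral_add integral_mult_right_zero
        Bochner_Integration.integrable_diff Bochner_Integration.integrable_add integrable_mult_right)
  also have "\<dots> = G u * G v + 2 * (G u)\<^sup>2"
    unfolding eq by (simp add: power2_eq_square algebra_simps)
  finally show "(LINT \<omega>|M. (Y u \<omega>)\<^sup>2 * (Y v \<omega>)\<^sup>2) = G u * G v + 2 * (G u)\<^sup>2" .
qed

text \<open>Chosen such that \<open>wt u * (Y u)\<^sup>2\<close> is the integrand of the observed information and \<open>wt u * G u\<close> that of
  the Fisher information.\<close>
definition wt :: "real \<Rightarrow> real" where "wt u = (b u)\<^sup>2 / ((\<sigma> u)\<^sup>2 * (E u)\<^sup>2)"

definition A :: "real \<Rightarrow> 'a \<Rightarrow> real" where "A t \<omega> = (LBINT u:{0..t}. (b u)\<^sup>2 * (X u \<omega>)\<^sup>2 / (\<sigma> u)\<^sup>2)"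

abbreviation I :: "real \<Rightarrow> real" where "I \<equiv> fisher_information M b \<sigma> X"

lemma wt_nonneg: "0 \<le> wt u" by (simp add: wt_def)

lemma wt_cont: "t \<in> time_dom T \<Longrightarrow> continuous_on {0..t} wt"
  unfolding wt_def using b_cont \<sigma>_cont E_cont E_pos \<sigma>_pos Icc_time_dom[of t]
  by (intro continuous_intros) (fastforce simp: less_imp_neq[symmetric] subset_eq)+

lemma A_eq: "A t \<omega> = (LBINT u:{0..t}. wt u * (Y u \<omega>)\<^sup>2)"
  unfolding A_def wt_def Y_def using E_pos by (simp add: power_mult_distrib less_imp_neq[symmetric])

lemma I_eq:
  assumes t: "t \<in> time_dom T"
  shows "I t = (LBINT u:{0..t}. wt u * G u)"
  unfolding fisher_information_def
proof (rule set_lebesgue_integral_cong)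
  show "\<forall>u. u \<in> {0..t} \<longrightarrow> (b u)\<^sup>2 * (LINT \<omega>|M. (X u \<omega>)\<^sup>2) / (\<sigma> u)\<^sup>2 = wt u * G u"
  proof (intro allI impI)
    fix u assume "u \<in> {0..t}"
    then have u: "u \<in> time_dom T" using Icc_time_dom[OF t] by blast
    have "(X u \<omega>)\<^sup>2 = (Y u \<omega>)\<^sup>2 / (E u)\<^sup>2" for \<omega>
      using E_pos[of u] by (simp add: Y_def power_mult_distrib)
    then have "(LINT \<omega>|M. (X u \<omega>)\<^sup>2) = G u / (E u)\<^sup>2" using Y_second_moment(2)[OF u] by simp
    then show "(b u)\<^sup>2 * (LINT \<omega>|M. (X u \<omega>)\<^sup>2) / (\<sigma> u)\<^sup>2 = wt u * G u" by (simp add: wt_def)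
  qed
qed simp

lemma A_nonneg: "0 \<le> A t \<omega>"
  unfolding A_def set_lebesgue_integral_def by (intro Bochner_Integration.integral_nonneg) simp

lemma A_continuous_integrand:
  "t \<in> time_dom T \<Longrightarrow> \<omega> \<in> space M \<Longrightarrow> continuous_on {0..t} (\<lambda>u. wt u * (Y u \<omega>)\<^sup>2)"
  unfolding Y_def using wt_cont E_cont X_cont by (intro continuous_intros) auto

text \<open>
  Joint measurability is inherited from the integrand \<open>b X / \<sigma>\<close> of the stochastic integral \<open>J\<close>, whose
  square is the integrand of \<open>A\<close>.
\<close>
lemma wt_Y_joint_measurable:
  assumes t: "t \<in> time_dom T"
  shows "(\<lambda>(u, \<omega>). wt u * (Y u \<omega>)\<^sup>2) \<in> borel_measurable (restrict_space borel {0..t} \<Otimes>\<^sub>M M)"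
proof -
  have "progressive T F (\<lambda>s \<omega>. b s * X s \<omega> / (\<sigma> s)\<^sup>2 * \<sigma> s)"
    using J by (auto simp: is_integral_against_ito_process_def is_ito_integral_def)
  from progressive_joint_measurable[OF this t]
  have "(\<lambda>x. (case x of (u, \<omega>) \<Rightarrow> b u * X u \<omega> / (\<sigma> u)\<^sup>2 * \<sigma> u)\<^sup>2) \<in> borel_measurable (restrict_space borel {0..t} \<Otimes>\<^sub>M M)"
    by measurable
  also have "?this \<longleftrightarrow> ?thesis"
  proof (rule measurable_cong)
    fix x assume "x \<in> space (restrict_space borel {0..t} \<Otimes>\<^sub>M M)"
    then obtain u \<omega> where x: "x = (u, \<omega>)" "u \<in> {0..t}" by (auto simp: space_pair_measure space_restrict_space)
    then have "0 < \<sigma> u" using \<sigma>_pos Icc_time_dom[OF t] by blast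
    then show "(case x of (u, \<omega>) \<Rightarrow> b u * X u \<omega> / (\<sigma> u)\<^sup>2 * \<sigma> u)\<^sup>2 = (case x of (u, \<omega>) \<Rightarrow> wt u * (Y u \<omega>)\<^sup>2)"
      using E_pos[of u] by (simp add: x wt_def Y_def power_mult_distrib power_divide power2_eq_square)
  qed
  finally show ?thesis .
qed

lemma A_measurable: "t \<in> time_dom T \<Longrightarrow> A t \<in> borel_measurable M"
  unfolding A_eq[abs_def] by (rule borel_measurable_set_integral_restrict[OF wt_Y_joint_measurable]) auto

text \<open>
  The covariance contributes \<open>2 wt u wt v (G (min u v))\<^sup>2\<close> to the second moment of \<open>A t\<close>. For \<open>u \<le> v\<close> the
  assumption bounds it by \<open>2 C wt v\<close> times the density of \<open>G\<close> at \<open>u\<close>. Integrating over \<open>u \<le> v\<close> turns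
  the density into \<open>G v\<close>, and \<open>wt v G v\<close> is the integrand of the Fisher information.
\<close>
lemma information_moments:
  assumes t: "t \<in> time_dom T" and C: "0 \<le> C"
    and bound: "\<And>u. u \<in> {0..t} \<Longrightarrow> wt u * (G u)\<^sup>2 \<le> C * ((E u)\<^sup>2 * (\<sigma> u)\<^sup>2)"
  shows "0 \<le> I t" "(\<integral>\<^sup>+\<omega>. ennreal (A t \<omega>) \<partial>M) = ennreal (I t)"
    and "(\<integral>\<^sup>+\<omega>. ennreal ((A t \<omega>)\<^sup>2) \<partial>M) \<le> ennreal ((I t)\<^sup>2 + 4 * C * I t)"
proof -
  define L where "L = restrict_space lborel {0..t}"
  define f where "f u \<omega> = ennreal (wt u * (Y u \<omega>)\<^sup>2)" for u \<omega>
  interpret L: sigma_finite_measure L unfolding L_def by (rule sigma_finite_restrict_lborel)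
  interpret LL: pair_sigma_finite L L ..
  interpret LM: pair_sigma_finite L M ..
  have t0: "0 \<le> t" using t by (simp add: time_dom_def)
  have dom: "u \<in> time_dom T" "0 \<le> u" "u \<le> t" if "u \<in> {0..t}" for u using Icc_time_dom[OF t] that by auto
  have spL: "space L = {0..t}" by (simp add: L_def space_restrict_space)
  have sL: "sets L = sets (restrict_space borel {0..t})" by (simp add: L_def sets_restrict_space)
  have fm: "(\<lambda>(u, \<omega>). f u \<omega>) \<in> borel_measurable (L \<Otimes>\<^sub>M M)"
  proof -
    have "(\<lambda>(u, \<omega>). wt u * (Y u \<omega>)\<^sup>2) \<in> borel_measurable (L \<Otimes>\<^sub>M M)"
      using wt_Y_joint_measurable[OF t] by (simp cong: measurable_cong_sets sets_pair_measure_cong add: sL)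
    then show ?thesis unfolding f_def case_prod_beta by measurable
  qed
  have cm: "g \<in> borel_measurable L" if "continuous_on {0..t} g" for g :: "real \<Rightarrow> real"
    using borel_measurable_continuous_on_restrict[OF that] by (simp cong: measurable_cong_sets add: sL)
  define e2 where "e2 u = (E u)\<^sup>2 * (\<sigma> u)\<^sup>2" for u
  have e2n: "0 \<le> e2 u" for u by (simp add: e2_def)
  have cont: "continuous_on {0..t} e2" "continuous_on {0..t} wt" "continuous_on {0..t} G"
    unfolding e2_def using E_cont \<sigma>_cont wt_cont G_cont t by (auto intro!: continuous_intros)
  note [measurable] = cm[OF cont(1)] cm[OF cont(2)] cm[OF cont(3)]
  have Gn: "0 \<le> G u" if "u \<in> {0..t}" for u using G_nonneg dom[OF that] by blast
  have I_nn: "(\<integral>\<^sup>+u. ennreal (wt u * G u) \<partial>L) = ennreal (I t)"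
    unfolding L_def I_eq[OF t] using cont wt_nonneg Gn by (intro nn_integral_restrict_LBINT continuous_intros) auto
  show I0: "0 \<le> I t"
    unfolding I_eq[OF t] set_lebesgue_integral_def using Gn wt_nonneg
    by (intro Bochner_Integration.integral_nonneg) (auto simp: indicator_def)
  have A_nn: "ennreal (A t \<omega>) = (\<integral>\<^sup>+u. f u \<omega> \<partial>L)" if "\<omega> \<in> space M" for \<omega>
    unfolding L_def A_eq f_def using A_continuous_integrand[OF t that] wt_nonneg
    by (intro nn_integral_restrict_LBINT[symmetric]) auto
  have m1: "(\<integral>\<^sup>+\<omega>. f u \<omega> \<partial>M) = ennreal (wt u * G u)" if "u \<in> {0..t}" for u
    using Y_second_moment[OF dom(1)[OF that]] wt_nonneg unfolding f_def
    by (subst nn_integral_eq_integral) auto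
  have "(\<integral>\<^sup>+\<omega>. ennreal (A t \<omega>) \<partial>M) = (\<integral>\<^sup>+\<omega>. \<integral>\<^sup>+u. f u \<omega> \<partial>L \<partial>M)"
    using A_nn by (intro nn_integral_cong) auto
  also have "\<dots> = (\<integral>\<^sup>+u. \<integral>\<^sup>+\<omega>. f u \<omega> \<partial>M \<partial>L)" by (rule LM.Fubini'[OF fm])
  also have "\<dots> = (\<integral>\<^sup>+u. ennreal (wt u * G u) \<partial>L)" using m1 by (intro nn_integral_cong) (auto simp: spL)
  finally show "(\<integral>\<^sup>+\<omega>. ennreal (A t \<omega>) \<partial>M) = ennreal (I t)" by (simp add: I_nn)
  (* Bounds the covariance where u is at most v; the other half is covered by exchanging u and v. *)
  define k where "k u v = ennreal (wt v) * (ennreal (e2 u) * indicator {..v} u)" for u v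
  have [measurable]: "(\<lambda>x. indicator {..snd x} (fst x) :: ennreal) \<in> borel_measurable (L \<Otimes>\<^sub>M L)"
  proof -
    have "(\<lambda>x. indicator {..snd x} (fst x) :: ennreal) \<in> borel_measurable (borel \<Otimes>\<^sub>M (borel :: real measure))"
      unfolding indicator_def atMost_iff by measurable
    moreover have "(\<lambda>x. (fst x, snd x)) \<in> L \<Otimes>\<^sub>M L \<rightarrow>\<^sub>M borel \<Otimes>\<^sub>M borel"
    proof -
      have "(\<lambda>x. x) \<in> L \<rightarrow>\<^sub>M borel" using cm[OF continuous_on_id] by simp
      then show ?thesis by (intro measurable_Pair) (auto intro: measurable_compose[OF measurable_fst] measurable_compose[OF measurable_snd])
    qed
    ultimately show ?thesis using measurable_compose by fastforce
  qed
  have km[measurable]: "(\<lambda>(u, v). k u v) \<in> borel_measurable (L \<Otimes>\<^sub>M L)"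
    unfolding k_def case_prod_beta by measurable
  have km'[measurable]: "(\<lambda>u. k u v) \<in> borel_measurable L" "(\<lambda>v. k u v) \<in> borel_measurable L" if "u \<in> {0..t}" "v \<in> {0..t}" for u v
    using measurable_compose[OF measurable_Pair2'[of v L] km] measurable_compose[OF measurable_Pair1'[of u L] km] that by (auto simp: spL)
  have kint: "(\<integral>\<^sup>+v. \<integral>\<^sup>+u. k u v \<partial>L \<partial>L) = ennreal (I t)"
  proof -
    have "(\<integral>\<^sup>+u. k u v \<partial>L) = ennreal (wt v * G v)" if v: "v \<in> {0..t}" for v
    proof -
      have "(\<integral>\<^sup>+u. ennreal (e2 u) * indicator {..v} u \<partial>L) = (\<integral>\<^sup>+u. ennreal (e2 u) \<partial>restrict_space lborel {0..v})"
        unfolding L_def using v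
        by (simp add: nn_integral_restrict_space) (auto intro!: nn_integral_cong simp: indicator_def)
      also have "\<dots> = ennreal (G v)"
        unfolding G_def e2_def[symmetric] using v e2n
        by (intro nn_integral_restrict_LBINT continuous_on_subset[OF cont(1)]) auto
      finally have *: "(\<integral>\<^sup>+u. ennreal (e2 u) * indicator {..v} u \<partial>L) = ennreal (G v)" .
      have [measurable]: "indicator {..v} \<in> borel_measurable L"
        unfolding L_def by (intro measurable_restrict_space1) simp
      show ?thesis unfolding k_def using wt_nonneg Gn[OF v] by (simp add: nn_integral_cmult * ennreal_mult)
    qed
    then have "(\<integral>\<^sup>+v. \<integral>\<^sup>+u. k u v \<partial>L \<partial>L) = (\<integral>\<^sup>+v. ennreal (wt v * G v) \<partial>L)"
      by (intro nn_integral_cong) (auto simp: spL)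
    then show ?thesis by (simp add: I_nn)
  qed
  have kint': "(\<integral>\<^sup>+u. \<integral>\<^sup>+v. k u v \<partial>L \<partial>L) = ennreal (I t)"
    using LL.Fubini'[OF km] kint by simp
  have m2: "(\<integral>\<^sup>+\<omega>. f u \<omega> * f v \<omega> \<partial>M) \<le> ennreal (wt u * G u) * ennreal (wt v * G v) + ennreal (2 * C) * k u v + ennreal (2 * C) * k v u"
    if uv: "u \<in> {0..t}" "v \<in> {0..t}" for u v
  proof -
    have main: "(\<integral>\<^sup>+\<omega>. f u \<omega> * f v \<omega> \<partial>M) \<le> ennreal (wt u * G u) * ennreal (wt v * G v) + ennreal (2 * C) * k u v"
      if uv: "u \<in> {0..t}" "v \<in> {0..t}" and le: "u \<le> v" for u v
    proof -
      note cov = Y_square_covariance[OF dom(1)[OF uv(1)] dom(1)[OF uv(2)] le]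
      have "(\<integral>\<^sup>+\<omega>. f u \<omega> * f v \<omega> \<partial>M) = (\<integral>\<^sup>+\<omega>. ennreal (wt u * wt v * ((Y u \<omega>)\<^sup>2 * (Y v \<omega>)\<^sup>2)) \<partial>M)"
        unfolding f_def using wt_nonneg by (intro nn_integral_cong) (simp add: ac_simps flip: ennreal_mult)
      also have "\<dots> = ennreal (wt u * wt v * (G u * G v + 2 * (G u)\<^sup>2))"
        using cov wt_nonneg by (subst nn_integral_eq_integral) auto
      also have "\<dots> \<le> ennreal (wt u * G u * (wt v * G v) + 2 * C * (wt v * e2 u))"
      proof (rule ennreal_leI)
        have "2 * wt v * (wt u * (G u)\<^sup>2) \<le> 2 * wt v * (C * e2 u)"
          using bound[OF uv(1)] wt_nonneg by (intro mult_left_mono) (auto simp: e2_def)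
        then show "wt u * wt v * (G u * G v + 2 * (G u)\<^sup>2) \<le> wt u * G u * (wt v * G v) + 2 * C * (wt v * e2 u)"
          by (simp add: algebra_simps)
      qed
      also have "\<dots> = ennreal (wt u * G u) * ennreal (wt v * G v) + ennreal (2 * C) * k u v"
        unfolding k_def using le C wt_nonneg Gn uv e2n by (simp add: ennreal_plus ennreal_mult del: ennreal_plus[symmetric])
      finally show ?thesis .
    qed
    show ?thesis
    proof (cases "u \<le> v")
      case True
      show ?thesis by (rule order_trans[OF main[OF uv True]]) simp
    next
      case False
      then have "(\<integral>\<^sup>+\<omega>. f u \<omega> * f v \<omega> \<partial>M) \<le> ennreal (wt u * G u) * ennreal (wt v * G v) + ennreal (2 * C) * k v u"
        using main[OF uv(2,1)] by (simp add: mult.commute)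
      also have "\<dots> \<le> ennreal (wt u * G u) * ennreal (wt v * G v) + ennreal (2 * C) * k u v + ennreal (2 * C) * k v u"
        by (intro add_right_mono) simp
      finally show ?thesis .
    qed
  qed
  have "(\<integral>\<^sup>+\<omega>. ennreal ((A t \<omega>)\<^sup>2) \<partial>M) = (\<integral>\<^sup>+\<omega>. (\<integral>\<^sup>+u. f u \<omega> \<partial>L)\<^sup>2 \<partial>M)"
    using A_nn A_nonneg by (intro nn_integral_cong) (auto simp flip: ennreal_power)
  also have "\<dots> = (\<integral>\<^sup>+u. \<integral>\<^sup>+v. \<integral>\<^sup>+\<omega>. f u \<omega> * f v \<omega> \<partial>M \<partial>L \<partial>L)"
    by (rule nn_integral_square_Tonelli[OF _ _ fm]) unfold_locales
  also have "\<dots> \<le> (\<integral>\<^sup>+u. \<integral>\<^sup>+v. ennreal (wt u * G u) * ennreal (wt v * G v) + ennreal (2 * C) * k u v + ennreal (2 * C) * k v u \<partial>L \<partial>L)"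
    using m2 by (intro nn_integral_mono) (auto simp: spL)
  also have "\<dots> = (\<integral>\<^sup>+u. ennreal (wt u * G u) * ennreal (I t) + ennreal (2 * C) * (\<integral>\<^sup>+v. k u v \<partial>L) + ennreal (2 * C) * (\<integral>\<^sup>+v. k v u \<partial>L) \<partial>L)"
  proof (rule nn_integral_cong)
    fix u assume "u \<in> space L"
    then have u: "u \<in> {0..t}" by (simp add: spL)
    note [measurable] = km'[OF u u]
    show "(\<integral>\<^sup>+v. ennreal (wt u * G u) * ennreal (wt v * G v) + ennreal (2 * C) * k u v + ennreal (2 * C) * k v u \<partial>L)
      = ennreal (wt u * G u) * ennreal (I t) + ennreal (2 * C) * (\<integral>\<^sup>+v. k u v \<partial>L) + ennreal (2 * C) * (\<integral>\<^sup>+v. k v u \<partial>L)"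
      by (simp add: nn_integral_add nn_integral_cmult I_nn)
  qed
  also have "\<dots> = ennreal (I t) * ennreal (I t) + ennreal (2 * C) * ennreal (I t) + ennreal (2 * C) * ennreal (I t)"
  proof -
    have km_swap: "(\<lambda>(u, v). k v u) \<in> borel_measurable (L \<Otimes>\<^sub>M L)"
      using measurable_compose[OF measurable_pair_swap' km] by (simp add: case_prod_beta)
    have [measurable]: "(\<lambda>u. \<integral>\<^sup>+v. k u v \<partial>L) \<in> borel_measurable L" "(\<lambda>u. \<integral>\<^sup>+v. k v u \<partial>L) \<in> borel_measurable L"
      using L.borel_measurable_nn_integral[OF km] L.borel_measurable_nn_integral[OF km_swap] by simp_all
    show ?thesis by (simp add: nn_integral_add nn_integral_cmult nn_integral_multc I_nn kint kint')
  qed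
  also have "\<dots> = ennreal ((I t)\<^sup>2 + 4 * C * I t)"
    using I0 C by (simp add: power2_eq_square flip: ennreal_mult ennreal_plus)
  finally show "(\<integral>\<^sup>+\<omega>. ennreal ((A t \<omega>)\<^sup>2) \<partial>M) \<le> ennreal ((I t)\<^sup>2 + 4 * C * I t)" .
qed

lemma information_Chebyshev:
  assumes t: "t \<in> time_dom T" and C: "0 \<le> C" and \<delta>: "0 < \<delta>" and I: "0 < I t"
    and bound: "\<And>u. u \<in> {0..t} \<Longrightarrow> wt u * (G u)\<^sup>2 \<le> C * ((E u)\<^sup>2 * (\<sigma> u)\<^sup>2)"
  shows "prob {\<omega>\<in>space M. \<delta> < \<bar>A t \<omega> / I t - 1\<bar>} \<le> 4 * C / (\<delta>\<^sup>2 * I t)"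
proof -
  note m = information_moments[OF t C bound]
  note [measurable] = A_measurable[OF t]
  have i1: "integrable M (A t)"
    using m(2) A_nonneg by (intro integrableI_nonneg) (auto simp: ennreal_less_top)
  have i2: "integrable M (\<lambda>\<omega>. (A t \<omega>)\<^sup>2)"
    by (intro integrableI_nonneg) (auto intro: le_less_trans[OF m(3)] simp: ennreal_less_top)
  have e1: "expectation (A t) = I t"
    using m(1,2) nn_integral_eq_integral[OF i1] A_nonneg by (simp add: Bochner_Integration.integral_nonneg)
  have "ennreal (expectation (\<lambda>\<omega>. (A t \<omega>)\<^sup>2)) \<le> ennreal ((I t)\<^sup>2 + 4 * C * I t)"
    using m(3) nn_integral_eq_integral[OF i2] by simp
  then have e2: "expectation (\<lambda>\<omega>. (A t \<omega>)\<^sup>2) \<le> (I t)\<^sup>2 + 4 * C * I t"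
    using C I by (subst (asm) ennreal_le_iff) auto
  have "variance (A t) \<le> 4 * C * I t"
    using e2 by (subst variance_eq[OF i1 i2]) (simp add: e1)
  have "prob {\<omega>\<in>space M. \<delta> < \<bar>A t \<omega> / I t - 1\<bar>} \<le> prob {\<omega>\<in>space M. \<delta> * I t \<le> \<bar>A t \<omega> - expectation (A t)\<bar>}"
  proof (rule finite_measure_mono, safe)
    fix \<omega> assume "\<delta> < \<bar>A t \<omega> / I t - 1\<bar>"
    also have "\<bar>A t \<omega> / I t - 1\<bar> = \<bar>A t \<omega> - I t\<bar> / I t"
    proof -
      have "A t \<omega> / I t - 1 = (A t \<omega> - I t) / I t" using I by (simp add: diff_divide_distrib)
      then show ?thesis using I by simp
    qed
    finally show "\<delta> * I t \<le> \<bar>A t \<omega> - expectation (A t)\<bar>" using I by (simp add: e1 pos_less_divide_eq)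
  qed measurable
  also have "\<dots> \<le> variance (A t) / (\<delta> * I t)\<^sup>2"
    using i2 \<delta> I by (intro Chebyshev_inequality) auto
  also have "\<dots> \<le> (4 * C * I t) / (\<delta> * I t)\<^sup>2"
    using \<open>variance (A t) \<le> 4 * C * I t\<close> by (intro divide_right_mono) auto
  also have "\<dots> = 4 * C / (\<delta>\<^sup>2 * I t)" using I by (simp add: power2_eq_square field_simps)
  finally show ?thesis .
qed

end

section \<open>Convergence in distribution\<close>

lemma eventually_up_to:
  assumes "0 < T"
  shows "eventually P (up_to T) \<longleftrightarrow> (\<exists>t\<^sub>1\<in>time_dom T. \<forall>t\<in>time_dom T. t\<^sub>1 < t \<longrightarrow> P t)"
proof -
  have *: "eventually P (up_to T) \<longleftrightarrow> (\<exists>c<T. \<forall>y>c. y < T \<longrightarrow> P (real_of_ereal y))"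
    unfolding up_to_def eventually_filtermap by (rule eventually_at_left[OF assms])
  show ?thesis unfolding *
  proof
    assume "\<exists>c<T. \<forall>y>c. y < T \<longrightarrow> P (real_of_ereal y)"
    then obtain c where c: "c < T" "\<And>y. c < y \<Longrightarrow> y < T \<Longrightarrow> P (real_of_ereal y)" by blast
    have "max 0 c < T" "0 \<le> max 0 c" using c assms by auto
    then obtain r where r: "max 0 c = ereal r" by (cases "max 0 c") auto
    show "\<exists>t\<^sub>1\<in>time_dom T. \<forall>t\<in>time_dom T. t\<^sub>1 < t \<longrightarrow> P t"
    proof (intro bexI ballI impI)
      show "r \<in> time_dom T" using \<open>max 0 c < T\<close> \<open>0 \<le> max 0 c\<close> unfolding r by (simp add: time_dom_def)
      fix t assume "t \<in> time_dom T" "r < t"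
      then have "max 0 c < ereal t" "ereal t < T" unfolding r by (auto simp: time_dom_def)
      then show "P t" using c(2)[of "ereal t"] by simp
    qed
  next
    assume "\<exists>t\<^sub>1\<in>time_dom T. \<forall>t\<in>time_dom T. t\<^sub>1 < t \<longrightarrow> P t"
    then obtain t1 where t1: "t1 \<in> time_dom T" "\<And>t. t \<in> time_dom T \<Longrightarrow> t1 < t \<Longrightarrow> P t" by blast
    show "\<exists>c<T. \<forall>y>c. y < T \<longrightarrow> P (real_of_ereal y)"
    proof (intro exI[of _ "ereal t1"] conjI allI impI)
      show "ereal t1 < T" using t1 by (simp add: time_dom_def)
      fix y assume y: "ereal t1 < y" "y < T"
      then obtain t where t: "y = ereal t" by (cases y) auto
      show "P (real_of_ereal y)" using y t1 by (auto simp: t time_dom_def)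
    qed
  qed
qed

lemma eventually_up_to_time_dom: "0 < T \<Longrightarrow> \<forall>\<^sub>F t in up_to T. t \<in> time_dom T"
  by (subst eventually_up_to) (auto intro!: bexI[of _ 0] simp: time_dom_def simp flip: zero_ereal_def)

text \<open>
  \<open>up_to T\<close> is the image of a left neighbourhood filter in a first countable space.
\<close>
lemma tendsto_up_to_sequentially:
  fixes f :: "real \<Rightarrow> 'b::topological_space"
  assumes "\<And>s. filterlim s (up_to T) sequentially \<Longrightarrow> (\<lambda>n. f (s n)) \<longlonglongrightarrow> l"
  shows "(f \<longlongrightarrow> l) (up_to T)"
proof -
  have "((\<lambda>y. f (real_of_ereal y)) \<longlongrightarrow> l) (at_left T)"
    unfolding tendsto_at_iff_sequentially
  proof (intro allI impI)
    fix y :: "nat \<Rightarrow> ereal" assume y: "\<forall>i. y i \<in> {..<T} - {T}" "y \<longlonglongrightarrow> T"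
    then have "\<forall>i. y i \<noteq> T" by auto
    with y have "filterlim y (at_left T) sequentially" by (auto simp: filterlim_at)
    then have "filterlim (\<lambda>n. real_of_ereal (y n)) (up_to T) sequentially"
      unfolding up_to_def by (rule filterlim_compose[rotated]) (simp add: filterlim_def)
    from assms[OF this] show "((\<lambda>y. f (real_of_ereal y)) \<circ> y) \<longlonglongrightarrow> l" by (simp add: comp_def)
  qed
  then show ?thesis by (simp add: up_to_def filterlim_filtermap)
qed

lemma isCont_cdf_std_normal: "isCont (cdf std_normal_distribution) x"
proof -
  interpret N: real_distribution std_normal_distribution by (rule real_dist_normal_dist)
  have "AE y in lborel. y \<noteq> x" by (rule AE_lborel_singleton)
  then have "emeasure std_normal_distribution {x} = 0"
    by (subst emeasure_density) (auto intro!: nn_integral_zero' elim!: eventually_mono)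
  then show ?thesis by (simp add: N.isCont_cdf measure_def)
qed

context prob_space
begin

lemma cdf_distr_eq:
  assumes [measurable]: "Z \<in> borel_measurable M"
  shows "cdf (distr M borel Z) x = prob {\<omega>\<in>space M. Z \<omega> \<le> x}"
  by (auto simp: cdf_def measure_distr intro!: arg_cong[where f=prob])

text \<open>
  Levy's continuity theorem is about sequences, so it is applied along each sequence of times that
  tends to \<open>T\<close>. The variables are replaced by \<open>0\<close> at the finitely many indices at which measurability
  may fail.
\<close>
lemma up_to_levy_continuity:
  assumes m: "\<forall>\<^sub>F t in up_to T. Z t \<in> borel_measurable M"
    and char: "\<And>\<theta>. ((\<lambda>t. CLINT \<omega>|M. iexp (\<theta> * Z t \<omega>)) \<longlongrightarrow> of_real (exp (- \<theta>\<^sup>2 / 2))) (up_to T)"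
  shows "((\<lambda>t. cdf (distr M borel (Z t)) x) \<longlongrightarrow> cdf std_normal_distribution x) (up_to T)"
proof (rule tendsto_up_to_sequentially)
  fix s assume s: "filterlim s (up_to T) sequentially"
  define Z' where "Z' n = (if Z (s n) \<in> borel_measurable M then Z (s n) else (\<lambda>_. 0))" for n
  have [measurable]: "Z' n \<in> borel_measurable M" for n by (simp add: Z'_def)
  have ev: "\<forall>\<^sub>F n in sequentially. Z' n = Z (s n)"
    using filterlim_iff[THEN iffD1, OF s, rule_format, OF m] by eventually_elim (simp add: Z'_def)
  have "weak_conv_m (\<lambda>n. distr M borel (Z' n)) std_normal_distribution"
  proof (rule levy_continuity)
    show "real_distribution (distr M borel (Z' n))" for n by (rule real_distribution_distr) simp
    fix \<theta>
    have "(\<lambda>n. CLINT \<omega>|M. iexp (\<theta> * Z (s n) \<omega>)) \<longlonglongrightarrow> of_real (exp (- \<theta>\<^sup>2 / 2))"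
      using filterlim_compose[OF char s] .
    then have "(\<lambda>n. CLINT \<omega>|M. iexp (\<theta> * Z' n \<omega>)) \<longlonglongrightarrow> of_real (exp (- \<theta>\<^sup>2 / 2))"
      by (rule Lim_transform_eventually) (use ev in eventually_elim, simp)
    then show "(\<lambda>n. char (distr M borel (Z' n)) \<theta>) \<longlonglongrightarrow> char std_normal_distribution \<theta>"
      by (simp add: char_def[of "distr M borel (Z' n)" for n] integral_distr char_std_normal_distribution)
  qed (rule real_dist_normal_dist)
  then have "(\<lambda>n. cdf (distr M borel (Z' n)) x) \<longlonglongrightarrow> cdf std_normal_distribution x"
    using isCont_cdf_std_normal by (auto simp: weak_conv_m_def weak_conv_def)
  then show "(\<lambda>n. cdf (distr M borel (Z (s n))) x) \<longlonglongrightarrow> cdf std_normal_distribution x"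
    by (rule Lim_transform_eventually) (use ev in eventually_elim, simp)
qed

text \<open>
  Where \<open>\<bar>R t - 1\<bar> \<le> \<eta> < 1\<close>, the event that the quotient is at most \<open>x\<close> lies between the events that
  \<open>U t\<close> is at most \<open>x - \<bar>x\<bar> \<eta>\<close> and at most \<open>x + \<bar>x\<bar> \<eta>\<close>.
\<close>
lemma slutsky_divide_sqrt:
  fixes U R :: "'i \<Rightarrow> 'a \<Rightarrow> real"
  assumes m: "\<forall>\<^sub>F t in G. U t \<in> borel_measurable M \<and> R t \<in> borel_measurable M"
    and U: "\<And>x. ((\<lambda>t. cdf (distr M borel (U t)) x) \<longlongrightarrow> \<Phi> x) G"
    and R: "\<And>\<delta>. 0 < \<delta> \<Longrightarrow> ((\<lambda>t. prob {\<omega>\<in>space M. \<delta> < \<bar>R t \<omega> - 1\<bar>}) \<longlongrightarrow> 0) G"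
    and \<Phi>: "isCont \<Phi> x"
  shows "((\<lambda>t. cdf (distr M borel (\<lambda>\<omega>. U t \<omega> / sqrt (R t \<omega>))) x) \<longlongrightarrow> \<Phi> x) G"
proof (rule tendstoI)
  fix e :: real assume e: "0 < e"
  have "((\<lambda>\<eta>. \<Phi> (x + \<bar>x\<bar> * \<eta>)) \<longlongrightarrow> \<Phi> x) (at_right 0)" "((\<lambda>\<eta>. \<Phi> (x - \<bar>x\<bar> * \<eta>)) \<longlongrightarrow> \<Phi> x) (at_right 0)"
    by (rule isCont_tendsto_compose[OF \<Phi>], auto intro!: tendsto_eq_intros)+
  then have "\<forall>\<^sub>F \<eta> in at_right 0. dist (\<Phi> (x + \<bar>x\<bar> * \<eta>)) (\<Phi> x) < e / 3" "\<forall>\<^sub>F \<eta> in at_right 0. dist (\<Phi> (x - \<bar>x\<bar> * \<eta>)) (\<Phi> x) < e / 3"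
    using e by (auto dest: tendstoD[where e="e/3"])
  moreover have "\<forall>\<^sub>F \<eta> in at_right (0::real). 0 < \<eta> \<and> \<eta> < 1"
    by (auto simp: eventually_at_right[of 0 1] intro: exI[of _ 1])
  ultimately have "\<forall>\<^sub>F \<eta> in at_right 0. dist (\<Phi> (x + \<bar>x\<bar> * \<eta>)) (\<Phi> x) < e / 3 \<and> dist (\<Phi> (x - \<bar>x\<bar> * \<eta>)) (\<Phi> x) < e / 3 \<and> 0 < \<eta> \<and> \<eta> < 1"
    by eventually_elim auto
  then obtain \<eta> where \<eta>: "dist (\<Phi> (x + \<bar>x\<bar> * \<eta>)) (\<Phi> x) < e / 3" "dist (\<Phi> (x - \<bar>x\<bar> * \<eta>)) (\<Phi> x) < e / 3" "0 < \<eta>" "\<eta> < 1"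
    by (auto dest: eventually_happens)
  have e3: "0 < e / 3" using e by simp
  from m tendstoD[OF U[of "x + \<bar>x\<bar> * \<eta>"] e3] tendstoD[OF U[of "x - \<bar>x\<bar> * \<eta>"] e3] tendstoD[OF R[OF \<eta>(3)] e3]
  show "\<forall>\<^sub>F t in G. dist (cdf (distr M borel (\<lambda>\<omega>. U t \<omega> / sqrt (R t \<omega>))) x) (\<Phi> x) < e"
  proof eventually_elim
    case (elim t)
    have [measurable]: "U t \<in> borel_measurable M" "R t \<in> borel_measurable M" using elim by auto
    define Bad where "Bad = {\<omega>\<in>space M. \<eta> < \<bar>R t \<omega> - 1\<bar>}"
    have [measurable]: "Bad \<in> sets M" unfolding Bad_def by measurable
    define P where "P = prob {\<omega>\<in>space M. U t \<omega> / sqrt (R t \<omega>) \<le> x}"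
    have good: "0 < R t \<omega>" "\<bar>x * sqrt (R t \<omega>) - x\<bar> \<le> \<bar>x\<bar> * \<eta>" if "\<omega> \<in> space M" "\<omega> \<notin> Bad" for \<omega>
    proof -
      have r: "\<bar>R t \<omega> - 1\<bar> \<le> \<eta>" using that by (auto simp: Bad_def)
      then show pos: "0 < R t \<omega>" using \<eta>(4) by linarith
      have "R t \<omega> - 1 = (sqrt (R t \<omega>) - 1) * (sqrt (R t \<omega>) + 1)"
        using pos by (simp add: algebra_simps)
      then have "\<bar>sqrt (R t \<omega>) - 1\<bar> * 1 \<le> \<bar>R t \<omega> - 1\<bar>"
        using pos by (simp only: abs_mult) (intro mult_left_mono, auto)
      then have "\<bar>x\<bar> * \<bar>sqrt (R t \<omega>) - 1\<bar> \<le> \<bar>x\<bar> * \<eta>" using r by (intro mult_left_mono) auto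
      then show "\<bar>x * sqrt (R t \<omega>) - x\<bar> \<le> \<bar>x\<bar> * \<eta>"
        unfolding abs_mult[symmetric] by (simp add: algebra_simps)
    qed
    have "P \<le> prob ({\<omega>\<in>space M. U t \<omega> \<le> x + \<bar>x\<bar> * \<eta>} \<union> Bad)"
      unfolding P_def
    proof (rule finite_measure_mono, safe)
      fix \<omega> assume *: "\<omega> \<in> space M" "U t \<omega> / sqrt (R t \<omega>) \<le> x" "\<omega> \<notin> Bad"
      then have "U t \<omega> \<le> x * sqrt (R t \<omega>)" using good(1) by (simp add: pos_divide_le_eq)
      then show "U t \<omega> \<le> x + \<bar>x\<bar> * \<eta>" using good(2)[OF *(1,3)] by linarith
    qed measurable
    also have "\<dots> \<le> prob {\<omega>\<in>space M. U t \<omega> \<le> x + \<bar>x\<bar> * \<eta>} + prob Bad" by (rule measure_Un_le) measurable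
    finally have up: "P \<le> cdf (distr M borel (U t)) (x + \<bar>x\<bar> * \<eta>) + prob Bad" by (simp add: cdf_distr_eq)
    have "prob {\<omega>\<in>space M. U t \<omega> \<le> x - \<bar>x\<bar> * \<eta>} \<le> prob ({\<omega>\<in>space M. U t \<omega> / sqrt (R t \<omega>) \<le> x} \<union> Bad)"
    proof (rule finite_measure_mono, safe)
      fix \<omega> assume *: "\<omega> \<in> space M" "U t \<omega> \<le> x - \<bar>x\<bar> * \<eta>" "\<omega> \<notin> Bad"
      then have "U t \<omega> \<le> x * sqrt (R t \<omega>)" using good(2)[OF *(1,3)] by linarith
      then show "U t \<omega> / sqrt (R t \<omega>) \<le> x" using good(1)[OF *(1,3)] by (simp add: pos_divide_le_eq)
    qed measurable
    also have "\<dots> \<le> P + prob Bad" unfolding P_def by (rule measure_Un_le) measurable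
    finally have low: "cdf (distr M borel (U t)) (x - \<bar>x\<bar> * \<eta>) \<le> P + prob Bad" by (simp add: cdf_distr_eq)
    have "cdf (distr M borel (\<lambda>\<omega>. U t \<omega> / sqrt (R t \<omega>))) x = P" unfolding P_def by (rule cdf_distr_eq) measurable
    moreover have "prob Bad < e / 3" using elim unfolding Bad_def by simp
    ultimately show ?case using up low elim(2,3) \<eta>(1,2) unfolding dist_real_def by linarith
  qed
qed

end

text \<open>
  All simple integrals vanish at time \<open>0\<close>. The definition of the integral only makes the initial value
  zero almost surely.
\<close>
lemma (in wiener_process) ito_integral_0:
  assumes "is_ito_integral M T F B H I" and 0: "0 \<in> time_dom T"
  shows "AE \<omega> in M. I 0 \<omega> = 0"
proof -
  obtain n p \<xi> where H: "\<And>k. simple_integrand M T F (n k) (p k) (\<xi> k)"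
    and S: "tendsto_in_prob M (\<lambda>k. simple_ito_integral B (n k) (p k) (\<xi> k) 0) (I 0)"
    using assms unfolding is_ito_integral_def by blast
  have [measurable]: "I 0 \<in> borel_measurable M"
    using assms measurable_F_M[OF 0] unfolding is_ito_integral_def adapted_def by blast
  have z: "simple_ito_integral B (n k) (p k) (\<xi> k) 0 \<omega> = 0" for k \<omega>
    unfolding simple_ito_integral_def
  proof (intro sum.neutral ballI)
    fix i assume "i \<in> {..<n k}"
    then have "0 \<le> p k i" "0 \<le> p k (Suc i)" using H[of k] by (auto simp: simple_integrand_def time_dom_def)
    then show "\<xi> k i \<omega> * (B (min 0 (p k (Suc i))) \<omega> - B (min 0 (p k i)) \<omega>) = 0" by (simp add: min_def)
  qed
  have "AE \<omega> in M. \<bar>I 0 \<omega>\<bar> \<le> 1 / real (Suc m)" for m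
  proof -
    have "(\<lambda>k::nat. prob {\<omega>\<in>space M. 1 / real (Suc m) < \<bar>I 0 \<omega>\<bar>}) \<longlonglongrightarrow> 0"
      using tendsto_in_probD[OF S, of "1 / real (Suc m)"] by (simp add: z)
    then have "prob {\<omega>\<in>space M. 1 / real (Suc m) < \<bar>I 0 \<omega>\<bar>} = 0" using LIMSEQ_unique tendsto_const by blast
    then have "AE \<omega> in M. \<not> (1 / real (Suc m) < \<bar>I 0 \<omega>\<bar>)"
      by (subst AE_iff_measurable[of "{\<omega>\<in>space M. 1 / real (Suc m) < \<bar>I 0 \<omega>\<bar>}"]) (auto simp: emeasure_eq_measure)
    then show ?thesis by eventually_elim simp
  qed
  then have "AE \<omega> in M. \<forall>m. \<bar>I 0 \<omega>\<bar> \<le> 1 / real (Suc m)" by (simp add: AE_all_countable)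
  then show ?thesis
  proof eventually_elim
    case (elim \<omega>)
    show ?case
    proof (rule ccontr)
      assume "I 0 \<omega> \<noteq> 0"
      then obtain m where "inverse (real (Suc m)) < \<bar>I 0 \<omega>\<bar>" using reals_Archimedean[of "\<bar>I 0 \<omega>\<bar>"] by auto
      with elim show False by (auto simp: inverse_eq_divide not_le[symmetric])
    qed
  qed
qed

context mle_diffusion
begin

text \<open>The martingale part of the score \<open>J\<close>.\<close>
definition N :: "real \<Rightarrow> 'a \<Rightarrow> real" where "N t \<omega> = J t \<omega> - \<alpha> * A t \<omega>"

lemma N_ito: "is_ito_integral M T F B (\<lambda>s \<omega>. b s * X s \<omega> / (\<sigma> s)\<^sup>2 * \<sigma> s) N"
proof -
  have "(LBINT s:{0..t}. b s * X s \<omega> / (\<sigma> s)\<^sup>2 * (\<alpha> * b s * X s \<omega>)) = \<alpha> * A t \<omega>" for t \<omega>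
  proof -
    have "b s * X s \<omega> / (\<sigma> s)\<^sup>2 * (\<alpha> * b s * X s \<omega>) = \<alpha> * ((b s)\<^sup>2 * (X s \<omega>)\<^sup>2 / (\<sigma> s)\<^sup>2)" for s
      by (simp add: power2_eq_square)
    note eq = this
    show ?thesis unfolding eq A_def by (rule set_integral_mult_right)
  qed
  then have "N = (\<lambda>t \<omega>. J t \<omega> - (LBINT s:{0..t}. b s * X s \<omega> / (\<sigma> s)\<^sup>2 * (\<alpha> * b s * X s \<omega>)))"
    by (simp add: N_def fun_eq_iff)
  then show ?thesis using J unfolding is_integral_against_ito_process_def by simp
qed

lemma N_bracket:
  assumes t: "t \<in> time_dom T"
  shows "(LBINT u:{0..t}. (b u * X u \<omega> / (\<sigma> u)\<^sup>2 * \<sigma> u)\<^sup>2) = A t \<omega>"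
  unfolding A_def
proof (rule set_lebesgue_integral_cong)
  show "\<forall>u. u \<in> {0..t} \<longrightarrow> (b u * X u \<omega> / (\<sigma> u)\<^sup>2 * \<sigma> u)\<^sup>2 = (b u)\<^sup>2 * (X u \<omega>)\<^sup>2 / (\<sigma> u)\<^sup>2"
  proof (intro allI impI)
    fix u assume "u \<in> {0..t}"
    then have "0 < \<sigma> u" using \<sigma>_pos Icc_time_dom[OF t] by blast
    then show "(b u * X u \<omega> / (\<sigma> u)\<^sup>2 * \<sigma> u)\<^sup>2 = (b u)\<^sup>2 * (X u \<omega>)\<^sup>2 / (\<sigma> u)\<^sup>2"
      by (simp add: power_mult_distrib power_divide power2_eq_square)
  qed
qed simp

lemma N_measurable: "t \<in> time_dom T \<Longrightarrow> N t \<in> borel_measurable M"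
  using N_ito measurable_F_M unfolding is_ito_integral_def adapted_def by blast

text \<open>
  This holds everywhere: where \<open>A t \<omega> = 0\<close> both sides are \<open>0\<close>, whatever value the estimator takes.
\<close>
lemma normalized_error_eq: "sqrt (A t \<omega>) * (mle b \<sigma> X J t \<omega> - \<alpha>) = N t \<omega> / sqrt (A t \<omega>)"
proof (cases "A t \<omega> = 0")
  case False
  then have pos: "0 < A t \<omega>" using A_nonneg[of t \<omega>] by simp
  have "mle b \<sigma> X J t \<omega> = J t \<omega> / A t \<omega>" using pos unfolding A_def by (rule mle_eq)
  then have "mle b \<sigma> X J t \<omega> - \<alpha> = N t \<omega> / sqrt (A t \<omega>) / sqrt (A t \<omega>)"
    using pos by (simp add: N_def diff_divide_distrib)
  moreover have "sqrt (A t \<omega>) * (y / sqrt (A t \<omega>)) = y" for y using pos by simp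
  ultimately show ?thesis by (simp only:)
qed simp

lemma I_mono:
  assumes t: "t \<in> time_dom T" and u: "0 \<le> u" "u \<le> t"
  shows "I u \<le> I t"
proof -
  have c: "continuous_on {0..t} (\<lambda>u. wt u * G u)" using wt_cont[OF t] G_cont[OF t] by (intro continuous_intros)
  have ud: "u \<in> time_dom T" using u Icc_time_dom[OF t] by auto
  have "0 \<le> integral {u..t} (\<lambda>u. wt u * G u)"
  proof (intro integral_nonneg LBINT_continuous continuous_on_subset[OF c])
    fix v assume "v \<in> {u..t}"
    then have "v \<in> time_dom T" using u Icc_time_dom[OF t] by (auto simp: subset_eq)
    then show "0 \<le> wt v * G v" using wt_nonneg G_nonneg by simp
  qed (use u in auto)
  also have "\<dots> = I t - I u"
    unfolding integral_increment[OF c u order_refl, symmetric] I_eq[OF t] I_eq[OF ud]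
    using u by (simp add: LBINT_continuous(2)[OF c] LBINT_continuous(2)[OF continuous_on_subset[OF c]])
  finally show ?thesis by simp
qed

lemma explicit_variance:
  assumes t: "t \<in> time_dom T"
  shows "(LBINT s:{0..t}. (\<sigma> s)\<^sup>2 * exp (2 * \<alpha> * (LBINT v:{s..t}. b v))) = G t / (E t)\<^sup>2"
proof -
  have "(LBINT s:{0..t}. (\<sigma> s)\<^sup>2 * exp (2 * \<alpha> * (LBINT v:{s..t}. b v))) = (LBINT s:{0..t}. (1 / (E t)\<^sup>2) * ((E s)\<^sup>2 * (\<sigma> s)\<^sup>2))"
  proof (rule set_lebesgue_integral_cong)
    show "\<forall>s. s \<in> {0..t} \<longrightarrow> (\<sigma> s)\<^sup>2 * exp (2 * \<alpha> * (LBINT v:{s..t}. b v)) = (1 / (E t)\<^sup>2) * ((E s)\<^sup>2 * (\<sigma> s)\<^sup>2)"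
    proof (intro allI impI)
      fix s assume s: "s \<in> {0..t}"
      have c: "continuous_on {0..t} b" by (rule b_cont[OF t])
      have L: "(LBINT v:{s..t}. b v) = (LBINT v:{0..t}. b v) - (LBINT v:{0..s}. b v)"
        using integral_increment[OF c, of s t] s
        by (simp add: LBINT_continuous(2)[OF c] LBINT_continuous(2)[OF continuous_on_subset[OF c]])
      have "exp (2 * \<alpha> * (LBINT v:{s..t}. b v)) = (E s)\<^sup>2 / (E t)\<^sup>2"
        unfolding L E_def power2_eq_square exp_add[symmetric] exp_diff[symmetric] by (simp add: algebra_simps)
      then show "(\<sigma> s)\<^sup>2 * exp (2 * \<alpha> * (LBINT v:{s..t}. b v)) = (1 / (E t)\<^sup>2) * ((E s)\<^sup>2 * (\<sigma> s)\<^sup>2)" by simp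
    qed
  qed simp
  then show ?thesis by (simp add: G_def)
qed

context
  assumes I_lim: "filterlim I at_top (up_to T)"
    and c_lim: "((\<lambda>t. 1 / sqrt (I t) * (b t / (\<sigma> t)\<^sup>2) *
            (LBINT s:{0..t}. (\<sigma> s)\<^sup>2 * exp (2 * \<alpha> * (LBINT v:{s..t}. b v)))) \<longlongrightarrow> 0) (up_to T)"
begin

text \<open>
  The expression in \<open>c_lim\<close> is \<open>\<kappa> t / sqrt (I t)\<close>, and \<open>wt (G)\<^sup>2\<close> is \<open>\<kappa>\<^sup>2\<close> times the density of
  \<open>G\<close>. So \<open>information_Chebyshev\<close> is available with \<open>C = K + \<epsilon> I t\<close>: past some time \<open>t1\<close> the assumption and
  the monotonicity of \<open>I\<close> give \<open>\<kappa>\<^sup>2 \<le> \<epsilon> I t\<close>, and before it \<open>\<kappa>\<close> is bounded by compactness.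
\<close>
lemma information_ratio_tendsto:
  assumes \<delta>: "0 < \<delta>"
  shows "((\<lambda>t. prob {\<omega>\<in>space M. \<delta> < \<bar>A t \<omega> / I t - 1\<bar>}) \<longlongrightarrow> 0) (up_to T)"
proof (rule tendstoI)
  fix r :: real assume r: "0 < r"
  (* In the Chebyshev bound this part of C contributes r / 2. *)
  define \<epsilon> where "\<epsilon> = r * \<delta>\<^sup>2 / 8"
  have \<epsilon>: "0 < \<epsilon>" using r \<delta> by (simp add: \<epsilon>_def)
  define \<kappa> where "\<kappa> u = b u / (\<sigma> u)\<^sup>2 * (G u / (E u)\<^sup>2)" for u
  have \<kappa>eq: "wt u * (G u)\<^sup>2 = (\<kappa> u)\<^sup>2 * ((E u)\<^sup>2 * (\<sigma> u)\<^sup>2)" if "u \<in> time_dom T" for u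
    using E_pos[of u] \<sigma>_pos[OF that] by (simp add: \<kappa>_def wt_def power_mult_distrib power_divide power2_eq_square field_simps)
  have "\<forall>\<^sub>F t in up_to T. \<bar>1 / sqrt (I t) * \<kappa> t\<bar> < sqrt \<epsilon> \<and> 0 < I t"
  proof -
    have "\<forall>\<^sub>F t in up_to T. dist (1 / sqrt (I t) * (b t / (\<sigma> t)\<^sup>2) * (LBINT s:{0..t}. (\<sigma> s)\<^sup>2 * exp (2 * \<alpha> * (LBINT v:{s..t}. b v)))) 0 < sqrt \<epsilon>"
      using tendstoD[OF c_lim, of "sqrt \<epsilon>"] \<epsilon> by simp
    moreover have "\<forall>\<^sub>F t in up_to T. 0 < I t" using I_lim by (auto simp: filterlim_at_top_dense)
    ultimately show ?thesis using eventually_up_to_time_dom[OF T_pos]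
      by eventually_elim (simp add: explicit_variance \<kappa>_def)
  qed
  then obtain t1 where t1: "t1 \<in> time_dom T" "\<And>t. t \<in> time_dom T \<Longrightarrow> t1 < t \<Longrightarrow> \<bar>1 / sqrt (I t) * \<kappa> t\<bar> < sqrt \<epsilon> \<and> 0 < I t"
    unfolding eventually_up_to[OF T_pos] by blast
  have "continuous_on {0..t1} \<kappa>"
    unfolding \<kappa>_def using b_cont[OF t1(1)] \<sigma>_cont[OF t1(1)] G_cont[OF t1(1)] E_cont[OF t1(1)] E_pos \<sigma>_pos Icc_time_dom[OF t1(1)]
    by (intro continuous_intros) (fastforce simp: less_imp_neq[symmetric] subset_eq)+
  then obtain K0 where K0: "0 < K0" "\<And>u. u \<in> {0..t1} \<Longrightarrow> \<bar>\<kappa> u\<bar> \<le> K0" using continuous_bounded_Icc by blast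
  define K where "K = K0\<^sup>2"
  have "\<forall>\<^sub>F t in up_to T. 8 * K / (\<delta>\<^sup>2 * r) < I t" using I_lim by (auto simp: filterlim_at_top_dense)
  moreover have "\<forall>\<^sub>F t in up_to T. t1 < t" unfolding eventually_up_to[OF T_pos] using t1(1) by blast
  ultimately show "\<forall>\<^sub>F t in up_to T. dist (prob {\<omega>\<in>space M. \<delta> < \<bar>A t \<omega> / I t - 1\<bar>}) 0 < r"
    using eventually_up_to_time_dom[OF T_pos]
  proof eventually_elim
    case (elim t)
    have It: "0 < I t" using t1(2) elim by blast
    define C where "C = K + \<epsilon> * I t"
    have C: "0 \<le> C" using It \<epsilon> by (simp add: C_def K_def)
    have bound: "wt u * (G u)\<^sup>2 \<le> C * ((E u)\<^sup>2 * (\<sigma> u)\<^sup>2)" if u: "u \<in> {0..t}" for u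
    proof -
      have ud: "u \<in> time_dom T" using Icc_time_dom[OF elim(3)] u by blast
      have "(\<kappa> u)\<^sup>2 \<le> C"
      proof (cases "u \<le> t1")
        case True
        then have "\<bar>\<kappa> u\<bar>\<^sup>2 \<le> K0\<^sup>2" using K0(2)[of u] u by (intro power_mono) auto
        then show ?thesis using \<epsilon> It by (simp add: C_def K_def add_increasing2)
      next
        case False
        then have *: "\<bar>1 / sqrt (I u) * \<kappa> u\<bar> < sqrt \<epsilon>" "0 < I u" using t1(2)[OF ud] by auto
        have "\<bar>\<kappa> u\<bar> \<le> sqrt \<epsilon> * sqrt (I u)"
          using * by (simp add: abs_mult pos_divide_less_eq)
        then have "\<bar>\<kappa> u\<bar>\<^sup>2 \<le> (sqrt \<epsilon> * sqrt (I u))\<^sup>2" by (intro power_mono) auto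
        also have "\<dots> = \<epsilon> * I u" using * \<epsilon> by (simp add: power_mult_distrib)
        also have "\<dots> \<le> \<epsilon> * I t" using I_mono[OF elim(3)] u \<epsilon> by simp
        finally show ?thesis using K0 by (simp add: C_def K_def add_increasing)
      qed
      then show ?thesis unfolding \<kappa>eq[OF ud] by (intro mult_right_mono) auto
    qed
    have "prob {\<omega>\<in>space M. \<delta> < \<bar>A t \<omega> / I t - 1\<bar>} \<le> 4 * C / (\<delta>\<^sup>2 * I t)"
      by (rule information_Chebyshev[OF elim(3) C \<delta> It bound])
    also have "\<dots> = 4 * K / (\<delta>\<^sup>2 * I t) + r / 2"
      using It \<delta> by (simp add: C_def \<epsilon>_def field_simps)
    also have "4 * K / (\<delta>\<^sup>2 * I t) < r / 2"
      using elim(1) It \<delta> r by (simp add: field_simps)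
    finally show ?case by simp
  qed
qed

text \<open>
  \<open>ito_integral_char_bound\<close> for \<open>N\<close> with frequency \<open>\<theta> / sqrt (I t)\<close> and \<open>a = \<theta>\<^sup>2\<close>: the bracket condition becomes
  a condition on \<open>A t / I t\<close>.
\<close>
lemma normalized_martingale_char:
  "((\<lambda>t. CLINT \<omega>|M. iexp (\<theta> * (N t \<omega> / sqrt (I t)))) \<longlongrightarrow> of_real (exp (- \<theta>\<^sup>2 / 2))) (up_to T)"
proof (rule tendstoI)
  fix e :: real assume e: "0 < e"
  have "((\<lambda>\<delta>. exp (\<delta> / 2) - 1) \<longlongrightarrow> exp (0 / 2) - 1) (at_right (0::real))"
    by (auto intro!: tendsto_eq_intros)
  then have "\<forall>\<^sub>F \<delta> in at_right (0::real). dist (exp (\<delta> / 2) - 1) (exp (0 / 2) - 1) < e / 2"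
    using e by (intro tendstoD) auto
  then have "\<forall>\<^sub>F \<delta> in at_right (0::real). 0 < \<delta> \<and> exp (\<delta> / 2) - 1 < e / 2"
    using eventually_at_right_less[of "0::real"] by eventually_elim (simp add: dist_real_def)
  then obtain \<delta> :: real where \<delta>: "0 < \<delta>" "exp (\<delta> / 2) - 1 < e / 2" by (auto dest: eventually_happens)
  define \<delta>' where "\<delta>' = \<delta> / 2 / (\<theta>\<^sup>2 + 1)"
  have \<delta>': "0 < \<delta>'" "\<theta>\<^sup>2 * \<delta>' \<le> \<delta> / 2"
    using \<delta>(1) by (auto simp: \<delta>'_def field_simps add_pos_nonneg intro!: divide_pos_pos)
  have "((\<lambda>t. (1 + exp (\<delta> / 2)) * prob {\<omega>\<in>space M. \<delta>' < \<bar>A t \<omega> / I t - 1\<bar>}) \<longlongrightarrow> (1 + exp (\<delta> / 2)) * 0) (up_to T)"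
    by (intro tendsto_intros information_ratio_tendsto \<delta>')
  then have "\<forall>\<^sub>F t in up_to T. dist ((1 + exp (\<delta> / 2)) * prob {\<omega>\<in>space M. \<delta>' < \<bar>A t \<omega> / I t - 1\<bar>}) 0 < e / 2"
    using e by (intro tendstoD) auto
  moreover have "\<forall>\<^sub>F t in up_to T. 0 < I t" using I_lim by (auto simp: filterlim_at_top_dense)
  ultimately show "\<forall>\<^sub>F t in up_to T. dist (CLINT \<omega>|M. iexp (\<theta> * (N t \<omega> / sqrt (I t)))) (of_real (exp (- \<theta>\<^sup>2 / 2))) < e"
    using eventually_up_to_time_dom[OF T_pos]
  proof eventually_elim
    case (elim t)
    have t0: "0 \<in> time_dom T" "0 \<le> t" using elim(3) time_dom_0 by (auto simp: time_dom_def)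
    note [measurable] = N_measurable[OF elim(3)] N_measurable[OF t0(1)] A_measurable[OF elim(3)]
    have "(CLINT \<omega>|M. iexp (\<theta> * (N t \<omega> / sqrt (I t)))) = (CLINT \<omega>|M. 1 * iexp (\<theta> / sqrt (I t) * (N t \<omega> - N 0 \<omega>)))"
      using ito_integral_0[OF N_ito t0(1)] by (intro integral_cong_AE) (auto elim!: eventually_mono)
    then have "dist (CLINT \<omega>|M. iexp (\<theta> * (N t \<omega> / sqrt (I t)))) (of_real (exp (- \<theta>\<^sup>2 / 2))) =
      norm ((CLINT \<omega>|M. 1 * iexp (\<theta> / sqrt (I t) * (N t \<omega> - N 0 \<omega>))) - of_real (exp (- \<theta>\<^sup>2 / 2)) * (CLINT \<omega>|M. 1))"
      by (simp add: dist_norm prob_space)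
    also have "\<dots> \<le> (exp (\<delta> / 2) - 1) + (1 + exp (\<delta> / 2)) *
      prob {\<omega>\<in>space M. \<delta> / 2 < \<bar>(\<theta> / sqrt (I t))\<^sup>2 * (LBINT u:{0..t}. (b u * X u \<omega> / (\<sigma> u)\<^sup>2 * \<sigma> u)\<^sup>2) - \<theta>\<^sup>2\<bar>}"
      by (rule ito_integral_char_bound[OF N_ito t0(1) elim(3) t0(2)]) (use \<delta> in auto)
    also have "\<dots> \<le> (exp (\<delta> / 2) - 1) + (1 + exp (\<delta> / 2)) * prob {\<omega>\<in>space M. \<delta>' < \<bar>A t \<omega> / I t - 1\<bar>}"
    proof (intro add_left_mono mult_left_mono finite_measure_mono subsetI)
      fix \<omega> assume "\<omega> \<in> {\<omega>\<in>space M. \<delta> / 2 < \<bar>(\<theta> / sqrt (I t))\<^sup>2 * (LBINT u:{0..t}. (b u * X u \<omega> / (\<sigma> u)\<^sup>2 * \<sigma> u)\<^sup>2) - \<theta>\<^sup>2\<bar>}"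
      then have \<omega>: "\<omega> \<in> space M" "\<delta> / 2 < \<bar>(\<theta> / sqrt (I t))\<^sup>2 * A t \<omega> - \<theta>\<^sup>2\<bar>"
        unfolding N_bracket[OF elim(3)] by simp_all
      have "(\<theta> / sqrt (I t))\<^sup>2 * A t \<omega> - \<theta>\<^sup>2 = \<theta>\<^sup>2 * (A t \<omega> / I t - 1)"
        using elim(2) by (simp add: power_divide right_diff_distrib)
      then have "\<theta>\<^sup>2 * \<delta>' < \<theta>\<^sup>2 * \<bar>A t \<omega> / I t - 1\<bar>" using \<omega>(2) \<delta>'(2) by (simp add: abs_mult)
      then have "\<delta>' < \<bar>A t \<omega> / I t - 1\<bar>" by (rule mult_left_less_imp_less) simp
      then show "\<omega> \<in> {\<omega>\<in>space M. \<delta>' < \<bar>A t \<omega> / I t - 1\<bar>}"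
        using \<omega>(1) by blast
    qed (auto intro: add_nonneg_nonneg)
    also have "\<dots> < e" using \<delta>(2) elim(1) by (auto simp: dist_real_def)
    finally show ?case .
  qed
qed

theorem normalized_error_converges:
  "converges_in_distribution M (\<lambda>t \<omega>. sqrt (A t \<omega>) * (mle b \<sigma> X J t \<omega> - \<alpha>)) std_normal_distribution (up_to T)"
  unfolding converges_in_distribution_def normalized_error_eq
proof (intro conjI allI impI)
  have ev: "\<forall>\<^sub>F t in up_to T. 0 < I t" using I_lim by (auto simp: filterlim_at_top_dense)
  note dom = eventually_up_to_time_dom[OF T_pos]
  show "\<forall>\<^sub>F t in up_to T. (\<lambda>\<omega>. N t \<omega> / sqrt (A t \<omega>)) \<in> borel_measurable M"
    using dom
  proof eventually_elim
    case (elim t)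
    note [measurable] = N_measurable[OF elim] A_measurable[OF elim]
    show ?case by measurable
  qed
  fix x
  have m: "\<forall>\<^sub>F t in up_to T. (\<lambda>\<omega>. N t \<omega> / sqrt (I t)) \<in> borel_measurable M \<and> (\<lambda>\<omega>. A t \<omega> / I t) \<in> borel_measurable M"
    using dom
  proof eventually_elim
    case (elim t)
    note [measurable] = N_measurable[OF elim] A_measurable[OF elim]
    show ?case by auto
  qed
  have "((\<lambda>t. cdf (distr M borel (\<lambda>\<omega>. (N t \<omega> / sqrt (I t)) / sqrt (A t \<omega> / I t))) x) \<longlongrightarrow> cdf std_normal_distribution x) (up_to T)"
  proof (rule slutsky_divide_sqrt[OF m _ information_ratio_tendsto isCont_cdf_std_normal])
    show "((\<lambda>t. cdf (distr M borel (\<lambda>\<omega>. N t \<omega> / sqrt (I t))) y) \<longlongrightarrow> cdf std_normal_distribution y) (up_to T)" for y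
      by (rule up_to_levy_continuity[OF _ normalized_martingale_char]) (use m in \<open>auto elim: eventually_mono\<close>)
  qed
  then show "((\<lambda>t. cdf (distr M borel (\<lambda>\<omega>. N t \<omega> / sqrt (A t \<omega>))) x) \<longlongrightarrow> cdf std_normal_distribution x) (up_to T)"
    by (rule Lim_transform_eventually) (use ev in eventually_elim, simp add: real_sqrt_divide)
qed

end
end

theorem corollary2p12:
  fixes M :: "'a measure" and T :: ereal and F :: "real \<Rightarrow> 'a measure"
    and B X J :: "real \<Rightarrow> 'a \<Rightarrow> real" and b \<sigma> :: "real \<Rightarrow> real" and \<alpha> t\<^sub>0 :: real
  assumes "0 < T"
    and "continuous_on (time_dom T) b"
    and "continuous_on (time_dom T) \<sigma>"
    and "\<And>t. t \<in> time_dom T \<Longrightarrow> \<sigma> t > 0"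
    and "0 < t\<^sub>0" and "ereal t\<^sub>0 < T"
    and "\<And>t. t\<^sub>0 \<le> t \<Longrightarrow> ereal t < T \<Longrightarrow> b t \<noteq> 0"
    and "usual_conditions M T F"
    and "wiener_process M T F B"
    and "\<And>t. t \<in> time_dom T \<Longrightarrow> sets (F t) = augmented_natural_sets M B t"
    and "sets M = sigma_sets (space M) (\<Union>t\<in>time_dom T. sets (F t))"
    and "is_solution M T F B \<alpha> b \<sigma> X"
    and "is_integral_against_ito_process M T F B X (\<lambda>t \<omega>. \<alpha> * b t * X t \<omega>) (\<lambda>t \<omega>. \<sigma> t)
           (\<lambda>t \<omega>. b t * X t \<omega> / (\<sigma> t)\<^sup>2) J"
    and "filterlim (fisher_information M b \<sigma> X) at_top (up_to T)"
    and "((\<lambda>t. 1 / sqrt (fisher_information M b \<sigma> X t) * (b t / (\<sigma> t)\<^sup>2) *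
            (LBINT s:{0..t}. (\<sigma> s)\<^sup>2 * exp (2 * \<alpha> * (LBINT v:{s..t}. b v)))) \<longlongrightarrow> 0) (up_to T)"
  shows "converges_in_distribution M
           (\<lambda>t \<omega>. sqrt (LBINT u:{0..t}. (b u)\<^sup>2 * (X u \<omega>)\<^sup>2 / (\<sigma> u)\<^sup>2) * (mle b \<sigma> X J t \<omega> - \<alpha>))
           std_normal_distribution (up_to T)"
proof -
  interpret wiener_process M T F B by fact
  interpret mle_diffusion M T F B b \<sigma> \<alpha> X J by unfold_locales fact+
  show ?thesis using normalized_error_converges[OF assms(14,15)] unfolding A_def .
qed

end
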